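(* Let $\mathbb K$ be a field of characteristic $0$. For a group-like element $\Psi=\exp(\psi)$ of $\mathbb K\langle\langle A,B\rangle\rangle$ (with $\psi\in\widehat{\mathbb L}\langle A,B\rangle$), write $\Psi_t:=\Psi(t_{12},t_{23})\in\exp\mathcal P_3\subset\mathcal A_3$ and put $$\rho(\sigma_1)=\exp\left(\tfrac{t_{12}}{2}\right)\otimes s_1,\qquad \rho(\Delta)=\exp(T)\cdot\Psi_t^{-1}\otimes 321,\qquad (\ast)$$ where $\Delta=\sigma_1\sigma_2\sigma_1\in\mathcal B_3$ and $T=\frac12(t_{12}+t_{13}+t_{23})\in\mathcal P_3$. (a) If $\Psi$ is a semi-associator, then $(\ast)$ defines a universal representation $\rho:\mathcal B_3\to\mathcal A_3\rtimes\mathbb K[\Sigma_3]$. (b) Conversely, every universal representation $\rho$ of $\mathcal B_3$ has a unique parametrization of the form $(\ast)$ in which $\Psi$ is a semi-associator. In particular, $\Psi\mapsto\rho$ given by $(\ast)$ is a bijection between the set of semi-associators and the set of universal representations of $\mathcal B_3$.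
   Context: $\mathcal B_n$ is the Artin braid group with generators $\sigma_1,\dots,\sigma_{n-1}$ and relations $\sigma_i\sigma_j=\sigma_j\sigma_i$ for $|i-j|\ge2$ and $\sigma_{i+1}\sigma_i\sigma_{i+1}=\sigma_i\sigma_{i+1}\sigma_i$. It maps onto the symmetric group $\Sigma_n$ by $\sigma_i\mapsto s_i:=(i,i+1)$, and $\mathcal B_{n-1}\hookrightarrow\mathcal B_n$ via $\sigma_i\mapsto\sigma_i$. The group $\mathcal B_3$ is generated by $\sigma_1$ and $\Delta=\sigma_1\sigma_2\sigma_1$. $\mathbb K\langle\langle A_1,\dots,A_m\rangle\rangle$ is the completed free associative algebra (degree completion), a complete Hopf algebra with the $A_i$ primitive of degree $1$; $\widehat{\mathbb L}\langle A_1,\dots,A_m\rangle$ is the complete free Lie algebra of its primitive elements, and $\widehat{\mathbb L}^{>1}$ denotes the elements of it with zero linear part. Infinitesimal Artin algebras: $\mathcal A_n$ is the complete Hopf algebra, the quotient of $\mathbb K\langle\langle t_{ij}=t_{ji}\mid 1\le i\ne j\le n\rangle\rangle$ by the relations $[t_{ij},t_{ik}+t_{jk}]=0$ ($i,j,k$ distinct) and $[t_{ij},t_{kl}]=0$ if $\{i,j\}\cap\{k,l\}=\emptyset$; $\mathcal P_n$ is the complete Lie algebra with the same generators and relations, so that $\mathcal P_n$ is the primitive part of $\mathcal A_n$. The relation $f\equiv_2 g$ means that $f$ and $g$ have the same constant term and the same linear part. $\Sigma_n$ acts on the left on $\mathcal A_n$ and $\mathcal P_n$ by $\pi(t_{ij})=t_{\pi(i)\pi(j)}$,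 and one writes ${}^{\pi}\Phi:=\pi(\Phi)$. For $n=3$, $ijk$ denotes the permutation $1\mapsto i,2\mapsto j,3\mapsto k$. The braid algebra $\mathcal A_n\rtimes\mathbb K[\Sigma_n]$ is $\mathcal A_n\otimes\mathbb K[\Sigma_n]$ with product $(a\otimes x)(b\otimes y)=a\cdot{}^{x}b\otimes xy$; it contains the multiplicative subgroup $\exp\mathcal P_n\rtimes\Sigma_n$, with projection to $\Sigma_n$ and canonical embeddings $\exp\mathcal P_{n-1}\rtimes\Sigma_{n-1}\hookrightarrow\exp\mathcal P_n\rtimes\Sigma_n$. Semi-associator: an element $\Psi\in\mathbb K\langle\langle A,B\rangle\rangle$ such that, with $\Psi_t:=\Psi(t_{12},t_{23})\in\mathcal A_3$ and $s$ the involution exchanging $A$ and $B$: (AE) $\Psi=\exp(\psi)$ with $\psi\in\widehat{\mathbb L}^{>1}\langle A,B\rangle$; (AS) ${}^s\Psi=\Psi^{-1}$; (H1) $\exp(\frac{t_{12}+t_{13}}2)={}^{231}\Psi_t^{-1}\cdot\exp(\frac{t_{13}}2)\cdot{}^{213}\Psi_t\cdot\exp(\frac{t_{12}}2)\cdot\Psi_t^{-1}$ in $\mathcal A_3$; (H3) $\exp(\frac{t_{13}+t_{23}}2)={}^{312}\Psi_t\cdot\exp(\frac{t_{13}}2)\cdot{}^{132}\Psi_t^{-1}\cdot\exp(\frac{t_{23}}2)\cdot\Psi_t$ in $\mathcal A_3$. Universal representation of $\mathcal B_3$: a representation (multiplicative map) $\rho:\mathcal B_3\to\mathcal A_3\rtimes\mathbb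 K[\Sigma_3]$ such that, with $\rho_3=\rho$ and $\rho_2=\rho'$ its restriction to $\mathcal B_2$: (E) $\rho_n$ takes values in $\exp\mathcal P_n\rtimes\Sigma_n$ for $n=2,3$; ($\Sigma$) the composition of $\rho_n$ with the projection to $\Sigma_n$ is the canonical map $\mathcal B_n\to\Sigma_n$, $n=2,3$; (S) the restriction of $\rho_3$ to $\mathcal B_2$ is $\rho_2$ followed by the embedding $\exp\mathcal P_2\rtimes\Sigma_2\hookrightarrow\exp\mathcal P_3\rtimes\Sigma_3$ (in particular $\rho(\mathcal B_2)\subset\exp\mathcal P_2\rtimes\Sigma_2$); (N) $\rho_n(\sigma_i)=u_i\otimes s_i$ with $u_i\in\exp\mathcal P_n$ and $u_i\equiv_2 1+\frac{t_{i,i+1}}2$, for $1\le i<n$, $n=2,3$. *)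

theory Defs
  imports "HOL-Algebra.Sym_Groups" "HOL-Algebra.QuotRing"
begin

section \<open>Completed free associative algebras\<close>

text \<open>
  A noncommutative formal power series over the alphabet \<open>'x\<close> is the family of its coefficients,
  indexed by words.  For a finite alphabet these are exactly the elements of the degree completion
  of the free associative algebra.
\<close>

typedef ('x, 'k) ncps = "UNIV :: ('x list \<Rightarrow> 'k) set"
  morphisms coeff Abs_ncps ..

lemma coeff_Abs [simp]: "coeff (Abs_ncps f) = f"
  by (simp add: Abs_ncps_inverse)

lemma ncps_eqI: "(\<And>w. coeff f w = coeff g w) \<Longrightarrow> f = g"
  by (simp add: coeff_inject[symmetric] fun_eq_iff)

instantiation ncps :: (type, ring_1) ring_1
begin

definition "0 = Abs_ncps (\<lambda>w. 0)"
definition "1 = Abs_ncps (\<lambda>w. if w = [] then 1 else 0)"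
definition "f + g = Abs_ncps (\<lambda>w. coeff f w + coeff g w)"
definition "- f = Abs_ncps (\<lambda>w. - coeff f w)"
definition "f - g = Abs_ncps (\<lambda>w. coeff f w - coeff g w)"
definition "f * g = Abs_ncps (\<lambda>w. \<Sum>i\<le>length w. coeff f (take i w) * coeff g (drop i w))"

lemma coeff_zero [simp]: "coeff 0 w = 0"
  by (simp add: zero_ncps_def)

lemma coeff_one: "coeff 1 w = (if w = [] then 1 else 0)"
  by (simp add: one_ncps_def)

lemma coeff_add [simp]: "coeff (f + g) w = coeff f w + coeff g w"
  by (simp add: plus_ncps_def)

lemma coeff_uminus [simp]: "coeff (- f) w = - coeff f w"
  by (simp add: uminus_ncps_def)

lemma coeff_diff [simp]: "coeff (f - g) w = coeff f w - coeff g w"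
  by (simp add: minus_ncps_def)

lemma coeff_mult: "coeff (f * g) w = (\<Sum>i\<le>length w. coeff f (take i w) * coeff g (drop i w))"
  by (simp add: times_ncps_def)

lemma coeff_mult_assoc: "coeff (f * g * h) w = coeff (f * (g * h)) w"
proof -
  let ?F = "\<lambda>i j. coeff f (take i w) * coeff g (drop i (take j w)) * coeff h (drop j w)"
  have "coeff (f * g * h) w = (\<Sum>j\<le>length w. \<Sum>i\<le>j. ?F i j)"
    unfolding coeff_mult
    by (intro sum.cong refl) (auto simp: sum_distrib_right min_def intro!: sum.cong)
  also have "\<dots> = (\<Sum>(j, i)\<in>(SIGMA j:{..length w}. {..j}). ?F i j)"
    by (simp add: sum.Sigma)
  also have "\<dots> = (\<Sum>(i, l)\<in>(SIGMA i:{..length w}. {..length w - i}). ?F i (i + l))"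
    by (rule sum.reindex_bij_witness[where i = "\<lambda>(i, l). (i + l, i)" and j = "\<lambda>(j, i). (i, j - i)"])
      auto
  also have "\<dots> = (\<Sum>i\<le>length w. \<Sum>l\<le>length w - i. ?F i (i + l))"
    by (simp add: sum.Sigma)
  also have "\<dots> = coeff (f * (g * h)) w"
    unfolding coeff_mult
    by (intro sum.cong refl)
      (auto simp: sum_distrib_left mult.assoc take_drop add.commute intro!: sum.cong)
  finally show ?thesis .
qed

instance
proof
  fix f g h :: "('a, 'b) ncps"
  show "f * g * h = f * (g * h)"
    by (rule ncps_eqI) (rule coeff_mult_assoc)
  show "1 * f = f"
  proof (rule ncps_eqI)
    fix w
    have "coeff (1 * f) w = (\<Sum>i\<le>length w. if i = 0 then coeff f w else 0)"
      unfolding coeff_mult by (intro sum.cong refl) (auto simp: coeff_one)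
    then show "coeff (1 * f) w = coeff f w" by simp
  qed
  show "f * 1 = f"
  proof (rule ncps_eqI)
    fix w
    have "coeff (f * 1) w = (\<Sum>i\<le>length w. if i = length w then coeff f w else 0)"
      unfolding coeff_mult by (intro sum.cong refl) (auto simp: coeff_one)
    then show "coeff (f * 1) w = coeff f w" by simp
  qed
  show "(f + g) * h = f * h + g * h"
    by (rule ncps_eqI) (simp add: coeff_mult distrib_right sum.distrib)
  show "f * (g + h) = f * g + f * h"
    by (rule ncps_eqI) (simp add: coeff_mult distrib_left sum.distrib)
  show "(0 :: ('a, 'b) ncps) \<noteq> 1"
  proof
    assume "(0 :: ('a, 'b) ncps) = 1"
    then have "coeff (0 :: ('a, 'b) ncps) [] = coeff 1 []" by simp
    then show False by (simp add: coeff_one)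
  qed
qed (auto intro!: ncps_eqI simp: algebra_simps)

end

definition nc_var :: "'x \<Rightarrow> ('x, 'k::ring_1) ncps" where
  "nc_var a = Abs_ncps (\<lambda>w. if w = [a] then 1 else 0)"

definition nc_scale :: "'k::ring_1 \<Rightarrow> ('x, 'k) ncps \<Rightarrow> ('x, 'k) ncps" where
  "nc_scale c f = Abs_ncps (\<lambda>w. c * coeff f w)"

definition nc_bracket :: "('x, 'k::ring_1) ncps \<Rightarrow> ('x, 'k) ncps \<Rightarrow> ('x, 'k) ncps" where
  "nc_bracket f g = f * g - g * f"

text \<open>
  The exponential series.  If \<open>f\<close> has constant term \<open>0\<close>, the only case of interest, then the terms
  of exponent greater than the length of \<open>w\<close> do not contribute to the coefficient of \<open>w\<close>.
\<close>

definition nc_exp :: "('x, 'k::field_char_0) ncps \<Rightarrow> ('x, 'k) ncps" where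
  "nc_exp f = Abs_ncps (\<lambda>w. \<Sum>k\<le>length w. coeff (f ^ k) w / fact k)"

text \<open>
  For a finite set \<open>X\<close> of letters and elements \<open>\<phi> x\<close> with constant term \<open>0\<close>, this is the value at
  \<open>f\<close> of the continuous algebra homomorphism sending each letter \<open>x \<in> X\<close> to \<open>\<phi> x\<close>: words longer
  than \<open>w\<close> do not contribute to the coefficient of \<open>w\<close>.
\<close>

definition nc_subst ::
  "'x set \<Rightarrow> ('x \<Rightarrow> ('y, 'k::ring_1) ncps) \<Rightarrow> ('x, 'k) ncps \<Rightarrow> ('y, 'k) ncps" where
  "nc_subst X \<phi> f = Abs_ncps (\<lambda>w.
     \<Sum>v | set v \<subseteq> X \<and> length v \<le> length w. coeff f v * coeff (prod_list (map \<phi> v)) w)"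

text \<open>
  \<open>unshuffles w\<close> lists, with multiplicities, the terms \<open>u \<otimes> v\<close> of the expansion of
  \<open>\<Prod> (a \<otimes> 1 + 1 \<otimes> a)\<close>, the product being taken over the letters \<open>a\<close> of \<open>w\<close> in order.
  An element of the completed tensor square is given by its coefficients at pairs of words.
  In \<open>nc_coproduct\<close> the sum may be restricted to \<open>shuffles u v\<close>, since \<open>u \<otimes> v\<close> occurs in the
  coproduct of no other word.
\<close>

fun unshuffles :: "'x list \<Rightarrow> ('x list \<times> 'x list) list" where
  "unshuffles [] = [([], [])]"
| "unshuffles (a # w) =
     map (\<lambda>(u, v). (a # u, v)) (unshuffles w) @ map (\<lambda>(u, v). (u, a # v)) (unshuffles w)"

definition nc_coproduct :: "('x, 'k::ring_1) ncps \<Rightarrow> 'x list \<times> 'x list \<Rightarrow> 'k" where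
  "nc_coproduct f = (\<lambda>(u, v).
     \<Sum>w\<in>shuffles u v. coeff f w * of_nat (count_list (unshuffles w) (u, v)))"

definition nc_tensor :: "('x, 'k::ring_1) ncps \<Rightarrow> ('x, 'k) ncps \<Rightarrow> 'x list \<times> 'x list \<Rightarrow> 'k" where
  "nc_tensor f g = (\<lambda>(u, v). coeff f u * coeff g v)"

definition nc_primitive :: "('x, 'k::ring_1) ncps \<Rightarrow> bool" where
  "nc_primitive f \<longleftrightarrow> (\<forall>p. nc_coproduct f p = nc_tensor f 1 p + nc_tensor 1 f p)"

text \<open>
  \<open>nc_ring X\<close> is the completed free algebra on the finite subset \<open>X\<close> of the type of letters, and
  \<open>free_lie X\<close> is the complete free Lie algebra of its primitive elements.
\<close>

definition nc_ring :: "'x set \<Rightarrow> ('x, 'k::ring_1) ncps ring" where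
  "nc_ring X = \<lparr>carrier = {f. \<forall>w. coeff f w \<noteq> 0 \<longrightarrow> set w \<subseteq> X},
     mult = (*), one = 1, zero = 0, add = (+)\<rparr>"

definition free_lie :: "'x set \<Rightarrow> ('x, 'k::ring_1) ncps set" where
  "free_lie X = {f \<in> carrier (nc_ring X). nc_primitive f}"

definition free_lie_gt1 :: "'x set \<Rightarrow> ('x, 'k::ring_1) ncps set" where
  "free_lie_gt1 X = {f \<in> free_lie X. \<forall>a. coeff f [a] = 0}"


section \<open>Infinitesimal Artin algebras\<close>

text \<open>The letter of the generator \<open>t\<^sub>i\<^sub>j = t\<^sub>j\<^sub>i\<close> is the two-element set \<open>{i, j}\<close>.\<close>

definition edges :: "nat \<Rightarrow> nat set set" where
  "edges n = {{i, j} | i j. i \<in> {1..n} \<and> j \<in> {1..n} \<and> i \<noteq> j}"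

definition gen :: "nat \<Rightarrow> nat \<Rightarrow> (nat set, 'k::ring_1) ncps" where
  "gen i j = nc_var {i, j}"

definition artin_rels :: "nat \<Rightarrow> (nat set, 'k::ring_1) ncps set" where
  "artin_rels n =
     {nc_bracket (gen i j) (gen i k + gen j k) | i j k. {i, j, k} \<subseteq> {1..n} \<and> distinct [i, j, k]} \<union>
     {nc_bracket (gen i j) (gen k l) | i j k l.
        {i, j, k, l} \<subseteq> {1..n} \<and> i \<noteq> j \<and> k \<noteq> l \<and> {i, j} \<inter> {k, l} = {}}"

text \<open>The closure, in the degree topology, of the two-sided ideal generated by the relations.\<close>

definition artin_ideal :: "nat \<Rightarrow> (nat set, 'k::ring_1) ncps set" where
  "artin_ideal n = {f \<in> carrier (nc_ring (edges n)).
     \<forall>N. \<exists>g \<in> Idl\<^bsub>nc_ring (edges n)\<^esub> (artin_rels n). \<forall>w. length w \<le> N \<longrightarrow> coeff f w = coeff g w}"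

definition artin_alg :: "nat \<Rightarrow> (nat set, 'k::ring_1) ncps set ring" where
  "artin_alg n = nc_ring (edges n) Quot artin_ideal n"

definition artin_class :: "nat \<Rightarrow> (nat set, 'k::ring_1) ncps \<Rightarrow> (nat set, 'k) ncps set" where
  "artin_class n f = artin_ideal n +>\<^bsub>nc_ring (edges n)\<^esub> f"

text \<open>
  Operations on \<open>artin_alg n\<close> induced by operations on series are written as unions over the
  representatives of a coset (all of which yield the same class), as for \<^const>\<open>rcoset_mult\<close>.
\<close>

definition artin_exp ::
  "nat \<Rightarrow> (nat set, 'k::field_char_0) ncps set \<Rightarrow> (nat set, 'k) ncps set" where
  "artin_exp n c = (\<Union>f\<in>c. artin_class n (nc_exp f))"

definition artin_act ::
  "nat \<Rightarrow> (nat \<Rightarrow> nat) \<Rightarrow> (nat set, 'k::ring_1) ncps set \<Rightarrow> (nat set, 'k) ncps set" where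
  "artin_act n \<pi> c = (\<Union>f\<in>c. artin_class n (nc_subst (edges n) (\<lambda>e. nc_var (\<pi> ` e)) f))"

definition artin_embed ::
  "nat \<Rightarrow> (nat set, 'k::ring_1) ncps set \<Rightarrow> (nat set, 'k) ncps set" where
  "artin_embed n c = (\<Union>f\<in>c. artin_class (Suc n) f)"

text \<open>
  The complete Lie algebra with the same generators and relations, as a subset of \<open>artin_alg n\<close>:
  the image of the complete free Lie algebra on the generators.
\<close>

definition artin_lie :: "nat \<Rightarrow> (nat set, 'k::ring_1) ncps set set" where
  "artin_lie n = artin_class n ` free_lie (edges n)"

definition exp_artin_lie :: "nat \<Rightarrow> (nat set, 'k::field_char_0) ncps set set" where
  "exp_artin_lie n = artin_exp n ` artin_lie n"

text \<open>
  The relation \<open>\<equiv>\<^sub>2\<close>.  The relations of \<open>artin_alg n\<close> being homogeneous of degree 2, the constant and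
  linear terms of a representative depend only on its class.
\<close>

definition equiv2 :: "(nat set, 'k::ring_1) ncps set \<Rightarrow> (nat set, 'k) ncps set \<Rightarrow> bool" where
  "equiv2 c d \<longleftrightarrow> (\<forall>f\<in>c. \<forall>g\<in>d. \<forall>w. length w \<le> 1 \<longrightarrow> coeff f w = coeff g w)"


section \<open>Braid algebras\<close>

text \<open>
  An element \<open>\<Sum> a\<^sub>x \<otimes> x\<close> of \<open>\<A>\<^sub>n \<otimes> \<K>[\<Sigma>\<^sub>n]\<close> is the function \<open>x \<mapsto> a\<^sub>x\<close> on \<open>\<Sigma>\<^sub>n\<close>.  Products in
  \<^const>\<open>sym_group\<close> are compositions of functions, the right factor being applied first.
\<close>

definition braid_alg :: "nat \<Rightarrow> ((nat \<Rightarrow> nat) \<Rightarrow> (nat set, 'k::ring_1) ncps set) ring" where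
  "braid_alg n = \<lparr>
     carrier = carrier (sym_group n) \<rightarrow>\<^sub>E carrier (artin_alg n),
     mult = (\<lambda>F G. \<lambda>z\<in>carrier (sym_group n).
       finsum (artin_alg n) (\<lambda>(x, y). F x \<otimes>\<^bsub>artin_alg n\<^esub> artin_act n x (G y))
         {(x, y). x \<in> carrier (sym_group n) \<and> y \<in> carrier (sym_group n) \<and>
                  x \<otimes>\<^bsub>sym_group n\<^esub> y = z}),
     one = (\<lambda>z\<in>carrier (sym_group n). if z = \<one>\<^bsub>sym_group n\<^esub> then \<one>\<^bsub>artin_alg n\<^esub> else \<zero>\<^bsub>artin_alg n\<^esub>),
     zero = (\<lambda>z\<in>carrier (sym_group n). \<zero>\<^bsub>artin_alg n\<^esub>),
     add = (\<lambda>F G. \<lambda>z\<in>carrier (sym_group n). F z \<oplus>\<^bsub>artin_alg n\<^esub> G z)\<rparr>"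

definition smash :: "nat \<Rightarrow> (nat set, 'k::ring_1) ncps set \<Rightarrow> (nat \<Rightarrow> nat) \<Rightarrow>
    (nat \<Rightarrow> nat) \<Rightarrow> (nat set, 'k) ncps set" where
  "smash n a x = (\<lambda>z\<in>carrier (sym_group n). if z = x then a else \<zero>\<^bsub>artin_alg n\<^esub>)"

definition exp_group :: "nat \<Rightarrow> ((nat \<Rightarrow> nat) \<Rightarrow> (nat set, 'k::field_char_0) ncps set) set" where
  "exp_group n = {smash n a x | a x. a \<in> exp_artin_lie n \<and> x \<in> carrier (sym_group n)}"

definition exp_group_perm ::
  "nat \<Rightarrow> ((nat \<Rightarrow> nat) \<Rightarrow> (nat set, 'k::field_char_0) ncps set) \<Rightarrow> nat \<Rightarrow> nat" where
  "exp_group_perm n F =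
     (THE x. x \<in> carrier (sym_group n) \<and> (\<exists>a\<in>exp_artin_lie n. F = smash n a x))"

text \<open>
  As functions on \<open>nat\<close>, the permutations of \<open>{1..n}\<close> are also permutations of \<open>{1..Suc n}\<close>.
\<close>

definition braid_alg_embed :: "nat \<Rightarrow> ((nat \<Rightarrow> nat) \<Rightarrow> (nat set, 'k::ring_1) ncps set) \<Rightarrow>
    (nat \<Rightarrow> nat) \<Rightarrow> (nat set, 'k) ncps set" where
  "braid_alg_embed n F = (\<lambda>z\<in>carrier (sym_group (Suc n)).
     if z \<in> carrier (sym_group n) then artin_embed n (F z) else \<zero>\<^bsub>artin_alg (Suc n)\<^esub>)"


section \<open>Braid groups\<close>

text \<open>
  The letter \<open>(i, True)\<close> stands for \<open>\<sigma>\<^sub>i\<close> and \<open>(i, False)\<close> for its inverse.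
\<close>

definition braid_words :: "nat \<Rightarrow> (nat \<times> bool) list set" where
  "braid_words n = lists ({1..<n} \<times> UNIV)"

inductive braid_eq :: "nat \<Rightarrow> (nat \<times> bool) list \<Rightarrow> (nat \<times> bool) list \<Rightarrow> bool" for n where
  refl: "u \<in> braid_words n \<Longrightarrow> braid_eq n u u"
| sym: "braid_eq n u v \<Longrightarrow> braid_eq n v u"
| trans: "braid_eq n u v \<Longrightarrow> braid_eq n v w \<Longrightarrow> braid_eq n u w"
| cong: "braid_eq n u v \<Longrightarrow> x \<in> braid_words n \<Longrightarrow> y \<in> braid_words n \<Longrightarrow>
    braid_eq n (x @ u @ y) (x @ v @ y)"
| cancel: "i \<in> {1..<n} \<Longrightarrow> braid_eq n [(i, b), (i, \<not> b)] []"
| far: "i \<in> {1..<n} \<Longrightarrow> j \<in> {1..<n} \<Longrightarrow> i + 2 \<le> j \<Longrightarrow>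
    braid_eq n [(i, True), (j, True)] [(j, True), (i, True)]"
| braid: "i \<in> {1..<n} \<Longrightarrow> Suc i \<in> {1..<n} \<Longrightarrow>
    braid_eq n [(Suc i, True), (i, True), (Suc i, True)] [(i, True), (Suc i, True), (i, True)]"

definition braid_class :: "nat \<Rightarrow> (nat \<times> bool) list \<Rightarrow> (nat \<times> bool) list set" where
  "braid_class n u = {v. braid_eq n u v}"

definition braid_group :: "nat \<Rightarrow> (nat \<times> bool) list set monoid" where
  "braid_group n = \<lparr>carrier = braid_class n ` braid_words n,
     mult = (\<lambda>\<alpha> \<beta>. \<Union>u\<in>\<alpha>. \<Union>v\<in>\<beta>. braid_class n (u @ v)),
     one = braid_class n []\<rparr>"

definition sigma :: "nat \<Rightarrow> nat \<Rightarrow> (nat \<times> bool) list set" where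
  "sigma n i = braid_class n [(i, True)]"

definition Delta :: "(nat \<times> bool) list set" where
  "Delta = sigma 3 1 \<otimes>\<^bsub>braid_group 3\<^esub> sigma 3 2 \<otimes>\<^bsub>braid_group 3\<^esub> sigma 3 1"

definition adj_transp :: "nat \<Rightarrow> nat \<Rightarrow> nat" where
  "adj_transp i = transpose i (Suc i)"

text \<open>The canonical map to \<open>\<Sigma>\<^sub>n\<close>; both \<open>\<sigma>\<^sub>i\<close> and its inverse are sent to \<open>adj_transp i\<close>.\<close>

definition braid_perm :: "(nat \<times> bool) list set \<Rightarrow> nat \<Rightarrow> nat" where
  "braid_perm \<beta> = the_elem ((\<lambda>w. foldr (\<lambda>(i, b) p. adj_transp i \<circ> p) w id) ` \<beta>)"

definition braid_embed :: "nat \<Rightarrow> (nat \<times> bool) list set \<Rightarrow> (nat \<times> bool) list set" where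
  "braid_embed n \<beta> = (\<Union>w\<in>\<beta>. braid_class (Suc n) w)"


section \<open>Semi-associators and universal representations\<close>

datatype letter = LA | LB

definition nc_swap :: "(letter, 'k::ring_1) ncps \<Rightarrow> (letter, 'k) ncps" where
  "nc_swap = nc_subst UNIV (\<lambda>a. case a of LA \<Rightarrow> nc_var LB | LB \<Rightarrow> nc_var LA)"

definition Psi_t :: "(letter, 'k::ring_1) ncps \<Rightarrow> (nat set, 'k) ncps set" where
  "Psi_t \<Psi> = artin_class 3 (nc_subst UNIV (\<lambda>a. case a of LA \<Rightarrow> gen 1 2 | LB \<Rightarrow> gen 2 3) \<Psi>)"

text \<open>\<open>perm3 i j k\<close> is the permutation written \<open>ijk\<close>.\<close>

definition perm3 :: "nat \<Rightarrow> nat \<Rightarrow> nat \<Rightarrow> nat \<Rightarrow> nat" where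
  "perm3 i j k = id(1 := i, 2 := j, 3 := k)"

definition exp_half :: "nat \<Rightarrow> (nat set, 'k::field_char_0) ncps \<Rightarrow> (nat set, 'k) ncps set" where
  "exp_half n f = artin_exp n (artin_class n (nc_scale (1/2) f))"

definition semi_associator :: "(letter, 'k::field_char_0) ncps \<Rightarrow> bool" where
  "semi_associator \<Psi> \<longleftrightarrow>
     (\<exists>\<psi>\<in>free_lie_gt1 UNIV. \<Psi> = nc_exp \<psi>) \<and>
     nc_swap \<Psi> = inv\<^bsub>nc_ring UNIV\<^esub> \<Psi> \<and>
     exp_half 3 (gen 1 2 + gen 1 3) =
       inv\<^bsub>artin_alg 3\<^esub> (artin_act 3 (perm3 2 3 1) (Psi_t \<Psi>)) \<otimes>\<^bsub>artin_alg 3\<^esub>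
       exp_half 3 (gen 1 3) \<otimes>\<^bsub>artin_alg 3\<^esub>
       artin_act 3 (perm3 2 1 3) (Psi_t \<Psi>) \<otimes>\<^bsub>artin_alg 3\<^esub>
       exp_half 3 (gen 1 2) \<otimes>\<^bsub>artin_alg 3\<^esub>
       inv\<^bsub>artin_alg 3\<^esub> (Psi_t \<Psi>) \<and>
     exp_half 3 (gen 1 3 + gen 2 3) =
       artin_act 3 (perm3 3 1 2) (Psi_t \<Psi>) \<otimes>\<^bsub>artin_alg 3\<^esub>
       exp_half 3 (gen 1 3) \<otimes>\<^bsub>artin_alg 3\<^esub>
       inv\<^bsub>artin_alg 3\<^esub> (artin_act 3 (perm3 1 3 2) (Psi_t \<Psi>)) \<otimes>\<^bsub>artin_alg 3\<^esub>
       exp_half 3 (gen 2 3) \<otimes>\<^bsub>artin_alg 3\<^esub>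
       Psi_t \<Psi>"

text \<open>
  Representations are taken to be \<^const>\<open>undefined\<close> outside the carrier of the braid group, so that
  equality of functions is equality of representations.
\<close>

definition braid_reps :: "nat \<Rightarrow>
    ((nat \<times> bool) list set \<Rightarrow> (nat \<Rightarrow> nat) \<Rightarrow> (nat set, 'k::ring_1) ncps set) set" where
  "braid_reps n = hom (braid_group n) (braid_alg n) \<inter> extensional (carrier (braid_group n))"

text \<open>Conditions (E), (\<open>\<Sigma>\<close>) and (N) for a representation of the braid group on \<open>n\<close> strands.\<close>

definition normalized_rep :: "nat \<Rightarrow>
    ((nat \<times> bool) list set \<Rightarrow> (nat \<Rightarrow> nat) \<Rightarrow> (nat set, 'k::field_char_0) ncps set) \<Rightarrow> bool" where
  "normalized_rep n \<rho> \<longleftrightarrow>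
     (\<forall>\<beta>\<in>carrier (braid_group n). \<rho> \<beta> \<in> exp_group n) \<and>
     (\<forall>\<beta>\<in>carrier (braid_group n). exp_group_perm n (\<rho> \<beta>) = braid_perm \<beta>) \<and>
     (\<forall>i\<in>{1..<n}. \<exists>u\<in>exp_artin_lie n. \<rho> (sigma n i) = smash n u (adj_transp i) \<and>
        equiv2 u (artin_class n (1 + nc_scale (1/2) (gen i (Suc i)))))"

definition universal_rep ::
  "((nat \<times> bool) list set \<Rightarrow> (nat \<Rightarrow> nat) \<Rightarrow> (nat set, 'k::field_char_0) ncps set) \<Rightarrow> bool" where
  "universal_rep \<rho> \<longleftrightarrow> \<rho> \<in> braid_reps 3 \<and> normalized_rep 3 \<rho> \<and>
     (\<exists>\<rho>'\<in>braid_reps 2. normalized_rep 2 \<rho>' \<and>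
        (\<forall>\<beta>\<in>carrier (braid_group 2). \<rho> (braid_embed 2 \<beta>) = braid_alg_embed 2 (\<rho>' \<beta>)))"

text \<open>The two formulas \<open>(\<ast>)\<close> relating a representation \<open>\<rho>\<close> to a series \<open>\<Psi>\<close>.\<close>

definition parametrizes :: "(letter, 'k::field_char_0) ncps \<Rightarrow>
    ((nat \<times> bool) list set \<Rightarrow> (nat \<Rightarrow> nat) \<Rightarrow> (nat set, 'k) ncps set) \<Rightarrow> bool" where
  "parametrizes \<Psi> \<rho> \<longleftrightarrow>
     \<rho> (sigma 3 1) = smash 3 (exp_half 3 (gen 1 2)) (adj_transp 1) \<and>
     \<rho> Delta = smash 3
       (exp_half 3 (gen 1 2 + gen 1 3 + gen 2 3) \<otimes>\<^bsub>artin_alg 3\<^esub> inv\<^bsub>artin_alg 3\<^esub> (Psi_t \<Psi>)) (perm3 3 2 1)"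

end

theory Submission
  imports Defs
begin

text \<open>
  In terms of the generators \<open>\<sigma>\<^sub>1\<close> and \<open>\<Delta>\<close>, the braid group \<open>B\<^sub>3\<close> has the single defining relation
  \<open>\<Delta> \<sigma>\<^sub>1\<^sup>-\<^sup>1 \<Delta> = \<sigma>\<^sub>1 \<Delta> \<sigma>\<^sub>1\<close>.  For the values \<open>(\<ast>)\<close> both sides of it can be multiplied out in
  \<open>exp P\<^sub>3 \<rtimes> \<Sigma>\<^sub>3\<close>.  The factors \<open>exp T\<close> are central, and \<open>exp T = exp (t\<^sub>1\<^sub>2/2) exp ((t\<^sub>1\<^sub>3 + t\<^sub>2\<^sub>3)/2)\<close>; what
  remains is an equation in \<open>exp P\<^sub>3\<close> that agrees with (H3) once (AS) is used to rewrite two of its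
  factors, and (H1) is its image under the permutation \<open>321\<close> (\<open>braid_relation_iff_hexagon\<close>,
  \<open>semi_associator_iff\<close>).  So a semi-associator defines a representation (\<open>semi_associator_rep\<close>), and
  the normalization of its values is a matter of linear parts.

  Conversely, let \<open>\<rho>\<close> be a universal representation.  As \<open>P\<^sub>2\<close> is one-dimensional, the value at \<open>\<sigma>\<^sub>1\<close> is
  the prescribed one.  The value at \<open>\<Delta>\<close> is \<open>exp h\<close> for a Lie series \<open>h\<close> with linear part \<open>T\<close>.  Now \<open>P\<^sub>3\<close> is
  the product of the line spanned by the central element \<open>2T\<close> and the free Lie algebra on \<open>t\<^sub>1\<^sub>2\<close> and
  \<open>t\<^sub>2\<^sub>3\<close> (\<open>art_of_lie\<close>), hence \<open>exp h = exp T \<cdot> \<Psi>\<^sub>t\<^sup>-\<^sup>1\<close> with \<open>\<Psi> = exp \<psi>\<close> and \<open>\<psi>\<close> without linear part.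
  The series \<open>\<Psi>\<close> is unique because the free algebra embeds into \<open>A\<^sub>3\<close>.  Since \<open>\<Delta>\<^sup>2\<close> commutes with
  \<open>\<sigma>\<^sub>1\<^sup>2\<close>, the series \<open>G = \<Psi>\<^sup>-\<^sup>1 \<cdot> \<^sup>s\<Psi>\<^sup>-\<^sup>1\<close> commutes with \<open>exp A\<close>, thus with \<open>A\<close>.  A group-like series
  with this property is the exponential of a multiple of \<open>A\<close>, and the linear part of \<open>G\<close> is \<open>0\<close>.
  So \<open>G = 1\<close>, which is (AS) (\<open>braid_relation_AS\<close>).  The braid relation now gives (H1) and (H3).

  Two general facts on power series carry these arguments.  Exponentials of primitive series form a
  group (\<open>free_lie_exp_mult\<close>): they are the group-like series, as is seen by means of the injectivity
  of the exponential on the tensor square.  And substitution of sums of commuting elements into a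
  primitive series is additive (\<open>is_subst_primitive_add\<close>).  The latter shows that substitutions
  preserve primitive series, and it splits off the centre of \<open>P\<^sub>3\<close> without any description of
  the free Lie algebra by brackets.
\<close>

section \<open>Exponentials and substitution in filtered algebras\<close>

text \<open>
  The free algebra, its tensor square and the quotient \<open>artin_alg 3\<close> are all algebras with a
  separated filtration by ideals.  Infinite sums enter through \<open>approx\<close>: the partial sum \<open>s N\<close> is
  correct up to degree \<open>N\<close>.  Exponentials and substitutions are relations rather than functions, so
  that they make sense in every such algebra and are carried along by homomorphisms; separatedness
  makes their values unique.
\<close>

locale filtered_algebra =
  fixes F :: "nat \<Rightarrow> 'a::ring_1 set" and sc :: "'k::field_char_0 \<Rightarrow> 'a"
  assumes F_0 [simp]: "F 0 = UNIV"
    and F_zero [simp]: "0 \<in> F n"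
    and F_diff: "x \<in> F n \<Longrightarrow> y \<in> F n \<Longrightarrow> x - y \<in> F n"
    and F_mono: "m \<le> n \<Longrightarrow> x \<in> F n \<Longrightarrow> x \<in> F m"
    and F_mult: "x \<in> F m \<Longrightarrow> y \<in> F n \<Longrightarrow> x * y \<in> F (m + n)"
    and F_separated: "(\<And>n. x \<in> F n) \<Longrightarrow> x = 0"
    and sc_1 [simp]: "sc 1 = 1"
    and sc_add: "sc (c + d) = sc c + sc d"
    and sc_mult: "sc (c * d) = sc c * sc d"
    and sc_commute: "sc c * x = x * sc c"
begin

lemma F_uminus: "x \<in> F n \<Longrightarrow> - x \<in> F n"
  using F_diff[of 0 n x] by simp

lemma F_add: "x \<in> F n \<Longrightarrow> y \<in> F n \<Longrightarrow> x + y \<in> F n"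
  using F_diff[of x n "- y"] F_uminus[of y n] by simp

lemma F_sum: "(\<And>i. i \<in> I \<Longrightarrow> x i \<in> F n) \<Longrightarrow> sum x I \<in> F n"
  by (induction I rule: infinite_finite_induct) (auto intro: F_add)

lemma F_mult_left: "y \<in> F n \<Longrightarrow> x * y \<in> F n"
  using F_mult[of x 0 y n] by simp

lemma F_mult_right: "x \<in> F n \<Longrightarrow> x * y \<in> F n"
  using F_mult[of x n y 0] by simp

lemma F_diff_sym: "x - y \<in> F n \<Longrightarrow> y - x \<in> F n"
  using F_uminus[of "x - y" n] by simp

lemma F_diff_trans: "x - y \<in> F n \<Longrightarrow> y - z \<in> F n \<Longrightarrow> x - z \<in> F n"
  using F_add[of "x - y" n "y - z"] by simp

lemma F_diff_mult:
  assumes "x - x' \<in> F n" "y - y' \<in> F n" shows "x * y - x' * y' \<in> F n"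
proof -
  have "x * y - x' * y' = (x - x') * y + x' * (y - y')"
    by (simp add: algebra_simps)
  then show ?thesis
    using F_add[OF F_mult_right[OF assms(1)] F_mult_left[OF assms(2)]] by simp
qed

lemma F_power: "x \<in> F 1 \<Longrightarrow> x ^ k \<in> F k"
proof (induction k)
  case (Suc k)
  then show ?case using F_mult[of x 1 "x ^ k" k] by simp
qed simp

lemma sc_0 [simp]: "sc 0 = 0"
  using sc_add[of 0 0] by simp

lemma sc_sum: "sc (sum c I) = (\<Sum>i\<in>I. sc (c i))"
  by (induction I rule: infinite_finite_induct) (auto simp: sc_add)

lemma sc_of_nat: "sc (of_nat n) = of_nat n"
  by (induction n) (auto simp: sc_add)

definition approx :: "(nat \<Rightarrow> 'a) \<Rightarrow> 'a \<Rightarrow> bool" where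
  "approx s r \<longleftrightarrow> (\<forall>N. r - s N \<in> F (Suc N))"

lemma approx_unique: "approx s r \<Longrightarrow> approx s r' \<Longrightarrow> r = r'"
proof -
  assume a: "approx s r" "approx s r'"
  have "r - r' \<in> F n" for n
  proof (rule F_mono[of n "Suc n"])
    have "r - s n \<in> F (Suc n)" "s n - r' \<in> F (Suc n)"
      using a by (auto simp: approx_def intro: F_diff_sym)
    then show "r - r' \<in> F (Suc n)" by (rule F_diff_trans)
  qed simp
  then show ?thesis using F_separated[of "r - r'"] by simp
qed

lemma approx_add: "approx s r \<Longrightarrow> approx t q \<Longrightarrow> approx (\<lambda>N. s N + t N) (r + q)"
  unfolding approx_def
  by (metis F_add add_diff_eq diff_add_eq diff_diff_eq)

lemma approx_mult: "approx s r \<Longrightarrow> approx t q \<Longrightarrow> approx (\<lambda>N. s N * t N) (r * q)"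
  unfolding approx_def by (blast intro: F_diff_mult)

lemma approx_close:
  assumes "approx s r" "\<And>N. s N - t N \<in> F (Suc N)" shows "approx t r"
  using assms unfolding approx_def by (blast intro: F_diff_trans)

subsection \<open>Exponentials\<close>

definition exp_partial :: "'a \<Rightarrow> nat \<Rightarrow> 'a" where
  "exp_partial a N = (\<Sum>k\<le>N. sc (1 / fact k) * a ^ k)"

definition is_exp :: "'a \<Rightarrow> 'a \<Rightarrow> bool" where
  "is_exp a e \<longleftrightarrow> approx (exp_partial a) e"

lemma is_exp_unique: "is_exp a e \<Longrightarrow> is_exp a e' \<Longrightarrow> e = e'"
  unfolding is_exp_def by (rule approx_unique)

lemma is_exp_0: "is_exp 0 1"
proof -
  have "exp_partial 0 N = 1" for N
    unfolding exp_partial_def by (simp add: power_0_left if_distrib sum.delta cong: if_cong)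
  then show ?thesis by (simp add: is_exp_def approx_def)
qed

text \<open>
  The binomial theorem for commuting elements in divided-power form, so that the exponential
  series multiply without rearranging binomial coefficients.
\<close>

lemma divided_power_add:
  assumes "a * b = b * a"
  shows "sc (1 / fact n) * (a + b) ^ n =
    (\<Sum>i\<le>n. (sc (1 / fact i) * a ^ i) * (sc (1 / fact (n - i)) * b ^ (n - i)))"
proof (induction n)
  case 0 then show ?case by simp
next
  case (Suc n)
  let ?A = "\<lambda>i. sc (1 / fact i) * a ^ i"
  let ?B = "\<lambda>i. sc (1 / fact i) * b ^ i"
  have stepA: "a * ?A i = of_nat (Suc i) * ?A (Suc i)" for i
  proof -
    have "of_nat (Suc i) * ?A (Suc i) = sc (of_nat (Suc i) * (1 / fact (Suc i))) * a ^ Suc i"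
      by (simp only: sc_mult[of "of_nat (Suc i)"] sc_of_nat mult.assoc)
    also have "of_nat (Suc i) * (1 / fact (Suc i)) = (1 / fact i :: 'k)"
      by (simp add: fact_Suc field_simps del: of_nat_Suc)
    finally show ?thesis by (simp add: mult.assoc[symmetric] sc_commute[of _ a])
  qed
  have stepB: "b * ?B i = of_nat (Suc i) * ?B (Suc i)" for i
  proof -
    have "of_nat (Suc i) * ?B (Suc i) = sc (of_nat (Suc i) * (1 / fact (Suc i))) * b ^ Suc i"
      by (simp only: sc_mult[of "of_nat (Suc i)"] sc_of_nat mult.assoc)
    also have "of_nat (Suc i) * (1 / fact (Suc i)) = (1 / fact i :: 'k)"
      by (simp add: fact_Suc field_simps del: of_nat_Suc)
    finally show ?thesis by (simp add: mult.assoc[symmetric] sc_commute[of _ b])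
  qed
  have of_nat_left_commute: "x * (of_nat k * y) = of_nat k * (x * y)" for x y :: 'a and k
    by (metis mult.assoc mult_of_nat_commute)
  have bA: "b * ?A i = ?A i * b" for i
  proof -
    have "b * a ^ i = a ^ i * b"
      using assms by (metis power_commuting_commutes)
    then show ?thesis by (metis mult.assoc sc_commute)
  qed
  have "of_nat (Suc n) * (sc (1 / fact (Suc n)) * (a + b) ^ Suc n)
      = sc (of_nat (Suc n) * (1 / fact (Suc n))) * (a + b) ^ Suc n"
    by (simp only: sc_mult[of "of_nat (Suc n)"] sc_of_nat mult.assoc)
  also have "of_nat (Suc n) * (1 / fact (Suc n)) = (1 / fact n :: 'k)"
    by (simp add: fact_Suc field_simps del: of_nat_Suc)
  also have "sc (1 / fact n) * (a + b) ^ Suc n = (a + b) * (sc (1 / fact n) * (a + b) ^ n)"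
    by (simp add: mult.assoc[symmetric] sc_commute[of _ "a + b"])
  also have "\<dots> = (\<Sum>i\<le>n. a * (?A i * ?B (n - i))) + (\<Sum>i\<le>n. b * (?A i * ?B (n - i)))"
    by (simp only: Suc.IH distrib_right sum_distrib_left sum.distrib)
  also have "(\<Sum>i\<le>n. a * (?A i * ?B (n - i))) = (\<Sum>i\<le>n. of_nat (Suc i) * (?A (Suc i) * ?B (n - i)))"
    by (intro sum.cong HOL.refl) (simp only: mult.assoc[symmetric] stepA[unfolded mult.assoc[symmetric]])
  also have "\<dots> = (\<Sum>i\<le>Suc n. of_nat i * (?A i * ?B (Suc n - i)))"
    by (simp only: sum.atMost_Suc_shift diff_Suc_Suc of_nat_0 mult_zero_left add_0_left)
  also have "(\<Sum>i\<le>n. b * (?A i * ?B (n - i))) = (\<Sum>i\<le>n. ?A i * (b * ?B (n - i)))"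
    by (intro sum.cong HOL.refl) (simp only: mult.assoc[symmetric] bA[unfolded mult.assoc[symmetric]])
  also have "\<dots> = (\<Sum>i\<le>n. of_nat (Suc n - i) * (?A i * ?B (Suc n - i)))"
    by (intro sum.cong HOL.refl) (simp only: stepB Suc_diff_le atMost_iff of_nat_left_commute)
  also have "\<dots> = (\<Sum>i\<le>Suc n. of_nat (Suc n - i) * (?A i * ?B (Suc n - i)))"
    by simp
  also have "(\<Sum>i\<le>Suc n. of_nat i * (?A i * ?B (Suc n - i))) + \<dots>
      = (\<Sum>i\<le>Suc n. of_nat (Suc n) * (?A i * ?B (Suc n - i)))"
    by (simp only: sum.distrib[symmetric])
      (intro sum.cong HOL.refl, simp only: distrib_right[symmetric] of_nat_add[symmetric], simp)
  also have "\<dots> = of_nat (Suc n) * (\<Sum>i\<le>Suc n. ?A i * ?B (Suc n - i))"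
    by (simp only: sum_distrib_left)
  finally have "of_nat (Suc n) * (sc (1 / fact (Suc n)) * (a + b) ^ Suc n)
      = of_nat (Suc n) * (\<Sum>i\<le>Suc n. ?A i * ?B (Suc n - i))" .
  then have "sc (1 / of_nat (Suc n)) * (of_nat (Suc n) * (sc (1 / fact (Suc n)) * (a + b) ^ Suc n))
      = sc (1 / of_nat (Suc n)) * (of_nat (Suc n) * (\<Sum>i\<le>Suc n. ?A i * ?B (Suc n - i)))"
    by (rule arg_cong)
  moreover have "sc (1 / of_nat (Suc n)) * of_nat (Suc n) = 1"
    by (simp only: sc_of_nat[symmetric] sc_mult[symmetric])
      (simp del: of_nat_Suc)
  ultimately show ?case
    by (simp only: mult.assoc[symmetric]) simp
qed

lemma is_exp_add:
  assumes "a * b = b * a" "a \<in> F 1" "b \<in> F 1" "is_exp a e" "is_exp b e'"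
  shows "is_exp (a + b) (e * e')"
proof -
  let ?t = "\<lambda>i j. (sc (1 / fact i) * a ^ i) * (sc (1 / fact j) * b ^ j)"
  have "approx (\<lambda>N. exp_partial a N * exp_partial b N) (e * e')"
    using assms(4,5) unfolding is_exp_def by (rule approx_mult)
  then have "approx (exp_partial (a + b)) (e * e')"
  proof (rule approx_close)
    fix N :: nat
    let ?S = "{(i, j). i + j \<le> N}"
    have fin: "finite ({..N} \<times> {..N})" by (intro finite_cartesian_product finite_atMost)
    have "exp_partial a N * exp_partial b N = (\<Sum>(i, j)\<in>{..N} \<times> {..N}. ?t i j)"
      unfolding exp_partial_def sum_product by (simp add: sum.cartesian_product)
    also have "\<dots> = (\<Sum>(i, j)\<in>?S. ?t i j) + (\<Sum>(i, j)\<in>{..N} \<times> {..N} - ?S. ?t i j)"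
      using fin by (subst sum.subset_diff[of ?S]) (auto simp: add.commute)
    also have "(\<Sum>(i, j)\<in>?S. ?t i j) = (\<Sum>n\<le>N. \<Sum>i\<le>n. ?t i (n - i))"
      by (rule sum.triangle_reindex_eq)
    also have "\<dots> = exp_partial (a + b) N"
      unfolding exp_partial_def by (simp only: divided_power_add[OF assms(1)])
    finally have "exp_partial a N * exp_partial b N - exp_partial (a + b) N
        = (\<Sum>(i, j)\<in>{..N} \<times> {..N} - ?S. ?t i j)" by simp
    also have "\<dots> \<in> F (Suc N)"
    proof -
      have "?t i j \<in> F (Suc N)" if "\<not> i + j \<le> N" for i j
        by (rule F_mono[OF _ F_mult[OF F_mult_left[OF F_power[OF assms(2), of i]]
              F_mult_left[OF F_power[OF assms(3), of j]]]]) (use that in auto)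
      then show ?thesis by (intro F_sum) auto
    qed
    finally show "exp_partial a N * exp_partial b N - exp_partial (a + b) N \<in> F (Suc N)" .
  qed
  then show ?thesis by (simp add: is_exp_def)
qed

lemma is_exp_inverse:
  assumes "a \<in> F 1" "is_exp a e" "is_exp (- a) e'" shows "e * e' = 1"
  using is_exp_add[of a "- a" e e'] assms is_exp_unique[OF _ is_exp_0]
  by (auto intro: F_uminus)

lemma is_exp_conjugate:
  assumes "u * v = 1" "v * u = 1" "is_exp a e" shows "is_exp (u * a * v) (u * e * v)"
proof -
  have pow: "(u * a * v) ^ k = u * a ^ k * v" for k
  proof (induction k)
    case (Suc k)
    have "(u * a * v) ^ Suc k = u * a * (v * u) * a ^ k * v"
      unfolding power_Suc Suc by (simp only: mult.assoc)
    then show ?case by (simp add: assms(2) mult.assoc)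
  qed (simp add: assms(1))
  have "exp_partial (u * a * v) N = u * exp_partial a N * v" for N
    unfolding exp_partial_def pow sum_distrib_left sum_distrib_right
  proof (rule sum.cong[OF HOL.refl])
    show "sc (1 / fact k) * (u * a ^ k * v) = u * (sc (1 / fact k) * a ^ k) * v" for k
      using sc_commute[of "1 / fact k" u] by (metis mult.assoc)
  qed
  moreover have "u * e * v - u * s * v = u * (e - s) * v" for s
    by (simp add: algebra_simps)
  ultimately show ?thesis
    using assms(3) by (simp add: is_exp_def approx_def F_mult_left F_mult_right)
qed

lemma is_exp_commute:
  assumes "a * x = x * a" "is_exp a e" shows "e * x = x * e"
proof -
  have "exp_partial a N * x = x * exp_partial a N" for N
    unfolding exp_partial_def sum_distrib_left sum_distrib_right
  proof (rule sum.cong[OF HOL.refl])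
    fix k
    have "a ^ k * x = x * a ^ k" using assms(1) by (metis power_commuting_commutes)
    then show "sc (1 / fact k) * a ^ k * x = x * (sc (1 / fact k) * a ^ k)"
      by (metis mult.assoc sc_commute)
  qed
  then have "e * x - x * e = (e - exp_partial a N) * x - x * (e - exp_partial a N)" for N
    by (simp add: algebra_simps)
  then have "e * x - x * e \<in> F (Suc N)" for N
    using assms(2) F_diff[OF F_mult_right F_mult_left] by (metis approx_def is_exp_def)
  then have "e * x - x * e \<in> F N" for N by (rule F_mono[OF le_SucI[OF order_refl]])
  then have "e * x - x * e = 0" by (rule F_separated)
  then show ?thesis by simp
qed

lemma power_diff_F:
  assumes "a \<in> F 1" "b \<in> F 1" "a - b \<in> F n"
  shows "a ^ Suc k - b ^ Suc k \<in> F (n + k)"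
proof (induction k)
  case (Suc k)
  have "a ^ Suc (Suc k) - b ^ Suc (Suc k) = a * (a ^ Suc k - b ^ Suc k) + (a - b) * b ^ Suc k"
    by (simp add: algebra_simps)
  moreover have "a * (a ^ Suc k - b ^ Suc k) \<in> F (n + Suc k)"
    using F_mult[OF assms(1) Suc] by simp
  moreover have "(a - b) * b ^ Suc k \<in> F (n + Suc k)"
    by (rule F_mult[OF assms(3) F_power[OF assms(2)]])
  ultimately show ?case by (simp only: F_add)
qed (use assms in simp)

text \<open>To lowest order the exponential is the identity: its nonlinear terms raise the degree.\<close>

lemma is_exp_diff:
  assumes "a \<in> F 1" "b \<in> F 1" "a - b \<in> F n" "is_exp a e" "is_exp b e'"
  shows "(e - e') - (a - b) \<in> F (Suc n)"
proof -
  let ?t = "\<lambda>k. sc (1 / fact k) * (a ^ k - b ^ k)"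
  have "e - exp_partial a (Suc n) \<in> F (Suc n)" "e' - exp_partial b (Suc n) \<in> F (Suc n)"
    using assms(4,5) by (auto simp: is_exp_def approx_def intro: F_mono[of "Suc n" "Suc (Suc n)"])
  then have 1: "(e - e') - (exp_partial a (Suc n) - exp_partial b (Suc n)) \<in> F (Suc n)"
    by (metis F_diff diff_diff_eq2 add_diff_eq diff_add_eq diff_diff_eq add.commute)
  have "exp_partial a (Suc n) - exp_partial b (Suc n) = (\<Sum>k\<le>Suc n. ?t k)"
    by (simp add: exp_partial_def sum_subtractf right_diff_distrib)
  also have "\<dots> = (a - b) + (\<Sum>k<n. ?t (Suc (Suc k)))"
    by (simp only: sum.atMost_Suc_shift lessThan_Suc_atMost[symmetric] sum.lessThan_Suc_shift) simp
  finally have eq: "exp_partial a (Suc n) - exp_partial b (Suc n) - (a - b)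
      = (\<Sum>k<n. ?t (Suc (Suc k)))" by simp
  have "?t (Suc (Suc k)) \<in> F (Suc n)" for k
    using power_diff_F[OF assms(1-3), of "Suc k"]
    by (intro F_mult_left F_mono[of "Suc n" "n + Suc k"]) auto
  then have "exp_partial a (Suc n) - exp_partial b (Suc n) - (a - b) \<in> F (Suc n)"
    unfolding eq by (intro F_sum) auto
  with 1 show ?thesis by (rule F_diff_trans)
qed

lemma is_exp_inject:
  assumes "a \<in> F 1" "b \<in> F 1" "is_exp a e" "is_exp b e" shows "a = b"
proof -
  have "a - b \<in> F n" for n
  proof (induction n)
    case (Suc n)
    show ?case
      using is_exp_diff[OF assms(1,2) Suc assms(3,4)] F_uminus[of "b - a" "Suc n"] by simp
  qed simp
  then show ?thesis using F_separated[of "a - b"] by simp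
qed

subsection \<open>Substitution into a power series\<close>

abbreviation monomial :: "('x \<Rightarrow> 'a) \<Rightarrow> 'x list \<Rightarrow> 'a" where
  "monomial \<phi> w \<equiv> prod_list (map \<phi> w)"

definition subst_partial :: "'x set \<Rightarrow> ('x \<Rightarrow> 'a) \<Rightarrow> ('x, 'k) ncps \<Rightarrow> nat \<Rightarrow> 'a" where
  "subst_partial X \<phi> f N = (\<Sum>w | set w \<subseteq> X \<and> length w \<le> N. sc (coeff f w) * monomial \<phi> w)"

definition is_subst :: "'x set \<Rightarrow> ('x \<Rightarrow> 'a) \<Rightarrow> ('x, 'k) ncps \<Rightarrow> 'a \<Rightarrow> bool" where
  "is_subst X \<phi> f r \<longleftrightarrow> approx (subst_partial X \<phi> f) r"

lemma is_subst_unique: "is_subst X \<phi> f r \<Longrightarrow> is_subst X \<phi> f r' \<Longrightarrow> r = r'"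
  unfolding is_subst_def by (rule approx_unique)

lemma monomial_F:
  assumes "\<And>x. x \<in> X \<Longrightarrow> \<phi> x \<in> F 1" "set w \<subseteq> X" shows "monomial \<phi> w \<in> F (length w)"
  using assms(2)
proof (induction w)
  case (Cons x w)
  then show ?case using F_mult[OF assms(1)[of x], of "monomial \<phi> w" "length w"] by simp
qed simp

lemma is_subst_add: "is_subst X \<phi> f r \<Longrightarrow> is_subst X \<phi> g q \<Longrightarrow> is_subst X \<phi> (f + g) (r + q)"
proof -
  have "subst_partial X \<phi> (f + g) = (\<lambda>N. subst_partial X \<phi> f N + subst_partial X \<phi> g N)"
    by (simp add: subst_partial_def fun_eq_iff sc_add distrib_right sum.distrib)
  then show "is_subst X \<phi> f r \<Longrightarrow> is_subst X \<phi> g q \<Longrightarrow> is_subst X \<phi> (f + g) (r + q)"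
    unfolding is_subst_def by (simp add: approx_add)
qed

lemma is_subst_scale: "is_subst X \<phi> f r \<Longrightarrow> is_subst X \<phi> (nc_scale c f) (sc c * r)"
proof -
  have "subst_partial X \<phi> (nc_scale c f) N = sc c * subst_partial X \<phi> f N" for N
    by (simp add: subst_partial_def nc_scale_def sc_mult mult.assoc sum_distrib_left)
  then show "is_subst X \<phi> f r \<Longrightarrow> is_subst X \<phi> (nc_scale c f) (sc c * r)"
    by (simp add: is_subst_def approx_def right_diff_distrib[symmetric] F_mult_left)
qed

lemma finite_words: "finite X \<Longrightarrow> finite {w. set w \<subseteq> X \<and> length w \<le> (N::nat)}"
  by (rule finite_lists_length_le)

lemma is_subst_mult:
  assumes X: "finite X" "\<And>x. x \<in> X \<Longrightarrow> \<phi> x \<in> F 1"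
    and fr: "is_subst X \<phi> f r" and gq: "is_subst X \<phi> g q"
  shows "is_subst X \<phi> (f * g) (r * q)"
proof -
  let ?W = "\<lambda>N. {w. set w \<subseteq> X \<and> length w \<le> N}"
  let ?t = "\<lambda>u v. (sc (coeff f u) * monomial \<phi> u) * (sc (coeff g v) * monomial \<phi> v)"
  have "approx (\<lambda>N. subst_partial X \<phi> f N * subst_partial X \<phi> g N) (r * q)"
    using fr gq unfolding is_subst_def by (rule approx_mult)
  then have "approx (subst_partial X \<phi> (f * g)) (r * q)"
  proof (rule approx_close)
    fix N :: nat
    let ?S = "{(u, v). set u \<subseteq> X \<and> set v \<subseteq> X \<and> length u + length v \<le> N}"
    have fin: "finite (?W N)" by (rule finite_words) (rule X)
    have "subst_partial X \<phi> f N * subst_partial X \<phi> g N = (\<Sum>(u, v)\<in>?W N \<times> ?W N. ?t u v)"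
      unfolding subst_partial_def sum_product by (simp add: sum.cartesian_product)
    also have "\<dots> = (\<Sum>(u, v)\<in>?S. ?t u v) + (\<Sum>(u, v)\<in>?W N \<times> ?W N - ?S. ?t u v)"
      using fin by (subst sum.subset_diff[of ?S]) (auto simp: add.commute)
    also have "(\<Sum>(u, v)\<in>?S. ?t u v)
        = (\<Sum>(w, i)\<in>(SIGMA w:?W N. {..length w}). ?t (take i w) (drop i w))"
      by (rule sum.reindex_bij_witness[where i = "\<lambda>(w, i). (take i w, drop i w)"
            and j = "\<lambda>(u, v). (u @ v, length u)"])
        (auto dest: in_set_takeD in_set_dropD)
    also have "\<dots> = (\<Sum>w\<in>?W N. \<Sum>i\<le>length w. ?t (take i w) (drop i w))"
      using fin by (simp add: sum.Sigma)
    also have "\<dots> = subst_partial X \<phi> (f * g) N"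
      unfolding subst_partial_def
    proof (rule sum.cong[OF HOL.refl])
      fix w
      have "?t (take i w) (drop i w) = sc (coeff f (take i w) * coeff g (drop i w)) * monomial \<phi> w" for i
      proof -
        have "monomial \<phi> w = monomial \<phi> (take i w) * monomial \<phi> (drop i w)"
          by (metis append_take_drop_id map_append prod_list.append)
        then show ?thesis by (metis mult.assoc sc_commute sc_mult)
      qed
      then show "(\<Sum>i\<le>length w. ?t (take i w) (drop i w)) = sc (coeff (f * g) w) * monomial \<phi> w"
        by (simp add: coeff_mult sc_sum sum_distrib_right)
    qed
    finally have "subst_partial X \<phi> f N * subst_partial X \<phi> g N - subst_partial X \<phi> (f * g) N
        = (\<Sum>(u, v)\<in>?W N \<times> ?W N - ?S. ?t u v)" by simp
    also have "\<dots> \<in> F (Suc N)"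
    proof -
      have "?t u v \<in> F (Suc N)"
        if "set u \<subseteq> X" "set v \<subseteq> X" "\<not> length u + length v \<le> N" for u v
        by (rule F_mono[OF _ F_mult[OF F_mult_left[OF monomial_F[OF X(2) that(1)]]
              F_mult_left[OF monomial_F[OF X(2) that(2)]]]]) (use that in auto)
      then show ?thesis by (intro F_sum) auto
    qed
    finally show "subst_partial X \<phi> f N * subst_partial X \<phi> g N - subst_partial X \<phi> (f * g) N \<in> F (Suc N)" .
  qed
  then show ?thesis by (simp add: is_subst_def)
qed

lemma is_subst_cong:
  assumes "\<And>x. x \<in> X \<Longrightarrow> \<phi> x = \<phi>' x" shows "is_subst X \<phi> f r \<longleftrightarrow> is_subst X \<phi>' f r"
proof -
  have "subst_partial X \<phi> f N = subst_partial X \<phi>' f N" for N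
    unfolding subst_partial_def
    by (intro sum.cong HOL.refl arg_cong[where f = "\<lambda>m. _ * prod_list m"] map_cong) (use assms in \<open>auto simp: subset_iff\<close>)
  then show ?thesis by (simp add: is_subst_def approx_def)
qed

lemma is_subst_one: "finite X \<Longrightarrow> is_subst X \<phi> 1 1"
proof -
  assume X: "finite X"
  have "subst_partial X \<phi> 1 N = (\<Sum>w\<in>{[]}. sc (coeff 1 w) * monomial \<phi> w)" for N
    unfolding subst_partial_def
    by (rule sum.mono_neutral_right) (auto simp: coeff_one finite_words[OF X])
  then show ?thesis by (simp add: is_subst_def approx_def coeff_one)
qed

lemma is_subst_var:
  assumes "finite X" "x \<in> X" "\<phi> x \<in> F 1" shows "is_subst X \<phi> (nc_var x) (\<phi> x)"
proof -
  have "\<phi> x - subst_partial X \<phi> (nc_var x) N \<in> F (Suc N)" for N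
  proof (cases N)
    case 0
    have "subst_partial X \<phi> (nc_var x) N = 0"
      unfolding subst_partial_def by (rule sum.neutral) (auto simp: nc_var_def 0)
    then show ?thesis using assms by (simp add: 0)
  next
    case (Suc M)
    have "subst_partial X \<phi> (nc_var x) N = (\<Sum>w\<in>{[x]}. sc (coeff (nc_var x) w) * monomial \<phi> w)"
      unfolding subst_partial_def
      by (rule sum.mono_neutral_right) (use assms Suc in \<open>auto simp: nc_var_def finite_words\<close>)
    then show ?thesis by (simp add: nc_var_def)
  qed
  then show ?thesis by (simp add: is_subst_def approx_def)
qed

end

locale filtered_hom = dom: filtered_algebra F sc + cod: filtered_algebra F' sc'
  for F :: "nat \<Rightarrow> 'a::ring_1 set" and sc :: "'k::field_char_0 \<Rightarrow> 'a"
    and F' :: "nat \<Rightarrow> 'b::ring_1 set" and sc' :: "'k \<Rightarrow> 'b" +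
  fixes h :: "'a \<Rightarrow> 'b"
  assumes hom_add: "h (x + y) = h x + h y"
    and hom_mult: "h (x * y) = h x * h y"
    and hom_one [simp]: "h 1 = 1"
    and hom_sc: "h (sc c) = sc' c"
    and hom_F: "x \<in> F n \<Longrightarrow> h x \<in> F' n"
begin

lemma hom_zero [simp]: "h 0 = 0"
  using hom_add[of 0 0] by simp

lemma hom_uminus: "h (- x) = - h x"
  using hom_add[of x "- x"] by (simp add: minus_unique)

lemma hom_diff: "h (x - y) = h x - h y"
  using hom_add[of x "- y"] hom_uminus by simp

lemma hom_sum: "h (sum x I) = (\<Sum>i\<in>I. h (x i))"
  by (induction I rule: infinite_finite_induct) (auto simp: hom_add)

lemma hom_power: "h (x ^ k) = h x ^ k"
  by (induction k) (auto simp: hom_mult)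

lemma hom_monomial: "h (prod_list (map \<phi> w)) = prod_list (map (\<lambda>x. h (\<phi> x)) w)"
  by (induction w) (auto simp: hom_mult)

lemma hom_approx: "dom.approx s r \<Longrightarrow> cod.approx (\<lambda>N. h (s N)) (h r)"
  unfolding dom.approx_def cod.approx_def by (metis hom_F hom_diff)

lemma hom_is_exp: "dom.is_exp a e \<Longrightarrow> cod.is_exp (h a) (h e)"
proof -
  have "h (dom.exp_partial a N) = cod.exp_partial (h a) N" for N
    by (simp add: dom.exp_partial_def cod.exp_partial_def hom_sum hom_mult hom_sc hom_power)
  then show "dom.is_exp a e \<Longrightarrow> cod.is_exp (h a) (h e)"
    unfolding dom.is_exp_def cod.is_exp_def using hom_approx by fastforce
qed

lemma hom_is_subst: "dom.is_subst X \<phi> f r \<Longrightarrow> cod.is_subst X (\<lambda>x. h (\<phi> x)) f (h r)"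
proof -
  have "h (dom.subst_partial X \<phi> f N) = cod.subst_partial X (\<lambda>x. h (\<phi> x)) f N" for N
    by (simp add: dom.subst_partial_def cod.subst_partial_def hom_sum hom_mult hom_sc hom_monomial)
  then show "dom.is_subst X \<phi> f r \<Longrightarrow> cod.is_subst X (\<lambda>x. h (\<phi> x)) f (h r)"
    unfolding dom.is_subst_def cod.is_subst_def using hom_approx by fastforce
qed

end


section \<open>Power series and their tensor square as filtered algebras\<close>

definition nc_filt :: "nat \<Rightarrow> ('x, 'k::ring_1) ncps set" where
  "nc_filt n = {f. \<forall>w. length w < n \<longrightarrow> coeff f w = 0}"

abbreviation nc_const :: "'k::ring_1 \<Rightarrow> ('x, 'k) ncps" where
  "nc_const c \<equiv> nc_scale c 1"

lemma coeff_scale [simp]: "coeff (nc_scale c f) w = c * coeff f w"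
  by (simp add: nc_scale_def)

lemma coeff_var: "coeff (nc_var x) w = (if w = [x] then 1 else 0)"
  by (simp add: nc_var_def)

lemma coeff_sum: "coeff (sum f I) w = (\<Sum>i\<in>I. coeff (f i) w)"
  by (induction I rule: infinite_finite_induct) auto

lemma coeff_const_mult [simp]: "coeff (nc_const c * f) w = c * coeff f w"
proof -
  have "coeff (nc_const c * f) w = (\<Sum>i\<le>length w. if i = 0 then c * coeff f w else 0)"
    unfolding coeff_mult by (intro sum.cong HOL.refl) (auto simp: coeff_one)
  then show ?thesis by simp
qed

lemma coeff_mult_const [simp]: "coeff (f * nc_const c) w = coeff f w * c"
proof -
  have "coeff (f * nc_const c) w = (\<Sum>i\<le>length w. if i = length w then coeff f w * c else 0)"
    unfolding coeff_mult by (intro sum.cong HOL.refl) (auto simp: coeff_one)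
  then show ?thesis by simp
qed

lemma coeff_var_mult:
  "coeff (nc_var x * g) [] = 0"
  "coeff (nc_var x * g) (y # v) = (if x = y then coeff g v else 0)"
proof -
  have "coeff (nc_var x * g) (y # v)
      = (\<Sum>i\<le>length v. coeff (nc_var x) (y # take i v) * coeff g (drop i v))"
    by (simp add: coeff_mult coeff_var sum.atMost_Suc_shift del: sum.atMost_Suc)
  also have "\<dots> = (\<Sum>i\<le>length v. if i = 0 then if x = y then coeff g v else 0 else 0)"
    by (intro sum.cong HOL.refl) (auto simp: coeff_var)
  finally show "coeff (nc_var x * g) (y # v) = (if x = y then coeff g v else 0)" by simp
qed (simp add: coeff_mult coeff_var)

lemma coeff_mult_var:
  "coeff (g * nc_var x) [] = 0"
  "coeff (g * nc_var x) (v @ [y]) = (if x = y then coeff g v else 0)"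
proof -
  have "coeff (g * nc_var x) (v @ [y])
      = (\<Sum>i\<le>length v. coeff g (take i v) * coeff (nc_var x) (drop i v @ [y]))"
    by (simp add: coeff_mult coeff_var)
  also have "\<dots> = (\<Sum>i\<le>length v. if i = length v then if x = y then coeff g v else 0 else 0)"
    by (intro sum.cong HOL.refl) (auto simp: coeff_var)
  finally show "coeff (g * nc_var x) (v @ [y]) = (if x = y then coeff g v else 0)" by simp
qed (simp add: coeff_mult coeff_var)

lemma const_mult: "nc_const c * f = nc_scale c f"
  by (rule ncps_eqI) simp

lemma const_1 [simp]: "nc_const 1 = 1"
  by (rule ncps_eqI) simp

lemma nc_filt_1: "f \<in> nc_filt 1 \<longleftrightarrow> coeff f [] = 0"
  by (auto simp: nc_filt_def)

lemma nc_var_filt [simp]: "nc_var x \<in> nc_filt (Suc 0)"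
  by (auto simp: nc_filt_def coeff_var)

interpretation nc: filtered_algebra nc_filt "nc_const :: 'k::field_char_0 \<Rightarrow> ('x, 'k) ncps"
proof
  fix f g :: "('x, 'k) ncps" and m n :: nat
  assume fg: "f \<in> nc_filt m" "g \<in> nc_filt n"
  have "coeff f (take i w) * coeff g (drop i w) = 0" if "length w < m + n" "i \<le> length w" for i w
    using fg that by (cases "i < m") (auto simp: nc_filt_def)
  then show "f * g \<in> nc_filt (m + n)"
    by (auto simp: nc_filt_def coeff_mult intro!: sum.neutral)
next
  fix f :: "('x, 'k) ncps"
  assume all: "\<And>n. f \<in> nc_filt n"
  have "coeff f w = 0" for w
    using all[of "Suc (length w)"] by (simp add: nc_filt_def)
  then show "f = 0" by (intro ncps_eqI) simp
qed (auto simp: nc_filt_def distrib_right intro!: ncps_eqI)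

text \<open>
  Series over \<open>X\<close> whose coefficients are series over \<open>Y\<close> form the completed tensor product of the
  two series algebras: letters commute with coefficients.  The relevant filtration is by the
  total degree.
\<close>

definition tensor_filt :: "nat \<Rightarrow> ('x, ('y, 'k::ring_1) ncps) ncps set" where
  "tensor_filt n = {f. \<forall>u v. length u + length v < n \<longrightarrow> coeff (coeff f u) v = 0}"

interpretation tensor: filtered_algebra tensor_filt
  "\<lambda>c::'k::field_char_0. nc_const (nc_const c) :: ('x, ('y, 'k) ncps) ncps"
proof
  fix f g :: "('x, ('y, 'k) ncps) ncps" and m n :: nat
  assume fg: "f \<in> tensor_filt m" "g \<in> tensor_filt n"
  have "coeff (coeff f (take i u)) (take j v) * coeff (coeff g (drop i u)) (drop j v) = 0"
    if "length u + length v < m + n" "i \<le> length u" "j \<le> length v" for i j u v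
  proof (cases "i + j < m")
    case True
    then show ?thesis using fg that by (simp add: tensor_filt_def)
  next
    case False
    then show ?thesis using fg that by (simp add: tensor_filt_def)
  qed
  then show "f * g \<in> tensor_filt (m + n)"
    by (auto simp: tensor_filt_def coeff_mult coeff_sum intro!: sum.neutral)
next
  fix f :: "('x, ('y, 'k) ncps) ncps"
  assume "\<And>n. f \<in> tensor_filt n"
  then have "coeff (coeff f u) v = 0" for u v
    by (metis (mono_tags, lifting) lessI mem_Collect_eq tensor_filt_def)
  then show "f = 0" by (intro ncps_eqI) simp
next
  fix c :: 'k and f :: "('x, ('y, 'k) ncps) ncps"
  show "nc_const (nc_const c) * f = f * nc_const (nc_const c)"
    by (intro ncps_eqI) (simp add: mult.commute)
qed (auto simp: tensor_filt_def distrib_right intro!: ncps_eqI)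

definition tensor_left :: "('x, 'k::ring_1) ncps \<Rightarrow> ('x, ('y, 'k) ncps) ncps" where
  "tensor_left f = Abs_ncps (\<lambda>u. nc_const (coeff f u))"

definition tensor_right :: "('y, 'k::ring_1) ncps \<Rightarrow> ('x, ('y, 'k) ncps) ncps" where
  "tensor_right f = nc_const f"

lemma coeff_tensor_left [simp]: "coeff (tensor_left f) u = nc_const (coeff f u)"
  by (simp add: tensor_left_def)

interpretation tensor_left: filtered_hom nc_filt nc_const tensor_filt
  "\<lambda>c::'k::field_char_0. nc_const (nc_const c)"
  "tensor_left :: ('x, 'k) ncps \<Rightarrow> ('x, ('y, 'k) ncps) ncps"
proof
  fix f g :: "('x, 'k) ncps"
  have "nc_const (c * d) = nc_const c * (nc_const d :: ('y, 'k) ncps)" for c d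
    by (intro ncps_eqI) (simp add: mult.assoc)
  moreover have "nc_const (sum c I) = (\<Sum>i\<in>I. nc_const (c i) :: ('y, 'k) ncps)" for c and I :: "nat set"
    by (intro ncps_eqI) (simp add: coeff_sum sum_distrib_right)
  ultimately show "tensor_left (f * g) = tensor_left f * (tensor_left g :: ('x, ('y, 'k) ncps) ncps)"
    by (intro ncps_eqI) (simp add: coeff_mult)
qed (auto simp: tensor_filt_def nc_filt_def coeff_one distrib_right intro!: ncps_eqI)

interpretation tensor_right: filtered_hom nc_filt nc_const tensor_filt
  "\<lambda>c::'k::field_char_0. nc_const (nc_const c)"
  "tensor_right :: ('y, 'k) ncps \<Rightarrow> ('x, ('y, 'k) ncps) ncps"
proof
  fix f g :: "('y, 'k) ncps"
  show "tensor_right (f * g) = tensor_right f * (tensor_right g :: ('x, ('y, 'k) ncps) ncps)"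
    unfolding tensor_right_def by (intro ncps_eqI) (simp add: coeff_one)
qed (auto simp: tensor_right_def tensor_filt_def nc_filt_def coeff_one distrib_right intro!: ncps_eqI)

lemma coeff_left_mult_right: "coeff (coeff (tensor_left f * tensor_right g) u) v = coeff f u * coeff g v"
  by (simp add: tensor_right_def)

lemma tensor_left_right_commute:
  fixes f :: "('x, 'k::field_char_0) ncps" and g :: "('y, 'k) ncps"
  shows "tensor_left f * tensor_right g = tensor_right g * tensor_left f"
  unfolding tensor_right_def by (intro ncps_eqI) (simp add: mult.commute)

subsection \<open>Series over a set of letters\<close>

lemma nc_ring_simps [simp]:
  "mult (nc_ring X) = (*)" "one (nc_ring X) = 1" "zero (nc_ring X) = 0" "add (nc_ring X) = (+)"
  by (auto simp: nc_ring_def)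

lemma nc_ring_carrier: "f \<in> carrier (nc_ring X) \<longleftrightarrow> (\<forall>w. coeff f w \<noteq> 0 \<longrightarrow> set w \<subseteq> X)"
  by (simp add: nc_ring_def)

lemma nc_ring_mono: "X \<subseteq> Y \<Longrightarrow> f \<in> carrier (nc_ring X) \<Longrightarrow> f \<in> carrier (nc_ring Y)"
  unfolding nc_ring_carrier by blast

lemma nc_ring_UNIV [simp]: "f \<in> carrier (nc_ring UNIV)"
  by (simp add: nc_ring_carrier)

lemma nc_ring_closed:
  shows "0 \<in> carrier (nc_ring X)" "1 \<in> carrier (nc_ring X)"
    and "x \<in> X \<Longrightarrow> nc_var x \<in> carrier (nc_ring X)"
    and "f \<in> carrier (nc_ring X) \<Longrightarrow> - f \<in> carrier (nc_ring X)"
    and "f \<in> carrier (nc_ring X) \<Longrightarrow> nc_scale c f \<in> carrier (nc_ring X)"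
  unfolding nc_ring_carrier by (auto simp: coeff_one coeff_var) (metis mult_zero_right subsetD)

lemma nc_ring_add_closed:
  "f \<in> carrier (nc_ring X) \<Longrightarrow> g \<in> carrier (nc_ring X) \<Longrightarrow> f + g \<in> carrier (nc_ring X)"
  unfolding nc_ring_carrier by (metis add_0_right coeff_add)

lemma nc_ring_diff_closed:
  "f \<in> carrier (nc_ring X) \<Longrightarrow> g \<in> carrier (nc_ring X) \<Longrightarrow> f - g \<in> carrier (nc_ring X)"
  using nc_ring_add_closed[of f X "- g"] nc_ring_closed(4) by fastforce

lemma nc_ring_mult_closed:
  assumes "f \<in> carrier (nc_ring X)" "g \<in> carrier (nc_ring X)"
  shows "f * g \<in> carrier (nc_ring X)"
  unfolding nc_ring_carrier
proof (intro allI impI)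
  fix w assume "coeff (f * g) w \<noteq> 0"
  then obtain i where "coeff f (take i w) * coeff g (drop i w) \<noteq> 0"
    unfolding coeff_mult using sum.not_neutral_contains_not_neutral by blast
  then have "coeff f (take i w) \<noteq> 0" "coeff g (drop i w) \<noteq> 0" by auto
  then have "set (take i w) \<subseteq> X" "set (drop i w) \<subseteq> X"
    using assms unfolding nc_ring_carrier by blast+
  then show "set w \<subseteq> X"
    by (metis append_take_drop_id set_append le_sup_iff)
qed

lemma nc_ring_power_closed: "f \<in> carrier (nc_ring X) \<Longrightarrow> f ^ k \<in> carrier (nc_ring X)"
  by (induction k) (auto intro: nc_ring_mult_closed nc_ring_closed)

lemma nc_exp_closed:
  assumes "f \<in> carrier (nc_ring X)" shows "nc_exp f \<in> carrier (nc_ring X)"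
  unfolding nc_ring_carrier
proof (intro allI impI)
  fix w assume "coeff (nc_exp f) w \<noteq> 0"
  then obtain k where "coeff (f ^ k) w \<noteq> 0"
    unfolding nc_exp_def by (auto elim!: sum.not_neutral_contains_not_neutral)
  then show "set w \<subseteq> X"
    using nc_ring_power_closed[OF assms] by (auto simp: nc_ring_carrier)
qed

text \<open>
  Discarding the words with letters outside \<open>X\<close> is a homomorphism.  Statements about series
  over a finite alphabet extend to all series by means of it.
\<close>

definition nc_restrict :: "'x set \<Rightarrow> ('x, 'k::ring_1) ncps \<Rightarrow> ('x, 'k) ncps" where
  "nc_restrict X f = Abs_ncps (\<lambda>w. if set w \<subseteq> X then coeff f w else 0)"

lemma coeff_restrict [simp]: "coeff (nc_restrict X f) w = (if set w \<subseteq> X then coeff f w else 0)"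
  by (simp add: nc_restrict_def)

lemma nc_restrict_closed: "nc_restrict X f \<in> carrier (nc_ring X)"
  by (simp add: nc_ring_carrier)

lemma nc_restrict_id: "f \<in> carrier (nc_ring X) \<Longrightarrow> nc_restrict X f = f"
  by (intro ncps_eqI) (auto simp: nc_ring_carrier)

lemma nc_restrict_mult: "nc_restrict X (f * g) = nc_restrict X f * nc_restrict X g"
proof (rule ncps_eqI)
  fix w
  show "coeff (nc_restrict X (f * g)) w = coeff (nc_restrict X f * nc_restrict X g) w"
  proof (cases "set w \<subseteq> X")
    case True
    then have "set (take i w) \<subseteq> X" "set (drop i w) \<subseteq> X" for i
      by (auto dest: in_set_takeD in_set_dropD)
    with True show ?thesis by (simp add: coeff_mult)
  next
    case False
    have "nc_restrict X f * nc_restrict X g \<in> carrier (nc_ring X)"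
      by (intro nc_ring_mult_closed nc_restrict_closed)
    with False show ?thesis by (auto simp: nc_ring_carrier)
  qed
qed

subsection \<open>Substitution and the exponential series\<close>

lemma coeff_subst:
  "coeff (nc_subst X \<phi> f) w
    = (\<Sum>v | set v \<subseteq> X \<and> length v \<le> length w. coeff f v * coeff (prod_list (map \<phi> v)) w)"
  by (simp add: nc_subst_def)

lemma nc_subst_is_subst:
  fixes \<phi> :: "'x \<Rightarrow> ('y, 'k::field_char_0) ncps"
  assumes "finite X" "\<And>x. x \<in> X \<Longrightarrow> \<phi> x \<in> nc_filt 1"
  shows "nc.is_subst X \<phi> f (nc_subst X \<phi> f)"
  unfolding nc.is_subst_def nc.approx_def
proof
  fix N
  have "coeff (nc.subst_partial X \<phi> f N) w = coeff (nc_subst X \<phi> f) w" if "length w \<le> N" for w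
    unfolding coeff_subst nc.subst_partial_def coeff_sum coeff_const_mult
    by (rule sum.mono_neutral_right)
      (use that assms(1) nc.monomial_F[of X \<phi>, OF assms(2)] in
        \<open>auto simp: nc_filt_def not_le[symmetric] intro: finite_lists_length_le\<close>)
  then show "nc_subst X \<phi> f - nc.subst_partial X \<phi> f N \<in> nc_filt (Suc N)"
    by (auto simp: nc_filt_def)
qed

lemma nc_subst_hom:
  fixes \<phi> :: "'x \<Rightarrow> ('y, 'k::field_char_0) ncps"
  assumes "finite X" "\<And>x. x \<in> X \<Longrightarrow> \<phi> x \<in> nc_filt 1"
  shows "filtered_hom nc_filt nc_const nc_filt nc_const (nc_subst X \<phi>)"
proof
  note subst = nc_subst_is_subst[OF assms]
  fix f g :: "('x, 'k) ncps" and c :: 'k and n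
  show "nc_subst X \<phi> (f + g) = nc_subst X \<phi> f + nc_subst X \<phi> g"
    by (rule nc.is_subst_unique[OF subst nc.is_subst_add[OF subst subst]])
  show "nc_subst X \<phi> (f * g) = nc_subst X \<phi> f * nc_subst X \<phi> g"
    by (rule nc.is_subst_unique[OF subst nc.is_subst_mult[OF assms subst subst]])
  show one: "nc_subst X \<phi> 1 = 1"
    by (rule nc.is_subst_unique[OF subst nc.is_subst_one[OF assms(1)]])
  show "nc_subst X \<phi> (nc_const c) = nc_const c"
    using nc.is_subst_unique[OF subst nc.is_subst_scale[OF subst[where f = 1], where c = c]] by (simp add: one)
  show "nc_subst X \<phi> f \<in> nc_filt n" if "f \<in> nc_filt n"
    using that by (auto simp: nc_filt_def coeff_subst intro!: sum.neutral)
qed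

lemma nc_subst_var:
  fixes \<phi> :: "'x \<Rightarrow> ('y, 'k::field_char_0) ncps"
  assumes "finite X" "\<And>x. x \<in> X \<Longrightarrow> \<phi> x \<in> nc_filt 1" "x \<in> X"
  shows "nc_subst X \<phi> (nc_var x) = \<phi> x"
proof (rule nc.is_subst_unique)
  show "nc.is_subst X \<phi> (nc_var x) (nc_subst X \<phi> (nc_var x))"
    by (rule nc_subst_is_subst) (fact assms)+
  show "nc.is_subst X \<phi> (nc_var x) (\<phi> x)"
    using assms by (intro nc.is_subst_var)
qed

lemma coeff_monomial: "coeff (prod_list (map nc_var v)) w = (if w = v then 1 else 0)"
proof (induction v arbitrary: w)
  case (Cons x v)
  then show ?case by (cases w) (auto simp: coeff_var_mult)
qed (simp add: coeff_one)

lemma nc_subst_identity: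
  assumes "finite X" shows "nc_subst X nc_var f = nc_restrict X (f :: ('x, 'k::field_char_0) ncps)"
proof (rule ncps_eqI)
  fix w
  have "coeff (nc_subst X nc_var f) w
      = (\<Sum>v | set v \<subseteq> X \<and> length v \<le> length w. if v = w then coeff f w else 0)"
    unfolding coeff_subst coeff_monomial by (intro sum.cong HOL.refl) auto
  then show "coeff (nc_subst X nc_var f) w = coeff (nc_restrict X f) w"
    using finite_lists_length_le[OF assms] by (simp add: sum.delta)
qed

lemma nc_is_subst_self:
  fixes f :: "('x, 'k::field_char_0) ncps"
  assumes "finite X" "f \<in> carrier (nc_ring X)" shows "nc.is_subst X nc_var f f"
  using nc_subst_is_subst[OF assms(1), of nc_var f] assms
  by (simp add: nc_subst_identity nc_restrict_id)

lemma nc_subst_closed: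
  fixes \<phi> :: "'x \<Rightarrow> ('y, 'k::field_char_0) ncps"
  assumes "\<And>x. x \<in> X \<Longrightarrow> \<phi> x \<in> carrier (nc_ring Y)"
  shows "nc_subst X \<phi> f \<in> carrier (nc_ring Y)"
  unfolding nc_ring_carrier
proof (intro allI impI)
  fix w assume "coeff (nc_subst X \<phi> f) w \<noteq> 0"
  then obtain v where v: "set v \<subseteq> X" "coeff (prod_list (map \<phi> v)) w \<noteq> 0"
    unfolding coeff_subst by (auto elim!: sum.not_neutral_contains_not_neutral)
  have "prod_list (map \<phi> v) \<in> carrier (nc_ring Y)"
    using v(1) by (induction v) (auto intro: nc_ring_mult_closed nc_ring_closed assms)
  with v(2) show "set w \<subseteq> Y" by (auto simp: nc_ring_carrier)
qed

lemma nc_exp_is_exp: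
  fixes f :: "('x, 'k::field_char_0) ncps"
  assumes "f \<in> nc_filt 1" shows "nc.is_exp f (nc_exp f)"
  unfolding nc.is_exp_def nc.approx_def
proof
  fix N
  have "coeff (nc.exp_partial f N) w = coeff (nc_exp f) w" if "length w \<le> N" for w
  proof -
    have "coeff (nc.exp_partial f N) w = (\<Sum>k\<le>N. coeff (f ^ k) w / fact k)"
      by (simp add: nc.exp_partial_def coeff_sum)
    also have "\<dots> = (\<Sum>k\<le>length w. coeff (f ^ k) w / fact k)"
      by (rule sum.mono_neutral_right) (use that nc.F_power[OF assms] in \<open>auto simp: nc_filt_def\<close>)
    finally show ?thesis by (simp add: nc_exp_def)
  qed
  then show "nc_exp f - nc.exp_partial f N \<in> nc_filt (Suc N)"
    by (auto simp: nc_filt_def)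
qed

lemma nc_exp_eqI: "f \<in> nc_filt 1 \<Longrightarrow> nc.is_exp f e \<Longrightarrow> nc_exp f = e"
  for f :: "('x, 'k::field_char_0) ncps"
  by (rule nc.is_exp_unique[OF nc_exp_is_exp])

lemma nc_exp_0 [simp]: "nc_exp 0 = (1 :: ('x, 'k::field_char_0) ncps)"
  by (rule nc_exp_eqI[OF _ nc.is_exp_0]) simp

lemma nc_exp_uminus:
  fixes f :: "('x, 'k::field_char_0) ncps"
  assumes "f \<in> nc_filt 1"
  shows "nc_exp f * nc_exp (- f) = 1" "nc_exp (- f) * nc_exp f = 1"
  using nc.is_exp_inverse[of f "nc_exp f" "nc_exp (- f)"]
    nc.is_exp_inverse[of "- f" "nc_exp (- f)" "nc_exp f"]
    nc_exp_is_exp[OF assms] nc_exp_is_exp[OF nc.F_uminus[OF assms]] assms nc.F_uminus[OF assms]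
  by auto

lemma coeff_exp_Nil: "coeff (nc_exp f) [] = 1"
  by (simp add: nc_exp_def coeff_one)

lemma coeff_exp_single: "f \<in> nc_filt 1 \<Longrightarrow> coeff (nc_exp f) [x] = coeff f [x]"
  by (simp add: nc_exp_def coeff_one nc_filt_1)

text \<open>
  Logarithms are found degree by degree: by \<open>is_exp_diff\<close>, adding to an approximate logarithm the
  error of its exponential corrects the next degree.
\<close>

primrec nc_log_approx :: "('x, 'k::field_char_0) ncps \<Rightarrow> nat \<Rightarrow> ('x, 'k) ncps" where
  "nc_log_approx g 0 = 0"
| "nc_log_approx g (Suc n) = nc_log_approx g n + (g - nc_exp (nc_log_approx g n))"

lemma nc_log_exists:
  fixes g :: "('x, 'k::field_char_0) ncps"
  assumes "g \<in> carrier (nc_ring X)" "coeff g [] = 1"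
  obtains f where "f \<in> carrier (nc_ring X)" "f \<in> nc_filt 1" "nc_exp f = g"
proof
  define l where "l = nc_log_approx g"
  have l_Suc: "l (Suc n) = l n + (g - nc_exp (l n))" for n
    by (simp add: l_def)
  have closed: "l n \<in> carrier (nc_ring X)" for n
    by (induction n)
      (auto simp: l_def intro!: nc_ring_add_closed nc_ring_diff_closed nc_exp_closed nc_ring_closed assms)
  have l1: "l n \<in> nc_filt 1" for n
    by (induction n) (simp_all add: l_def nc_filt_1 coeff_exp_Nil assms del: One_nat_def)
  have err: "g - nc_exp (l n) \<in> nc_filt (Suc n)" for n
  proof (induction n)
    case 0
    show ?case using assms by (simp add: l_def nc_filt_def coeff_one)
  next
    case (Suc n)
    have "(nc_exp (l (Suc n)) - nc_exp (l n)) - (l (Suc n) - l n) \<in> nc_filt (Suc (Suc n))"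
      by (rule nc.is_exp_diff[OF l1 l1 _ nc_exp_is_exp[OF l1] nc_exp_is_exp[OF l1]])
        (simp add: l_Suc Suc)
    then have "- (g - nc_exp (l (Suc n))) \<in> nc_filt (Suc (Suc n))"
      by (simp add: l_Suc algebra_simps)
    then show ?case using nc.F_uminus by fastforce
  qed
  have stable: "l (n + k) - l n \<in> nc_filt (Suc n)" for n k
  proof (induction k)
    case (Suc k)
    have "l (Suc (n + k)) - l (n + k) \<in> nc_filt (Suc n)"
      using nc.F_mono[OF _ err[of "n + k"], of "Suc n"] by (simp add: l_Suc)
    then have "l (Suc (n + k)) - l n \<in> nc_filt (Suc n)"
      using Suc by (rule nc.F_diff_trans)
    then show ?case by simp
  qed simp
  let ?f = "Abs_ncps (\<lambda>w. coeff (l (length w)) w)"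
  show "?f \<in> carrier (nc_ring X)"
    using closed by (auto simp: nc_ring_carrier)
  show f1: "?f \<in> nc_filt 1"
    using l1 by (simp add: nc_filt_1 del: One_nat_def)
  have "?f - l n \<in> nc_filt (Suc n)" for n
    unfolding nc_filt_def
  proof (clarsimp)
    fix w :: "'x list" assume "length w < Suc n"
    then show "coeff (l (length w)) w = coeff (l n) w"
      using stable[of "length w" "n - length w"] by (auto simp: nc_filt_def)
  qed
  note close = this
  have "nc_exp ?f - nc_exp (l n) \<in> nc_filt (Suc n)" for n
  proof -
    have "(nc_exp ?f - nc_exp (l n)) - (?f - l n) \<in> nc_filt (Suc (Suc n))"
      by (rule nc.is_exp_diff[OF f1 l1 close nc_exp_is_exp[OF f1] nc_exp_is_exp[OF l1]])
    then have "(nc_exp ?f - nc_exp (l n)) - (?f - l n) \<in> nc_filt (Suc n)"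
      by (rule nc.F_mono[rotated]) simp
    from nc.F_add[OF this close[of n]] show ?thesis by simp
  qed
  then have "nc_exp ?f - g \<in> nc_filt (Suc n)" for n
    by (rule nc.F_diff_trans[OF _ nc.F_diff_sym[OF err]])
  then have "nc_exp ?f - g \<in> nc_filt n" for n
    by (rule nc.F_mono[OF le_SucI[OF order_refl]])
  then have "nc_exp ?f - g = 0"
    by (rule nc.F_separated)
  then show "nc_exp ?f = g" by simp
qed


section \<open>Primitive and group-like series\<close>

lemma mem_unshuffles: "(u, v) \<in> set (unshuffles w) \<Longrightarrow> w \<in> shuffles u v"
  by (induction w arbitrary: u v) (auto intro: Cons_in_shuffles_leftI Cons_in_shuffles_rightI)

lemma count_unshuffles_Cons:
  "count_list (unshuffles (a # w)) (u, v) =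
    (case u of [] \<Rightarrow> 0 | y # u' \<Rightarrow> if y = a then count_list (unshuffles w) (u', v) else 0) +
    (case v of [] \<Rightarrow> 0 | y # v' \<Rightarrow> if y = a then count_list (unshuffles w) (u, v') else 0)"
proof -
  have "count_list (map (\<lambda>(u, v). (a # u, v)) L) (u, v)
      = (case u of [] \<Rightarrow> 0 | y # u' \<Rightarrow> if y = a then count_list L (u', v) else 0)" for L
    by (induction L) (auto split: list.split)
  moreover have "count_list (map (\<lambda>(u, v). (u, a # v)) L) (u, v)
      = (case v of [] \<Rightarrow> 0 | y # v' \<Rightarrow> if y = a then count_list L (u, v') else 0)" for L
    by (induction L) (auto split: list.split)
  ultimately show ?thesis by simp
qed

lemma count_unshuffles_eq_0: "w \<notin> shuffles u v \<Longrightarrow> count_list (unshuffles w) (u, v) = 0"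
  using mem_unshuffles by (fastforce simp: count_list_0_iff)

lemma sum_list_eq_sum_count:
  assumes "finite P" "set L \<subseteq> P"
  shows "(\<Sum>p\<leftarrow>L. G p) = (\<Sum>p\<in>P. of_nat (count_list L p) * (G p :: 'a::ring_1))"
  using assms(2)
proof (induction L)
  case (Cons x L)
  have "(\<Sum>p\<in>P. of_nat (count_list (x # L) p) * G p)
      = (\<Sum>p\<in>P. (if p = x then G x else 0) + of_nat (count_list L p) * G p)"
    by (intro sum.cong HOL.refl) (auto simp: algebra_simps)
  with Cons assms(1) show ?case by (simp add: sum.distrib)
qed simp

text \<open>
  Expanding a word in sums of commuting elements gives one term for each way to split the word
  into two complementary subwords.
\<close>

lemma prod_list_add_unshuffles:
  fixes a b :: "'x \<Rightarrow> 'a::ring_1"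
  assumes "\<And>x y. x \<in> X \<Longrightarrow> y \<in> X \<Longrightarrow> a x * b y = b y * a x" "set w \<subseteq> X"
  shows "prod_list (map (\<lambda>x. a x + b x) w)
    = (\<Sum>(u, v)\<leftarrow>unshuffles w. prod_list (map a u) * prod_list (map b v))"
  using assms(2)
proof (induction w)
  case (Cons x w)
  let ?L = "unshuffles w"
  have bx: "b x * prod_list (map a u) = prod_list (map a u) * b x" if "set u \<subseteq> X" for u
    using that
  proof (induction u)
    case (Cons y u)
    then show ?case
      using assms(1)[of y x] \<open>set (x # w) \<subseteq> X\<close> by simp (metis mult.assoc)
  qed simp
  have sub: "set u \<subseteq> X" if "(u, v) \<in> set ?L" for u v
    using set_shuffles[OF mem_unshuffles[OF that]] Cons.prems by auto
  have "(\<Sum>(u, v)\<leftarrow>?L. b x * (prod_list (map a u) * prod_list (map b v)))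
      = (\<Sum>(u, v)\<leftarrow>?L. prod_list (map a u) * (b x * prod_list (map b v)))"
    by (intro arg_cong[where f = sum_list] map_cong HOL.refl)
      (auto simp: mult.assoc[symmetric] bx[OF sub])
  moreover have "(\<Sum>(u, v)\<leftarrow>?L. c * (prod_list (map a u) * prod_list (map b v)))
      = c * (\<Sum>(u, v)\<leftarrow>?L. prod_list (map a u) * prod_list (map b v))" for c
    by (simp add: sum_list_const_mult[symmetric] case_prod_unfold)
  ultimately show ?case
    using Cons by (simp add: distrib_right o_def case_prod_unfold mult.assoc)
qed simp

lemma nc_coproduct_superset:
  assumes "finite W" "shuffles u v \<subseteq> W"
  shows "nc_coproduct f (u, v) = (\<Sum>w\<in>W. coeff f w * of_nat (count_list (unshuffles w) (u, v)))"
  unfolding nc_coproduct_def prod.case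
  by (rule sum.mono_neutral_left) (use assms count_unshuffles_eq_0 in fastforce)+

context filtered_algebra
begin

lemma subst_partial_coproduct:
  assumes X: "finite X" and comm: "\<And>x y. x \<in> X \<Longrightarrow> y \<in> X \<Longrightarrow> a x * b y = b y * a x"
  shows "subst_partial X (\<lambda>x. a x + b x) f N =
    (\<Sum>(u, v) | set u \<subseteq> X \<and> set v \<subseteq> X \<and> length u + length v \<le> N.
      sc (nc_coproduct f (u, v)) * (monomial a u * monomial b v))"
proof -
  let ?W = "{w. set w \<subseteq> X \<and> length w \<le> N}"
  let ?P = "{(u, v). set u \<subseteq> X \<and> set v \<subseteq> X \<and> length u + length v \<le> N}"
  let ?G = "\<lambda>(u, v). monomial a u * monomial b v"
  have fW: "finite ?W" by (rule finite_words[OF X])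
  have fP: "finite ?P"
    by (rule finite_subset[OF _ finite_cartesian_product[OF fW fW]]) auto
  have "subst_partial X (\<lambda>x. a x + b x) f N
      = (\<Sum>w\<in>?W. \<Sum>p\<in>?P. sc (coeff f w * of_nat (count_list (unshuffles w) p)) * ?G p)"
    unfolding subst_partial_def
  proof (intro sum.cong HOL.refl)
    fix w assume w: "w \<in> ?W"
    have sub: "set (unshuffles w) \<subseteq> ?P"
    proof (rule subrelI)
      fix u v assume "(u, v) \<in> set (unshuffles w)"
      then have "w \<in> shuffles u v" by (rule mem_unshuffles)
      from set_shuffles[OF this] length_shuffles[OF this] w show "(u, v) \<in> ?P" by simp
    qed
    have "monomial (\<lambda>x. a x + b x) w = (\<Sum>p\<leftarrow>unshuffles w. ?G p)"
      using w by (intro prod_list_add_unshuffles[of X]) (auto intro: comm)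
    also have "\<dots> = (\<Sum>p\<in>?P. of_nat (count_list (unshuffles w) p) * ?G p)"
      by (rule sum_list_eq_sum_count[OF fP sub])
    finally show "sc (coeff f w) * monomial (\<lambda>x. a x + b x) w
        = (\<Sum>p\<in>?P. sc (coeff f w * of_nat (count_list (unshuffles w) p)) * ?G p)"
      by (simp add: sum_distrib_left sc_mult sc_of_nat mult.assoc)
  qed
  also have "\<dots> = (\<Sum>p\<in>?P. sc (\<Sum>w\<in>?W. coeff f w * of_nat (count_list (unshuffles w) p)) * ?G p)"
    by (subst sum.swap) (simp add: sc_sum sum_distrib_right)
  also have "\<dots> = (\<Sum>p\<in>?P. sc (nc_coproduct f p) * ?G p)"
  proof (intro sum.cong HOL.refl)
    fix p assume "p \<in> ?P"
    then obtain u v where p: "p = (u, v)" "set u \<subseteq> X" "set v \<subseteq> X" "length u + length v \<le> N"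
      by auto
    have "shuffles u v \<subseteq> ?W"
    proof
      fix w assume "w \<in> shuffles u v"
      from set_shuffles[OF this] length_shuffles[OF this] p show "w \<in> ?W" by simp
    qed
    from nc_coproduct_superset[OF fW this, of f]
    show "sc (\<Sum>w\<in>?W. coeff f w * of_nat (count_list (unshuffles w) p)) * ?G p
        = sc (nc_coproduct f p) * ?G p"
      by (simp add: p(1))
  qed
  finally show ?thesis by (simp add: case_prod_unfold)
qed

text \<open>
  The coproduct of a primitive series \<open>f\<close> has no mixed terms, so substituting sums of commuting
  elements into \<open>f\<close> is additive.
\<close>

lemma is_subst_primitive_add:
  fixes X :: "'x set"
  assumes X: "finite X" and comm: "\<And>x y. x \<in> X \<Longrightarrow> y \<in> X \<Longrightarrow> a x * b y = b y * a x"
    and f: "nc_primitive f" and "is_subst X a f r" "is_subst X b f s"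
  shows "is_subst X (\<lambda>x. a x + b x) f (r + s)"
proof -
  have "subst_partial X (\<lambda>x. a x + b x) f N = subst_partial X a f N + subst_partial X b f N" for N
  proof -
    let ?W = "{w. set w \<subseteq> X \<and> length w \<le> N}"
    let ?P = "{(u, v). set u \<subseteq> X \<and> set v \<subseteq> X \<and> length u + length v \<le> N}"
    have fW: "finite ?W" by (rule finite_words[OF X])
    have fP: "finite ?P"
      by (rule finite_subset[OF _ finite_cartesian_product[OF fW fW]]) auto
    have "subst_partial X (\<lambda>x. a x + b x) f N
        = (\<Sum>(u, v)\<in>?P. (if v = [] then sc (coeff f u) * monomial a u else 0)
            + (if u = [] then sc (coeff f v) * monomial b v else 0))"
    proof -
      have "nc_coproduct f p = nc_tensor f 1 p + nc_tensor 1 f p" for p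
        using f unfolding nc_primitive_def by blast
      moreover have "subst_partial X (\<lambda>x. a x + b x) f N
          = (\<Sum>(u, v)\<in>?P. sc (nc_coproduct f (u, v)) * (monomial a u * monomial b v))"
        by (rule subst_partial_coproduct) (use X comm in auto)
      ultimately show ?thesis
        by (auto simp: nc_tensor_def coeff_one sc_add distrib_right intro!: sum.cong)
    qed
    also have "\<dots> = (\<Sum>(u, v)\<in>?P. if v = [] then sc (coeff f u) * monomial a u else 0)
        + (\<Sum>(u, v)\<in>?P. if u = [] then sc (coeff f v) * monomial b v else 0)"
      by (simp add: sum.distrib case_prod_unfold)
    also have "(\<Sum>(u, v)\<in>?P. if v = [] then sc (coeff f u) * monomial a u else 0)
        = subst_partial X a f N"
    proof -
      have "(\<Sum>(u, v)\<in>?P. if v = [] then sc (coeff f u) * monomial a u else 0)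
          = (\<Sum>p\<in>(\<lambda>u. (u, [] :: 'x list)) ` ?W. sc (coeff f (fst p)) * monomial a (fst p))"
        by (rule sum.mono_neutral_cong_right[OF fP]) auto
      also have "\<dots> = subst_partial X a f N"
        unfolding subst_partial_def by (subst sum.reindex) (auto simp: inj_on_def)
      finally show ?thesis .
    qed
    also have "(\<Sum>(u, v)\<in>?P. if u = [] then sc (coeff f v) * monomial b v else 0)
        = subst_partial X b f N"
    proof -
      have "(\<Sum>(u, v)\<in>?P. if u = [] then sc (coeff f v) * monomial b v else 0)
          = (\<Sum>p\<in>(\<lambda>v. ([] :: 'x list, v)) ` ?W. sc (coeff f (snd p)) * monomial b (snd p))"
        by (rule sum.mono_neutral_cong_right[OF fP]) auto
      also have "\<dots> = subst_partial X b f N"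
        unfolding subst_partial_def by (subst sum.reindex) (auto simp: inj_on_def)
      finally show ?thesis .
    qed
    finally show ?thesis .
  qed
  then have "subst_partial X (\<lambda>x. a x + b x) f = (\<lambda>N. subst_partial X a f N + subst_partial X b f N)"
    by (rule ext)
  then show ?thesis
    using approx_add[OF assms(4,5)[unfolded is_subst_def]] by (simp add: is_subst_def)
qed

end

definition nc_delta :: "('x, 'k::ring_1) ncps \<Rightarrow> ('x, ('x, 'k) ncps) ncps" where
  "nc_delta f = Abs_ncps (\<lambda>u. Abs_ncps (\<lambda>v. nc_coproduct f (u, v)))"

lemma coeff_delta [simp]: "coeff (coeff (nc_delta f) u) v = nc_coproduct f (u, v)"
  by (simp add: nc_delta_def)

text \<open>
  The formula for \<open>nc_coproduct\<close> describes the continuous homomorphism that makes the letters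
  primitive.  Its multiplicativity is inherited from that of substitutions.
\<close>

lemma nc_delta_is_subst:
  fixes f :: "('x, 'k::field_char_0) ncps"
  assumes X: "finite X" and f: "f \<in> carrier (nc_ring X)"
  shows "tensor.is_subst X (\<lambda>x. tensor_left (nc_var x) + tensor_right (nc_var x)) f (nc_delta f)"
  unfolding tensor.is_subst_def tensor.approx_def
proof
  fix N
  let ?P = "{(u, v). set u \<subseteq> X \<and> set v \<subseteq> X \<and> length u + length v \<le> N}"
  have fP: "finite ?P"
    by (rule finite_subset[OF _ finite_cartesian_product[OF nc.finite_words[OF X, of N] nc.finite_words[OF X, of N]]]) auto
  have "coeff (coeff (tensor.subst_partial X (\<lambda>x. tensor_left (nc_var x) + tensor_right (nc_var x)) f N) u) v
      = nc_coproduct f (u, v)" if "length u + length v \<le> N" for u v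
  proof -
    have "coeff (coeff (tensor.subst_partial X (\<lambda>x. tensor_left (nc_var x) + tensor_right (nc_var x)) f N) u) v
        = (\<Sum>p\<in>?P. if p = (u, v) then nc_coproduct f (u, v) else 0)"
      unfolding tensor.subst_partial_coproduct[OF X tensor_left_right_commute]
        tensor_left.hom_monomial[symmetric] tensor_right.hom_monomial[symmetric] coeff_sum
      by (intro sum.cong HOL.refl) (auto simp: coeff_left_mult_right coeff_monomial split: if_splits)
    also have "\<dots> = (if (u, v) \<in> ?P then nc_coproduct f (u, v) else 0)"
      using fP by (simp only: sum.delta)
    also have "\<dots> = nc_coproduct f (u, v)"
    proof (cases "(u, v) \<in> ?P")
      case False
      then have "\<not> set u \<union> set v \<subseteq> X" using that by auto
      then have "coeff f w = 0" if "w \<in> shuffles u v" for w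
        using f set_shuffles[OF that] unfolding nc_ring_carrier by blast
      then show ?thesis by (simp add: nc_coproduct_def)
    qed simp
    finally show ?thesis .
  qed
  then show "nc_delta f - tensor.subst_partial X (\<lambda>x. tensor_left (nc_var x) + tensor_right (nc_var x)) f N
      \<in> tensor_filt (Suc N)"
    by (simp add: tensor_filt_def)
qed

interpretation nc_delta: filtered_hom nc_filt nc_const tensor_filt
  "\<lambda>c::'k::field_char_0. nc_const (nc_const c)"
  "nc_delta :: ('x, 'k) ncps \<Rightarrow> ('x, ('x, 'k) ncps) ncps"
proof
  fix f g :: "('x, 'k) ncps" and c :: 'k and n
  show "nc_delta (f + g) = nc_delta f + nc_delta g"
    by (intro ncps_eqI) (simp add: nc_coproduct_def distrib_right sum.distrib)
  have const: "nc_delta (nc_const c) = (nc_const (nc_const c) :: ('x, ('x, 'k) ncps) ncps)" for c :: 'k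
  proof (intro ncps_eqI)
    fix u v :: "'x list"
    have "nc_coproduct (nc_const c) (u, v) = (\<Sum>w\<in>shuffles u v. if w = [] then c else 0)"
      unfolding nc_coproduct_def prod.case
      by (intro sum.cong HOL.refl) (auto simp: coeff_one)
    then show "coeff (coeff (nc_delta (nc_const c)) u) v = coeff (coeff (nc_const (nc_const c)) u) v"
      by (auto simp: coeff_one)
  qed
  show "nc_delta (nc_const c) = (nc_const (nc_const c) :: ('x, ('x, 'k) ncps) ncps)" by (rule const)
  show "nc_delta 1 = (1 :: ('x, ('x, 'k) ncps) ncps)"
    using const[of 1] by simp
  show "nc_delta f \<in> tensor_filt n" if "f \<in> nc_filt n"
    using that by (auto simp: nc_filt_def tensor_filt_def nc_coproduct_def length_shuffles)
  show "nc_delta (f * g) = nc_delta f * nc_delta g"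
  proof (intro ncps_eqI)
    fix u v :: "'x list"
    \<comment> \<open>A coefficient of the coproduct involves finitely many letters.\<close>
    define X where "X = set u \<union> set v"
    have restrict: "nc_coproduct (nc_restrict X h) (u', v') = nc_coproduct h (u', v')"
      if "set u' \<union> set v' \<subseteq> X" for h :: "('x, 'k) ncps" and u' v'
      unfolding nc_coproduct_def prod.case
    proof (intro sum.cong HOL.refl)
      fix w assume "w \<in> shuffles u' v'"
      then have "set w \<subseteq> X" using set_shuffles that by blast
      then show "coeff (nc_restrict X h) w * of_nat (count_list (unshuffles w) (u', v'))
          = coeff h w * of_nat (count_list (unshuffles w) (u', v'))" by simp
    qed
    let ?f = "nc_restrict X f" and ?g = "nc_restrict X g"
    have X: "finite X" by (simp add: X_def)
    note subst = nc_delta_is_subst[OF X]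
    have deg1: "tensor_left (nc_var x) + tensor_right (nc_var x)
        \<in> (tensor_filt 1 :: ('x, ('x, 'k) ncps) ncps set)" for x
      by (intro tensor.F_add tensor_left.hom_F tensor_right.hom_F) simp_all
    have "tensor.is_subst X (\<lambda>x. tensor_left (nc_var x) + tensor_right (nc_var x)) (?f * ?g)
        (nc_delta ?f * nc_delta ?g)"
      by (rule tensor.is_subst_mult[OF X deg1 subst[OF nc_restrict_closed] subst[OF nc_restrict_closed]])
    then have "nc_delta (?f * ?g) = nc_delta ?f * nc_delta ?g"
      by (rule tensor.is_subst_unique[OF subst[OF nc_ring_mult_closed[OF nc_restrict_closed nc_restrict_closed]]])
    moreover have "coeff (coeff (nc_delta ?f * nc_delta ?g) u) v = coeff (coeff (nc_delta f * nc_delta g) u) v"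
    proof -
      have "set (take i u) \<union> set (take j v) \<subseteq> X" "set (drop i u) \<union> set (drop j v) \<subseteq> X" for i j
        by (auto simp: X_def dest: in_set_takeD in_set_dropD)
      then show ?thesis by (simp add: coeff_mult coeff_sum restrict)
    qed
    moreover have "nc_coproduct (?f * ?g) (u, v) = nc_coproduct (f * g) (u, v)"
      unfolding nc_restrict_mult[symmetric] by (rule restrict) (simp add: X_def)
    ultimately show "coeff (coeff (nc_delta (f * g)) u) v = coeff (coeff (nc_delta f * nc_delta g) u) v"
      by (simp only: coeff_delta[symmetric])
  qed
qed

lemma nc_primitive_iff: "nc_primitive f \<longleftrightarrow> nc_delta f = tensor_left f + tensor_right f"
  for f :: "('x, 'k::field_char_0) ncps"
proof -
  have "coeff (coeff (tensor_left f + tensor_right f) u) v = nc_tensor f 1 (u, v) + nc_tensor 1 f (u, v)"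
    for u v :: "'x list"
    by (simp add: nc_tensor_def tensor_right_def coeff_one)
  then show ?thesis
    unfolding nc_primitive_def by (metis coeff_delta ncps_eqI surj_pair)
qed

lemma nc_primitive_filt: "nc_primitive f \<Longrightarrow> f \<in> nc_filt 1" for f :: "('x, 'k::field_char_0) ncps"
proof -
  assume "nc_primitive f"
  then have "nc_coproduct f ([], []) = nc_tensor f 1 ([], []) + nc_tensor 1 f ([], [])"
    unfolding nc_primitive_def by blast
  then show "f \<in> nc_filt 1" unfolding nc_filt_1 by (simp add: nc_coproduct_def nc_tensor_def coeff_one)
qed

lemma free_lie_filt: "f \<in> free_lie X \<Longrightarrow> f \<in> nc_filt 1" for f :: "('x, 'k::field_char_0) ncps"
  by (simp add: free_lie_def nc_primitive_filt del: One_nat_def)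

lemma free_lie_closed:
  "f \<in> free_lie X \<Longrightarrow> f \<in> carrier (nc_ring X)"
  "f \<in> free_lie X \<Longrightarrow> nc_exp f \<in> carrier (nc_ring X)"
  by (auto simp: free_lie_def intro: nc_exp_closed)

lemma free_lie_uminus: "f \<in> free_lie X \<Longrightarrow> - f \<in> free_lie X" for f :: "('x, 'k::field_char_0) ncps"
  by (simp add: free_lie_def nc_primitive_iff nc_ring_closed nc_delta.hom_uminus
      tensor_left.hom_uminus tensor_right.hom_uminus)

lemma free_lie_add: "f \<in> free_lie X \<Longrightarrow> g \<in> free_lie X \<Longrightarrow> f + g \<in> free_lie X"
  for f :: "('x, 'k::field_char_0) ncps"
  by (simp add: free_lie_def nc_primitive_iff nc_ring_add_closed nc_delta.hom_add
      tensor_left.hom_add tensor_right.hom_add)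

lemma free_lie_scale:
  fixes f :: "('x, 'k::field_char_0) ncps"
  assumes "f \<in> free_lie X" shows "nc_scale c f \<in> free_lie X"
proof -
  have "nc_delta (nc_const c * f) = nc_const (nc_const c) * (tensor_left f + tensor_right f)"
    using assms by (simp only: nc_delta.hom_mult nc_delta.hom_sc free_lie_def nc_primitive_iff mem_Collect_eq)
  also have "\<dots> = tensor_left (nc_const c * f) + tensor_right (nc_const c * f)"
    by (simp only: tensor_left.hom_mult tensor_right.hom_mult tensor_left.hom_sc tensor_right.hom_sc
        distrib_left)
  finally show ?thesis
    using assms by (simp only: free_lie_def nc_primitive_iff mem_Collect_eq const_mult nc_ring_closed(5))
qed

lemma free_lie_zero: "(0 :: ('x, 'k::field_char_0) ncps) \<in> free_lie X"
  by (simp add: free_lie_def nc_primitive_iff nc_ring_closed)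

lemma free_lie_var:
  assumes x: "x \<in> X" shows "(nc_var x :: ('x, 'k::field_char_0) ncps) \<in> free_lie X"
proof -
  have "tensor.is_subst {x} (\<lambda>x. tensor_left (nc_var x) + tensor_right (nc_var x)) (nc_var x)
      (tensor_left (nc_var x) + tensor_right (nc_var x) :: ('x, ('x, 'k) ncps) ncps)"
    by (intro tensor.is_subst_var tensor.F_add tensor_left.hom_F tensor_right.hom_F) auto
  then have "nc_delta (nc_var x) = (tensor_left (nc_var x) + tensor_right (nc_var x) :: ('x, ('x, 'k) ncps) ncps)"
    by (rule tensor.is_subst_unique[OF nc_delta_is_subst, rotated 2]) (auto intro: nc_ring_closed)
  then show ?thesis
    using x by (simp add: free_lie_def nc_primitive_iff nc_ring_closed)
qed

text \<open>
  The coproduct of a value \<open>\<phi> x\<close> is the sum of its two commuting copies in the tensor square, so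
  \<open>is_subst_primitive_add\<close> computes the coproduct of the substituted series.
\<close>

lemma free_lie_subst:
  fixes \<phi> :: "'x \<Rightarrow> ('y, 'k::field_char_0) ncps"
  assumes X: "finite X" and \<phi>: "\<And>x. x \<in> X \<Longrightarrow> \<phi> x \<in> free_lie Y" and f: "f \<in> free_lie X"
  shows "nc_subst X \<phi> f \<in> free_lie Y"
proof -
  let ?r = "nc_subst X \<phi> f"
  have \<phi>1: "\<phi> x \<in> nc_filt 1" if "x \<in> X" for x
    by (rule free_lie_filt[OF \<phi>[OF that]])
  have r: "nc.is_subst X \<phi> f ?r"
    by (rule nc_subst_is_subst[OF X \<phi>1])
  have "tensor.is_subst X (\<lambda>x. tensor_left (\<phi> x) + tensor_right (\<phi> x)) f (tensor_left ?r + tensor_right ?r)"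
    using f by (intro tensor.is_subst_primitive_add X tensor_left_right_commute
        tensor_left.hom_is_subst tensor_right.hom_is_subst r) (simp add: free_lie_def)
  moreover have "tensor.is_subst X (\<lambda>x. tensor_left (\<phi> x) + tensor_right (\<phi> x)) f (nc_delta ?r)"
    using nc_delta.hom_is_subst[OF r] \<phi>
    by (subst tensor.is_subst_cong[of X _ "\<lambda>x. nc_delta (\<phi> x)"])
      (auto simp: free_lie_def nc_primitive_iff)
  ultimately have "nc_delta ?r = tensor_left ?r + tensor_right ?r"
    by (rule tensor.is_subst_unique[rotated])
  then show ?thesis
    using nc_subst_closed[of X \<phi> Y f] \<phi> by (auto simp: free_lie_def nc_primitive_iff)
qed

lemma nc_subst_exp:
  fixes \<phi> :: "'x \<Rightarrow> ('y, 'k::field_char_0) ncps"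
  assumes "finite X" "\<And>x. x \<in> X \<Longrightarrow> \<phi> x \<in> nc_filt 1" "f \<in> nc_filt 1"
  shows "nc_subst X \<phi> (nc_exp f) = nc_exp (nc_subst X \<phi> f)"
proof -
  interpret filtered_hom nc_filt nc_const nc_filt nc_const "nc_subst X \<phi>"
    by (rule nc_subst_hom[OF assms(1,2)])
  show ?thesis
    using nc_exp_eqI[OF hom_F[OF assms(3)] hom_is_exp[OF nc_exp_is_exp[OF assms(3)]]] by simp
qed

subsection \<open>Exponentials of primitive series form a group\<close>

lemma nc_delta_exp:
  fixes f :: "('x, 'k::field_char_0) ncps"
  assumes "nc_primitive f"
  shows "nc_delta (nc_exp f) = tensor_left (nc_exp f) * tensor_right (nc_exp f)"
proof -
  have f1: "f \<in> nc_filt 1" by (rule nc_primitive_filt[OF assms])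
  have e: "nc.is_exp f (nc_exp f)" by (rule nc_exp_is_exp[OF f1])
  have "tensor.is_exp (tensor_left f + tensor_right f) (tensor_left (nc_exp f) * tensor_right (nc_exp f))"
    by (intro tensor.is_exp_add tensor_left_right_commute tensor_left.hom_F tensor_right.hom_F f1
        tensor_left.hom_is_exp tensor_right.hom_is_exp e)
  moreover have "tensor.is_exp (tensor_left f + tensor_right f) (nc_delta (nc_exp f))"
    using nc_delta.hom_is_exp[OF e] assms by (simp add: nc_primitive_iff)
  ultimately show ?thesis by (rule tensor.is_exp_unique[rotated])
qed

text \<open>
  The exponential is injective on the tensor square as well, so the logarithm of a group-like
  series is primitive.  As group-like series are closed under multiplication, this replaces the
  Campbell-Baker-Hausdorff formula.
\<close>

lemma free_lie_exp_mult:
  fixes f g :: "('x, 'k::field_char_0) ncps"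
  assumes f: "f \<in> free_lie X" and g: "g \<in> free_lie X"
  obtains h where "h \<in> free_lie X" "nc_exp h = nc_exp f * nc_exp g"
proof -
  let ?E = "nc_exp f * nc_exp g"
  have "?E \<in> carrier (nc_ring X)"
    by (intro nc_ring_mult_closed free_lie_closed f g)
  moreover have "coeff ?E [] = 1" by (simp add: coeff_mult coeff_exp_Nil)
  ultimately obtain h where h: "h \<in> carrier (nc_ring X)" "h \<in> nc_filt 1" "nc_exp h = ?E"
    using nc_log_exists by blast
  have e: "nc.is_exp h ?E" using nc_exp_is_exp[OF h(2)] h(3) by simp
  have "nc_delta ?E = (tensor_left (nc_exp f) * tensor_right (nc_exp f)) *
      (tensor_left (nc_exp g) * tensor_right (nc_exp g))"
    using f g by (simp add: nc_delta.hom_mult nc_delta_exp free_lie_def)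
  also have "\<dots> = tensor_left (nc_exp f) * (tensor_left (nc_exp g) * tensor_right (nc_exp f)) *
      tensor_right (nc_exp g)"
    unfolding tensor_left_right_commute[of "nc_exp g" "nc_exp f"] by (simp only: mult.assoc)
  also have "\<dots> = tensor_left ?E * tensor_right ?E"
    by (simp only: mult.assoc tensor_left.hom_mult tensor_right.hom_mult)
  finally have "nc_delta ?E = tensor_left ?E * tensor_right ?E" .
  moreover have "tensor.is_exp (tensor_left h + tensor_right h) (tensor_left ?E * tensor_right ?E)"
    by (intro tensor.is_exp_add tensor_left_right_commute tensor_left.hom_F tensor_right.hom_F h(2)
        tensor_left.hom_is_exp tensor_right.hom_is_exp e)
  ultimately have "nc_delta h = tensor_left h + tensor_right h"
    using nc_delta.hom_is_exp[OF e] h(2)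
    by (intro tensor.is_exp_inject[of _ _ "nc_delta ?E"] tensor.F_add nc_delta.hom_F
        tensor_left.hom_F tensor_right.hom_F) auto
  then have "h \<in> free_lie X" using h(1) by (simp add: free_lie_def nc_primitive_iff)
  with h(3) show ?thesis by (rule that[rotated])
qed

text \<open>
  In one letter the coproduct is that of a divided power, which leaves no primitive series but
  the linear ones.
\<close>

lemma nc_coproduct_single_letter:
  "nc_coproduct f ([a], replicate m a) = coeff f (replicate (Suc m) a) * of_nat (Suc m)"
proof -
  have "w = replicate (Suc m) a" if "w \<in> shuffles [a] (replicate m a)" for w
    using length_shuffles[OF that] set_shuffles[OF that]
    by (intro replicate_eqI) auto
  moreover have "replicate (Suc m) a \<in> shuffles [a] (replicate m a)"
    by (cases m) (auto intro: Cons_in_shuffles_leftI)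
  ultimately have shuffles: "shuffles [a] (replicate m a) = {replicate (Suc m) a}" by blast
  have c0: "count_list (unshuffles (replicate m a)) ([], replicate m a) = 1" for m
    by (induction m) (simp_all add: count_unshuffles_Cons del: unshuffles.simps(2))
  have "count_list (unshuffles (replicate (Suc m) a)) ([a], replicate m a) = Suc m"
  proof (induction m)
    case (Suc m)
    have "count_list (unshuffles (replicate (Suc (Suc m)) a)) ([a], replicate (Suc m) a)
        = count_list (unshuffles (replicate (Suc m) a)) ([], replicate (Suc m) a)
          + count_list (unshuffles (replicate (Suc m) a)) ([a], replicate m a)"
      by (simp add: count_unshuffles_Cons del: unshuffles.simps(2))
    then show ?case by (simp only: c0 Suc)
  qed simp
  then show ?thesis by (simp only: nc_coproduct_def prod.case shuffles) simp
qed

lemma nc_primitive_replicate: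
  fixes f :: "('x, 'k::field_char_0) ncps"
  assumes "nc_primitive f" "n \<noteq> 1" shows "coeff f (replicate n a) = 0"
proof (cases n)
  case 0
  then show ?thesis using nc_primitive_filt[OF assms(1)] by (simp add: nc_filt_def)
next
  case (Suc m)
  with assms(2) have "m \<noteq> 0" by simp
  have "nc_coproduct f ([a], replicate m a) = 0"
    using assms(1) \<open>m \<noteq> 0\<close> unfolding nc_primitive_def by (simp add: nc_tensor_def coeff_one)
  then show ?thesis
    unfolding Suc nc_coproduct_single_letter by (simp del: of_nat_Suc)
qed

lemma nc_exp_primitive_replicate:
  fixes f :: "('x, 'k::field_char_0) ncps"
  assumes "nc_primitive f" "coeff f [a] = 0" "n \<noteq> 0"
  shows "coeff (nc_exp f) (replicate n a) = 0"
proof -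
  obtain m where n: "n = Suc m" using assms(3) by (cases n) auto
  have "nc_coproduct (nc_exp f) ([a], replicate m a) = coeff (nc_exp f) [a] * coeff (nc_exp f) (replicate m a)"
    unfolding coeff_delta[symmetric] nc_delta_exp[OF assms(1)] coeff_left_mult_right ..
  then show ?thesis
    unfolding n nc_coproduct_single_letter
    using coeff_exp_single[OF nc_primitive_filt[OF assms(1)]] assms(2) by (simp del: of_nat_Suc)
qed


section \<open>The infinitesimal Artin algebras\<close>

lemma nc_ring_is_ring: "ring (nc_ring X)"
proof (rule ringI)
  show "abelian_group (nc_ring X)"
    by (rule abelian_groupI)
      (auto simp: nc_ring_closed algebra_simps intro: nc_ring_add_closed
        intro!: bexI[of _ "- _"])
  show "monoid (nc_ring X)"
    by (rule monoidI) (auto simp: nc_ring_closed mult.assoc intro: nc_ring_mult_closed)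
qed (auto simp: algebra_simps)

lemma nc_ring_a_inv: "f \<in> carrier (nc_ring X) \<Longrightarrow> \<ominus>\<^bsub>nc_ring X\<^esub> f = - f"
proof -
  assume "f \<in> carrier (nc_ring X)"
  interpret ring "nc_ring X" by (rule nc_ring_is_ring)
  show ?thesis
    by (rule minus_equality) (use \<open>f \<in> _\<close> in \<open>auto intro: nc_ring_closed\<close>)
qed

lemma nc_idealI:
  assumes "K \<subseteq> carrier (nc_ring X)" "0 \<in> K" "\<And>f g. f \<in> K \<Longrightarrow> g \<in> K \<Longrightarrow> f - g \<in> K"
    and "\<And>f g. f \<in> K \<Longrightarrow> g \<in> carrier (nc_ring X) \<Longrightarrow> g * f \<in> K"
    and "\<And>f g. f \<in> K \<Longrightarrow> g \<in> carrier (nc_ring X) \<Longrightarrow> f * g \<in> K"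
  shows "ideal K (nc_ring X)"
proof (rule idealI[OF nc_ring_is_ring])
  interpret ring "nc_ring X" by (rule nc_ring_is_ring)
  have neg: "- f \<in> K" if "f \<in> K" for f using assms(3)[OF assms(2) that] by simp
  show "subgroup K (add_monoid (nc_ring X))"
  proof (rule add.subgroupI)
    show "\<ominus>\<^bsub>nc_ring X\<^esub> f \<in> K" if "f \<in> K" for f
      using nc_ring_a_inv[OF subsetD[OF assms(1) that]] neg[OF that] by simp
    show "f \<oplus>\<^bsub>nc_ring X\<^esub> g \<in> K" if "f \<in> K" "g \<in> K" for f g
      using assms(3)[OF that(1) neg[OF that(2)]] by simp
    show "K \<noteq> {}" using assms(2) by blast
  qed (use assms(1) in simp)
qed (simp_all add: assms(4,5))

lemma nc_idealD:
  assumes "ideal K (nc_ring X)"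
  shows "K \<subseteq> carrier (nc_ring X)" "0 \<in> K" "f \<in> K \<Longrightarrow> g \<in> K \<Longrightarrow> f - g \<in> K"
    and "f \<in> K \<Longrightarrow> g \<in> carrier (nc_ring X) \<Longrightarrow> g * f \<in> K"
    and "f \<in> K \<Longrightarrow> g \<in> carrier (nc_ring X) \<Longrightarrow> f * g \<in> K"
proof -
  interpret ideal K "nc_ring X" by (rule assms)
  show sub: "K \<subseteq> carrier (nc_ring X)" by (rule a_subset)
  show "0 \<in> K" 
    using additive_subgroup.zero_closed[OF ideal.axioms(1)[OF assms]] by simp
  show "f - g \<in> K" if "f \<in> K" "g \<in> K"
    using additive_subgroup.a_closed[OF ideal.axioms(1)[OF assms] that(1)
        additive_subgroup.a_inv_closed[OF ideal.axioms(1)[OF assms] that(2)]] nc_ring_a_inv[OF subsetD[OF sub that(2)]]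
    by simp
  show "g * f \<in> K" if "f \<in> K" "g \<in> carrier (nc_ring X)" using I_l_closed[OF that] by simp
  show "f * g \<in> K" if "f \<in> K" "g \<in> carrier (nc_ring X)" using I_r_closed[OF that] by simp
qed

lemma finite_edges: "finite (edges n)"
  by (rule finite_subset[of _ "Pow {1..n}"]) (auto simp: edges_def)

lemma edgesI: "i \<in> {1..n} \<Longrightarrow> j \<in> {1..n} \<Longrightarrow> i \<noteq> j \<Longrightarrow> {i, j} \<in> edges n"
  by (auto simp: edges_def)

lemma edges_mono: "edges n \<subseteq> edges (Suc n)"
  unfolding edges_def by (intro Collect_mono) (metis atLeastAtMost_iff le_SucI)

lemma gen_closed: "i \<in> {1..n} \<Longrightarrow> j \<in> {1..n} \<Longrightarrow> i \<noteq> j \<Longrightarrow> gen i j \<in> carrier (nc_ring (edges n))"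
  unfolding gen_def by (intro nc_ring_closed edgesI)

lemma nc_bracket_closed:
  "f \<in> carrier (nc_ring X) \<Longrightarrow> g \<in> carrier (nc_ring X) \<Longrightarrow> nc_bracket f g \<in> carrier (nc_ring X)"
  unfolding nc_bracket_def by (intro nc_ring_diff_closed nc_ring_mult_closed)

lemma artin_rels_cases:
  assumes "r \<in> artin_rels n"
  obtains (adjacent) i j k where "i \<in> {1..n}" "j \<in> {1..n}" "k \<in> {1..n}" "i \<noteq> j" "i \<noteq> k" "j \<noteq> k"
      "r = nc_bracket (gen i j) (gen i k + gen j k)"
  | (disjoint) i j k l where "i \<in> {1..n}" "j \<in> {1..n}" "k \<in> {1..n}" "l \<in> {1..n}" "i \<noteq> j" "k \<noteq> l"
      "{i, j} \<inter> {k, l} = {}" "r = nc_bracket (gen i j) (gen k l)"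
  using assms unfolding artin_rels_def
proof (elim UnE CollectE exE conjE)
  fix i j k assume "{i, j, k} \<subseteq> {1..n}" "distinct [i, j, k]"
    "r = nc_bracket (gen i j) (gen i k + gen j k)"
  then show thesis by (intro adjacent[of i j k]) simp_all
next
  fix i j k l assume "{i, j, k, l} \<subseteq> {1..n}" "i \<noteq> j" "k \<noteq> l" "{i, j} \<inter> {k, l} = {}"
    "r = nc_bracket (gen i j) (gen k l)"
  then show thesis by (intro disjoint[of i j k l]) simp_all
qed

lemma artin_rels_closed: "artin_rels n \<subseteq> carrier (nc_ring (edges n))"
proof
  fix r assume "r \<in> artin_rels n"
  then show "r \<in> carrier (nc_ring (edges n))"
    by (cases rule: artin_rels_cases)
      (auto intro!: nc_bracket_closed nc_ring_add_closed gen_closed simp del: atLeastAtMost_iff)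
qed

abbreviation artin_pre_ideal :: "nat \<Rightarrow> (nat set, 'k::ring_1) ncps set" where
  "artin_pre_ideal n \<equiv> Idl\<^bsub>nc_ring (edges n)\<^esub> (artin_rels n)"

lemma artin_ideal_iff:
  "f \<in> artin_ideal n \<longleftrightarrow>
    f \<in> carrier (nc_ring (edges n)) \<and> (\<forall>N. \<exists>g\<in>artin_pre_ideal n. f - g \<in> nc_filt (Suc N))"
  by (simp add: artin_ideal_def nc_filt_def less_Suc_eq_le)

lemma artin_pre_ideal: "ideal (artin_pre_ideal n) (nc_ring (edges n))"
  by (rule ring.genideal_ideal[OF nc_ring_is_ring artin_rels_closed])

lemma artin_rels_ideal: "artin_rels n \<subseteq> artin_ideal n"
proof
  fix r :: "(nat set, 'a) ncps" assume r: "r \<in> artin_rels n"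
  then have "r \<in> artin_pre_ideal n"
    using ring.genideal_self[OF nc_ring_is_ring artin_rels_closed] by blast
  then show "r \<in> artin_ideal n"
    using r artin_rels_closed[of n] by (auto simp: artin_ideal_iff nc_filt_def intro!: bexI[of _ r])
qed

lemma artin_ideal: "ideal (artin_ideal n :: (nat set, 'k::field_char_0) ncps set) (nc_ring (edges n))"
proof (rule nc_idealI)
  note J = nc_idealD[OF artin_pre_ideal]
  fix f g :: "(nat set, 'k) ncps" assume f: "f \<in> artin_ideal n"
  show "f - g \<in> artin_ideal n" if g: "g \<in> artin_ideal n"
    unfolding artin_ideal_iff
  proof (intro conjI allI)
    show "f - g \<in> carrier (nc_ring (edges n))"
      using f g by (auto simp: artin_ideal_iff intro: nc_ring_diff_closed)
    fix N
    obtain f' g' where "f' \<in> artin_pre_ideal n" "f - f' \<in> nc_filt (Suc N)"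
      "g' \<in> artin_pre_ideal n" "g - g' \<in> nc_filt (Suc N)"
      using f g unfolding artin_ideal_iff by blast
    then show "\<exists>h\<in>artin_pre_ideal n. f - g - h \<in> nc_filt (Suc N)"
      using J(3)[of f' n g'] nc.F_diff[of "f - f'" "Suc N" "g - g'"]
      by (intro bexI[of _ "f' - g'"]) (simp_all add: algebra_simps)
  qed
  assume g: "g \<in> carrier (nc_ring (edges n))"
  have approx: "\<exists>h\<in>artin_pre_ideal n. g * f - h \<in> nc_filt (Suc N)"
    "\<exists>h\<in>artin_pre_ideal n. f * g - h \<in> nc_filt (Suc N)" for N
  proof -
    obtain f' where f': "f' \<in> artin_pre_ideal n" "f - f' \<in> nc_filt (Suc N)"
      using f unfolding artin_ideal_iff by blast
    show "\<exists>h\<in>artin_pre_ideal n. g * f - h \<in> nc_filt (Suc N)"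
      using nc.F_mult_left[OF f'(2), of g] J(4)[OF f'(1) g]
      by (intro bexI[of _ "g * f'"]) (simp_all add: algebra_simps)
    show "\<exists>h\<in>artin_pre_ideal n. f * g - h \<in> nc_filt (Suc N)"
      using nc.F_mult_right[OF f'(2), of g] J(5)[OF f'(1) g]
      by (intro bexI[of _ "f' * g"]) (simp_all add: algebra_simps)
  qed
  then show "g * f \<in> artin_ideal n" "f * g \<in> artin_ideal n"
    using f g by (auto simp: artin_ideal_iff intro: nc_ring_mult_closed)
next
  show "(0 :: (nat set, 'k) ncps) \<in> artin_ideal n"
    using nc_idealD(2)[OF artin_pre_ideal] by (auto simp: artin_ideal_iff nc_ring_closed intro!: bexI[of _ 0])
qed (auto simp: artin_ideal_iff)

lemmas artin_idealD = nc_idealD[OF artin_ideal]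

lemma artin_ideal_add:
  fixes f g :: "(nat set, 'k::field_char_0) ncps"
  shows "f \<in> artin_ideal n \<Longrightarrow> g \<in> artin_ideal n \<Longrightarrow> f + g \<in> artin_ideal n"
  using artin_idealD(3)[OF _ artin_idealD(3)[OF artin_idealD(2)], of f n g] by simp

lemma artin_ideal_limit:
  fixes f :: "(nat set, 'k::field_char_0) ncps"
  assumes "f \<in> carrier (nc_ring (edges n))" "\<And>N. \<exists>g\<in>artin_ideal n. f - g \<in> nc_filt N"
  shows "f \<in> artin_ideal n"
  unfolding artin_ideal_iff
proof (intro conjI allI)
  fix N
  obtain g where g: "g \<in> artin_ideal n" "f - g \<in> nc_filt (Suc N)" using assms(2) by blast
  then obtain h where "h \<in> artin_pre_ideal n" "g - h \<in> nc_filt (Suc N)"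
    unfolding artin_ideal_iff by blast
  then show "\<exists>h\<in>artin_pre_ideal n. f - h \<in> nc_filt (Suc N)"
    using g(2) nc.F_diff_trans by blast
qed (rule assms)

text \<open>
  Homomorphisms out of the Artin algebra are obtained from this: the series that a continuous
  homomorphism maps into a closed ideal form a closed ideal themselves.
\<close>

lemma artin_ideal_minimal:
  fixes K :: "(nat set, 'k::field_char_0) ncps set"
  assumes rels: "artin_rels n \<subseteq> K" and zero: "0 \<in> K"
    and diff: "\<And>f g. f \<in> K \<Longrightarrow> g \<in> K \<Longrightarrow> f - g \<in> K"
    and mult: "\<And>f g. f \<in> K \<Longrightarrow> g \<in> carrier (nc_ring (edges n)) \<Longrightarrow> g * f \<in> K \<and> f * g \<in> K"
    and limit: "\<And>f. f \<in> carrier (nc_ring (edges n)) \<Longrightarrow> (\<And>N. \<exists>g\<in>K. f - g \<in> nc_filt N) \<Longrightarrow> f \<in> K"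
  shows "artin_ideal n \<subseteq> K"
proof
  fix f :: "(nat set, 'k) ncps" assume f: "f \<in> artin_ideal n"
  have "ideal (K \<inter> carrier (nc_ring (edges n))) (nc_ring (edges n))"
    by (rule nc_idealI)
      (auto simp: zero diff mult nc_ring_closed intro: nc_ring_diff_closed nc_ring_mult_closed)
  then have sub: "artin_pre_ideal n \<subseteq> K"
    using ring.genideal_minimal[OF nc_ring_is_ring, of "K \<inter> carrier (nc_ring (edges n))" "edges n" "artin_rels n"]
      rels artin_rels_closed by blast
  show "f \<in> K"
  proof (rule limit)
    fix N
    obtain g where "g \<in> artin_pre_ideal n" "f - g \<in> nc_filt (Suc N)"
      using f unfolding artin_ideal_iff by blast
    then show "\<exists>g\<in>K. f - g \<in> nc_filt N"
      using sub nc.F_mono[of N "Suc N"] by auto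
  qed (use f in \<open>simp add: artin_ideal_iff\<close>)
qed

lemma artin_ideal_kernel:
  fixes h :: "(nat set, 'k::field_char_0) ncps \<Rightarrow> 'b::ring_1"
  assumes "filtered_hom nc_filt nc_const F sc h" "\<And>r. r \<in> artin_rels n \<Longrightarrow> h r = 0"
    and "f \<in> artin_ideal n"
  shows "h f = 0"
proof -
  interpret filtered_hom nc_filt nc_const F sc h by (rule assms(1))
  have "artin_ideal n \<subseteq> {f. h f = 0}"
  proof (rule artin_ideal_minimal)
    fix f :: "(nat set, 'k) ncps" assume approx: "\<And>N. \<exists>g\<in>{f. h f = 0}. f - g \<in> nc_filt N"
    have "h f \<in> F N" for N
    proof -
      obtain g where "h g = 0" "f - g \<in> nc_filt N" using approx[of N] by blast
      then show ?thesis using hom_F[of "f - g" N] by (simp add: hom_diff)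
    qed
    then show "f \<in> {f. h f = 0}" using cod.F_separated by simp
  qed (use assms(2) in \<open>auto simp: hom_diff hom_mult\<close>)
  then show ?thesis using assms(3) by blast
qed

lemma artin_ideal_filt:
  fixes f :: "(nat set, 'k::field_char_0) ncps"
  assumes "f \<in> artin_ideal n" shows "f \<in> nc_filt 2"
proof -
  have gen: "gen i j \<in> nc_filt 1" for i j :: nat
    by (simp add: gen_def)
  have bracket: "nc_bracket g h \<in> nc_filt 2" if "g \<in> nc_filt 1" "h \<in> nc_filt 1"
    for g h :: "(nat set, 'k) ncps"
    using nc.F_diff[OF nc.F_mult[OF that] nc.F_mult[OF that(2,1)]]
    by (simp only: nc_bracket_def one_add_one)
  have "artin_ideal n \<subseteq> (nc_filt 2 :: (nat set, 'k) ncps set)"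
  proof (rule artin_ideal_minimal)
    show "artin_rels n \<subseteq> (nc_filt 2 :: (nat set, 'k) ncps set)"
    proof
      fix r :: "(nat set, 'k) ncps" assume "r \<in> artin_rels n"
      then show "r \<in> nc_filt 2"
        by (cases rule: artin_rels_cases) (simp_all only: bracket gen nc.F_add)
    qed
    show "f \<in> nc_filt 2" if limit: "\<And>N. \<exists>g\<in>nc_filt 2. f - g \<in> nc_filt N" for f :: "(nat set, 'k) ncps"
    proof -
      obtain g where "g \<in> nc_filt 2" "f - g \<in> nc_filt 2" using limit by blast
      then show ?thesis using nc.F_add[of "f - g" 2 g] by simp
    qed
  qed (auto intro: nc.F_diff nc.F_mult_left nc.F_mult_right)
  then show ?thesis using assms by blast
qed

lemma artin_ideal_filt_1: "f \<in> artin_ideal n \<Longrightarrow> f \<in> nc_filt 1"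
  for f :: "(nat set, 'k::field_char_0) ncps"
  using nc.F_mono[of 1 2] artin_ideal_filt by auto

subsection \<open>Classes of series\<close>

lemma mem_artin_class: "g \<in> artin_class n f \<longleftrightarrow> g - f \<in> artin_ideal n"
proof -
  have "g \<in> artin_class n f \<longleftrightarrow> (\<exists>h\<in>artin_ideal n. g = h + f)"
    by (simp add: artin_class_def a_r_coset_def')
  then show ?thesis by (metis add_diff_cancel_right' diff_add_cancel)
qed

lemma artin_class_eq_iff: "artin_class n f = artin_class n g \<longleftrightarrow> f - g \<in> artin_ideal n"
  for f g :: "(nat set, 'k::field_char_0) ncps"
proof
  assume "artin_class n f = artin_class n g"
  moreover have "f \<in> artin_class n f" using artin_idealD(2) by (simp add: mem_artin_class)
  ultimately show "f - g \<in> artin_ideal n" by (simp add: mem_artin_class)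
next
  assume "f - g \<in> artin_ideal n"
  then have "h - f \<in> artin_ideal n \<longleftrightarrow> h - g \<in> artin_ideal n" for h
    using artin_ideal_add[of "h - f" n "f - g"] artin_idealD(3)[of "h - g" n "f - g"]
    by (metis diff_add_cancel diff_diff_eq2 add_diff_eq)
  then show "artin_class n f = artin_class n g"
    unfolding set_eq_iff mem_artin_class by blast
qed

lemma artin_class_self: "f \<in> artin_class n f" for f :: "(nat set, 'k::field_char_0) ncps"
  using artin_idealD(2) by (simp add: mem_artin_class)

lemma UN_artin_class:
  fixes f :: "(nat set, 'k::field_char_0) ncps"
  assumes "\<And>g. g - f \<in> artin_ideal n \<Longrightarrow> artin_class m (h g) = artin_class m (h f)"
  shows "(\<Union>g\<in>artin_class n f. artin_class m (h g)) = artin_class m (h f)"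
  using assms artin_class_self[of f n] unfolding mem_artin_class[symmetric] by blast

lemma artin_alg_ring: "ring (artin_alg n :: (nat set, 'k::field_char_0) ncps set ring)"
  unfolding artin_alg_def by (rule ideal.quotient_is_ring[OF artin_ideal])

lemma artin_alg_carrier: "carrier (artin_alg n) = artin_class n ` carrier (nc_ring (edges n))"
  by (auto simp: artin_alg_def FactRing_def A_RCOSETS_def' artin_class_def)

lemma artin_class_closed: "f \<in> carrier (nc_ring (edges n)) \<Longrightarrow> artin_class n f \<in> carrier (artin_alg n)"
  by (simp add: artin_alg_carrier)

lemma artin_class_hom:
  "(artin_class n :: (nat set, 'k::field_char_0) ncps \<Rightarrow> _) \<in> ring_hom (nc_ring (edges n)) (artin_alg n)"
  using ideal.rcos_ring_hom[OF artin_ideal] by (simp add: artin_alg_def artin_class_def[abs_def])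

lemma artin_class_mult:
  fixes f g :: "(nat set, 'k::field_char_0) ncps"
  assumes "f \<in> carrier (nc_ring (edges n))" "g \<in> carrier (nc_ring (edges n))"
  shows "artin_class n f \<otimes>\<^bsub>artin_alg n\<^esub> artin_class n g = artin_class n (f * g)"
  using ring_hom_mult[OF artin_class_hom assms] by simp

lemma artin_class_add:
  fixes f g :: "(nat set, 'k::field_char_0) ncps"
  assumes "f \<in> carrier (nc_ring (edges n))" "g \<in> carrier (nc_ring (edges n))"
  shows "artin_class n f \<oplus>\<^bsub>artin_alg n\<^esub> artin_class n g = artin_class n (f + g)"
  using ring_hom_add[OF artin_class_hom assms] by simp

lemma artin_class_one: "\<one>\<^bsub>artin_alg n\<^esub> = artin_class n (1 :: (nat set, 'k::field_char_0) ncps)"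
  using ring_hom_one[OF artin_class_hom[of n, where ?'k = 'k]] by simp

lemma artin_class_zero: "\<zero>\<^bsub>artin_alg n\<^esub> = artin_class n (0 :: (nat set, 'k::field_char_0) ncps)"
proof -
  have "\<zero>\<^bsub>artin_alg n\<^esub> = (artin_ideal n :: (nat set, 'k) ncps set)"
    by (simp add: artin_alg_def FactRing_def)
  moreover have "artin_class n 0 = (artin_ideal n :: (nat set, 'k) ncps set)"
    by (simp add: set_eq_iff mem_artin_class)
  ultimately show ?thesis by simp
qed

lemma artin_class_inv:
  fixes f g :: "(nat set, 'k::field_char_0) ncps"
  assumes "f \<in> carrier (nc_ring (edges n))" "g \<in> carrier (nc_ring (edges n))" "f * g = 1" "g * f = 1"
  shows "inv\<^bsub>artin_alg n\<^esub> (artin_class n f) = artin_class n g"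
proof -
  interpret ring "artin_alg n :: (nat set, 'k) ncps set ring" by (rule artin_alg_ring)
  show ?thesis
    by (rule inv_unique'[symmetric])
      (use assms in \<open>simp_all add: artin_class_closed artin_class_mult artin_class_one\<close>)
qed

text \<open>
  Congruent series have congruent partial sums of the exponential, and \<open>artin_ideal n\<close> is closed.
\<close>

lemma artin_exp_class:
  fixes f :: "(nat set, 'k::field_char_0) ncps"
  assumes f: "f \<in> carrier (nc_ring (edges n))" "f \<in> nc_filt 1"
  shows "artin_exp n (artin_class n f) = artin_class n (nc_exp f)"
  unfolding artin_exp_def
proof (rule UN_artin_class)
  fix g assume gf: "g - f \<in> artin_ideal n"
  have gC: "g \<in> carrier (nc_ring (edges n))"
    using nc_ring_add_closed[OF subsetD[OF artin_idealD(1) gf] f(1)] by simp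
  have g1: "g \<in> nc_filt 1"
    using nc.F_add[OF artin_ideal_filt_1[OF gf] f(2)] by simp
  have pow: "g ^ k - f ^ k \<in> artin_ideal n" for k
  proof (induction k)
    case (Suc k)
    have "g ^ Suc k - f ^ Suc k = g * (g ^ k - f ^ k) + (g - f) * f ^ k"
      by (simp add: algebra_simps)
    then show ?case
      by (simp only: artin_ideal_add artin_idealD(4)[OF Suc gC]
          artin_idealD(5)[OF gf nc_ring_power_closed[OF f(1)]])
  qed (simp add: artin_idealD)
  have partial: "nc.exp_partial g N - nc.exp_partial f N \<in> artin_ideal n" for N
  proof -
    have "nc.exp_partial g N - nc.exp_partial f N = (\<Sum>k\<le>N. nc_const (1 / fact k) * (g ^ k - f ^ k))"
      by (simp add: nc.exp_partial_def sum_subtractf right_diff_distrib)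
    moreover have "(\<Sum>k\<in>A. nc_const (1 / fact k) * (g ^ k - f ^ k)) \<in> artin_ideal n" for A :: "nat set"
      by (induction A rule: infinite_finite_induct)
        (auto intro!: artin_ideal_add artin_idealD(4) pow nc_ring_closed simp: artin_idealD(2))
    ultimately show ?thesis by simp
  qed
  have "nc_exp g - nc_exp f \<in> artin_ideal n"
  proof (rule artin_ideal_limit)
    show "nc_exp g - nc_exp f \<in> carrier (nc_ring (edges n))"
      by (intro nc_ring_diff_closed nc_exp_closed gC f)
    fix N
    have "nc_exp g - nc.exp_partial g N \<in> nc_filt (Suc N)" "nc_exp f - nc.exp_partial f N \<in> nc_filt (Suc N)"
      using nc_exp_is_exp[OF g1] nc_exp_is_exp[OF f(2)] by (auto simp: nc.is_exp_def nc.approx_def)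
    from nc.F_diff[OF this] have "(nc_exp g - nc_exp f) - (nc.exp_partial g N - nc.exp_partial f N) \<in> nc_filt (Suc N)"
      by (simp add: algebra_simps)
    then show "\<exists>h\<in>artin_ideal n. nc_exp g - nc_exp f - h \<in> nc_filt N"
      using partial nc.F_mono[of N "Suc N"] by auto
  qed
  then show "artin_class n (nc_exp g) = artin_class n (nc_exp f)" by (simp add: artin_class_eq_iff)
qed

lemma exp_half_class:
  fixes f :: "(nat set, 'k::field_char_0) ncps"
  assumes "f \<in> carrier (nc_ring (edges n))" "f \<in> nc_filt 1"
  shows "exp_half n f = artin_class n (nc_exp (nc_scale (1/2) f))"
  unfolding exp_half_def
  by (rule artin_exp_class) (use assms in \<open>auto simp: nc_ring_closed nc_filt_def\<close>)

lemma equiv2_iff: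
  fixes f g :: "(nat set, 'k::field_char_0) ncps"
  shows "equiv2 (artin_class n f) (artin_class n g) \<longleftrightarrow> (\<forall>w. length w \<le> 1 \<longrightarrow> coeff f w = coeff g w)"
proof -
  have eq: "coeff h w = coeff f w" if "h \<in> artin_class n f" "length w \<le> 1" for h f :: "(nat set, 'k) ncps" and w
    using artin_ideal_filt[of "h - f" n] that by (simp add: mem_artin_class nc_filt_def)
  show ?thesis
    unfolding equiv2_def using eq artin_class_self[of f n] artin_class_self[of g n] by metis
qed

subsection \<open>The action of the symmetric group\<close>

definition edge_action :: "nat \<Rightarrow> (nat \<Rightarrow> nat) \<Rightarrow> (nat set, 'k::ring_1) ncps \<Rightarrow> (nat set, 'k) ncps" where
  "edge_action n \<pi> f = nc_subst (edges n) (\<lambda>e. nc_var (\<pi> ` e)) f"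

lemma edge_action_hom:
  "filtered_hom nc_filt nc_const nc_filt nc_const
    (edge_action n \<pi> :: (nat set, 'k::field_char_0) ncps \<Rightarrow> _)"
  unfolding edge_action_def[abs_def] by (rule nc_subst_hom[OF finite_edges]) simp

lemma edge_action_edge:
  assumes "\<pi> permutes {1..n}" "e \<in> edges n" shows "\<pi> ` e \<in> edges n"
  using assms permutes_inj[OF assms(1)] permutes_in_image[OF assms(1)]
  unfolding edges_def by (auto dest: injD)

lemma edge_action_closed:
  fixes f :: "(nat set, 'k::field_char_0) ncps"
  assumes "\<pi> permutes {1..n}"
  shows "edge_action n \<pi> f \<in> carrier (nc_ring (edges n))"
  unfolding edge_action_def
  by (rule nc_subst_closed) (auto intro: nc_ring_closed edge_action_edge[OF assms])

lemma edge_action_var: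
  "e \<in> edges n \<Longrightarrow> edge_action n \<pi> (nc_var e) = (nc_var (\<pi> ` e) :: (nat set, 'k::field_char_0) ncps)"
  unfolding edge_action_def by (rule nc_subst_var[OF finite_edges]) auto

lemma edge_action_gen:
  assumes "i \<in> {1..n}" "j \<in> {1..n}" "i \<noteq> j"
  shows "edge_action n \<pi> (gen i j) = (gen (\<pi> i) (\<pi> j) :: (nat set, 'k::field_char_0) ncps)"
  unfolding gen_def edge_action_var[OF edgesI[OF assms]] by simp

lemma edge_action_comp:
  assumes "\<tau> permutes {1..n}"
  shows "edge_action n \<pi> (edge_action n \<tau> f) = edge_action n (\<pi> \<circ> \<tau>) (f :: (nat set, 'k::field_char_0) ncps)"
proof -
  interpret h: filtered_hom nc_filt nc_const nc_filt nc_const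
    "edge_action n \<pi> :: (nat set, 'k) ncps \<Rightarrow> _" by (rule edge_action_hom)
  have "nc.is_subst (edges n) (\<lambda>e. edge_action n \<pi> (nc_var (\<tau> ` e))) f (edge_action n \<pi> (edge_action n \<tau> f))"
    unfolding edge_action_def[of n \<tau>]
    by (rule h.hom_is_subst[OF nc_subst_is_subst[OF finite_edges]]) simp
  then have "nc.is_subst (edges n) (\<lambda>e. nc_var ((\<pi> \<circ> \<tau>) ` e)) f (edge_action n \<pi> (edge_action n \<tau> f))"
    by (subst nc.is_subst_cong[of _ _ "\<lambda>e. edge_action n \<pi> (nc_var (\<tau> ` e))"])
      (simp_all add: edge_action_var edge_action_edge[OF assms] image_comp)
  then show ?thesis
    unfolding edge_action_def[of n "\<pi> \<circ> \<tau>"]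
    by (rule nc.is_subst_unique[OF _ nc_subst_is_subst[OF finite_edges]]) simp
qed

lemma edge_action_id:
  "f \<in> carrier (nc_ring (edges n)) \<Longrightarrow> edge_action n id f = (f :: (nat set, 'k::field_char_0) ncps)"
  by (simp add: edge_action_def nc_subst_identity[OF finite_edges] nc_restrict_id)

lemma edge_action_ideal:
  fixes f :: "(nat set, 'k::field_char_0) ncps"
  assumes \<pi>: "\<pi> permutes {1..n}" and "f \<in> artin_ideal n"
  shows "edge_action n \<pi> f \<in> artin_ideal n"
proof -
  interpret h: filtered_hom nc_filt nc_const nc_filt nc_const
    "edge_action n \<pi> :: (nat set, 'k) ncps \<Rightarrow> _" by (rule edge_action_hom)
  have "artin_ideal n \<subseteq> {f :: (nat set, 'k) ncps. edge_action n \<pi> f \<in> artin_ideal n}"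
  proof (rule artin_ideal_minimal)
    show "artin_rels n \<subseteq> {f :: (nat set, 'k) ncps. edge_action n \<pi> f \<in> artin_ideal n}"
    proof safe
      fix r :: "(nat set, 'k) ncps" assume "r \<in> artin_rels n"
      then have "edge_action n \<pi> r \<in> artin_rels n"
      proof (cases rule: artin_rels_cases)
        case (adjacent i j k)
        have "edge_action n \<pi> r = nc_bracket (gen (\<pi> i) (\<pi> j)) (gen (\<pi> i) (\<pi> k) + gen (\<pi> j) (\<pi> k))"
          using adjacent by (simp add: nc_bracket_def h.hom_diff h.hom_mult h.hom_add edge_action_gen
              del: atLeastAtMost_iff)
        moreover have "{\<pi> i, \<pi> j, \<pi> k} \<subseteq> {1..n}" "distinct [\<pi> i, \<pi> j, \<pi> k]"
          using adjacent permutes_in_image[OF \<pi>] permutes_inj[OF \<pi>] by (auto dest: injD)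
        ultimately show ?thesis unfolding artin_rels_def by blast
      next
        case (disjoint i j k l)
        have "edge_action n \<pi> r = nc_bracket (gen (\<pi> i) (\<pi> j)) (gen (\<pi> k) (\<pi> l))"
          using disjoint by (simp add: nc_bracket_def h.hom_diff h.hom_mult edge_action_gen
              del: atLeastAtMost_iff)
        moreover have "{\<pi> i, \<pi> j, \<pi> k, \<pi> l} \<subseteq> {1..n}" "\<pi> i \<noteq> \<pi> j" "\<pi> k \<noteq> \<pi> l"
          "{\<pi> i, \<pi> j} \<inter> {\<pi> k, \<pi> l} = {}"
          using disjoint permutes_in_image[OF \<pi>] permutes_inj[OF \<pi>] by (auto dest: injD)
        ultimately show ?thesis unfolding artin_rels_def by blast
      qed
      then show "edge_action n \<pi> r \<in> artin_ideal n" using artin_rels_ideal by blast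
    qed
    fix f g :: "(nat set, 'k) ncps"
    assume "f \<in> {f. edge_action n \<pi> f \<in> artin_ideal n}" "g \<in> carrier (nc_ring (edges n))"
    then show "g * f \<in> {f. edge_action n \<pi> f \<in> artin_ideal n}
        \<and> f * g \<in> {f. edge_action n \<pi> f \<in> artin_ideal n}"
      by (simp add: h.hom_mult artin_idealD(4,5) edge_action_closed[OF \<pi>])
  next
    fix f :: "(nat set, 'k) ncps"
    assume approx: "\<And>N. \<exists>g\<in>{f. edge_action n \<pi> f \<in> artin_ideal n}. f - g \<in> nc_filt N"
    have "\<exists>h\<in>artin_ideal n. edge_action n \<pi> f - h \<in> nc_filt N" for N
    proof -
      obtain g where "edge_action n \<pi> g \<in> artin_ideal n" "f - g \<in> nc_filt N" using approx[of N] by blast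
      then show ?thesis using h.hom_F[of "f - g" N] by (auto simp: h.hom_diff)
    qed
    then have "edge_action n \<pi> f \<in> artin_ideal n"
      by (rule artin_ideal_limit[OF edge_action_closed[OF \<pi>]])
    then show "f \<in> {f. edge_action n \<pi> f \<in> artin_ideal n}" by simp
  qed (auto simp: h.hom_diff artin_idealD(2,3))
  then show ?thesis using assms(2) by blast
qed

lemma artin_act_class:
  fixes f :: "(nat set, 'k::field_char_0) ncps"
  assumes \<pi>: "\<pi> permutes {1..n}"
  shows "artin_act n \<pi> (artin_class n f) = artin_class n (edge_action n \<pi> f)"
proof -
  interpret h: filtered_hom nc_filt nc_const nc_filt nc_const
    "edge_action n \<pi> :: (nat set, 'k) ncps \<Rightarrow> _" by (rule edge_action_hom)
  show ?thesis
    unfolding artin_act_def edge_action_def[symmetric]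
    by (rule UN_artin_class) (simp add: artin_class_eq_iff h.hom_diff[symmetric] edge_action_ideal[OF \<pi>])
qed

lemma artin_act_closed:
  fixes a :: "(nat set, 'k::field_char_0) ncps set"
  assumes "\<pi> permutes {1..n}" "a \<in> carrier (artin_alg n)"
  shows "artin_act n \<pi> a \<in> carrier (artin_alg n)"
  using assms(2) by (auto simp: artin_alg_carrier artin_act_class[OF assms(1)] edge_action_closed[OF assms(1)])

lemma artin_act_mult:
  fixes a b :: "(nat set, 'k::field_char_0) ncps set"
  assumes \<pi>: "\<pi> permutes {1..n}" and "a \<in> carrier (artin_alg n)" "b \<in> carrier (artin_alg n)"
  shows "artin_act n \<pi> (a \<otimes>\<^bsub>artin_alg n\<^esub> b) = artin_act n \<pi> a \<otimes>\<^bsub>artin_alg n\<^esub> artin_act n \<pi> b"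
proof -
  interpret h: filtered_hom nc_filt nc_const nc_filt nc_const
    "edge_action n \<pi> :: (nat set, 'k) ncps \<Rightarrow> _" by (rule edge_action_hom)
  show ?thesis
    using assms(2,3) by (auto simp: artin_alg_carrier artin_class_mult artin_act_class[OF \<pi>]
        edge_action_closed[OF \<pi>] h.hom_mult)
qed

lemma artin_act_one:
  assumes "\<pi> permutes {1..n}"
  shows "artin_act n \<pi> \<one>\<^bsub>artin_alg n\<^esub> = (\<one>\<^bsub>artin_alg n\<^esub> :: (nat set, 'k::field_char_0) ncps set)"
  using filtered_hom.hom_one[OF edge_action_hom[of n \<pi>, where ?'k = 'k]]
  by (simp add: artin_class_one artin_act_class[OF assms])

lemma artin_act_zero:
  assumes "\<pi> permutes {1..n}"
  shows "artin_act n \<pi> \<zero>\<^bsub>artin_alg n\<^esub> = (\<zero>\<^bsub>artin_alg n\<^esub> :: (nat set, 'k::field_char_0) ncps set)"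
  using filtered_hom.hom_zero[OF edge_action_hom[of n \<pi>, where ?'k = 'k]]
  by (simp add: artin_class_zero artin_act_class[OF assms])

lemma artin_act_comp:
  fixes a :: "(nat set, 'k::field_char_0) ncps set"
  assumes "\<pi> permutes {1..n}" "\<tau> permutes {1..n}" "a \<in> carrier (artin_alg n)"
  shows "artin_act n \<pi> (artin_act n \<tau> a) = artin_act n (\<pi> \<circ> \<tau>) a"
proof -
  obtain f where "a = artin_class n f" using assms(3) by (auto simp: artin_alg_carrier)
  then show ?thesis
    by (simp only: artin_act_class assms permutes_compose[OF assms(2,1)] edge_action_comp)
qed

lemma artin_act_id:
  fixes a :: "(nat set, 'k::field_char_0) ncps set"
  assumes "a \<in> carrier (artin_alg n)" shows "artin_act n id a = a"
  using assms by (auto simp: artin_alg_carrier artin_act_class permutes_id edge_action_id)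

subsection \<open>The embeddings\<close>

lemma artin_embed_class:
  fixes f :: "(nat set, 'k::field_char_0) ncps"
  shows "artin_embed n (artin_class n f) = artin_class (Suc n) f"
proof -
  have "artin_ideal n \<subseteq> (artin_ideal (Suc n) :: (nat set, 'k) ncps set)"
  proof (rule artin_ideal_minimal)
    show "artin_rels n \<subseteq> (artin_ideal (Suc n) :: (nat set, 'k) ncps set)"
    proof
      fix r :: "(nat set, 'k) ncps" assume "r \<in> artin_rels n"
      then have "r \<in> artin_rels (Suc n)"
      proof (cases rule: artin_rels_cases)
        case (adjacent i j k)
        then have "{i, j, k} \<subseteq> {1..Suc n}" "distinct [i, j, k]" by simp_all
        then show ?thesis unfolding adjacent(7) artin_rels_def by blast
      next
        case (disjoint i j k l)
        then have "{i, j, k, l} \<subseteq> {1..Suc n}" by simp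
        then show ?thesis unfolding disjoint(8) artin_rels_def using disjoint(5-7) by blast
      qed
      then show "r \<in> artin_ideal (Suc n)" using artin_rels_ideal by blast
    qed
  qed (auto intro: artin_idealD artin_ideal_limit nc_ring_mono[OF edges_mono])
  then show ?thesis
    unfolding artin_embed_def using UN_artin_class[where h = "\<lambda>g. g"]
    by (metis artin_class_eq_iff subsetD)
qed

subsection \<open>Exponentials of the Lie algebra\<close>

lemma exp_artin_lie_eq:
  "exp_artin_lie n = (\<lambda>f. artin_class n (nc_exp f)) ` (free_lie (edges n) :: (nat set, 'k::field_char_0) ncps set)"
proof -
  have "artin_exp n (artin_class n f) = artin_class n (nc_exp f)"
    if "f \<in> free_lie (edges n)" for f :: "(nat set, 'k) ncps"
    by (intro artin_exp_class free_lie_closed free_lie_filt) (rule that)+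
  then show ?thesis by (auto simp: exp_artin_lie_def artin_lie_def image_image)
qed

lemma exp_artin_lieI: "f \<in> free_lie (edges n) \<Longrightarrow> artin_class n (nc_exp f) \<in> exp_artin_lie n"
  for f :: "(nat set, 'k::field_char_0) ncps"
  unfolding exp_artin_lie_eq by (rule imageI)

lemma exp_artin_lieE:
  fixes a :: "(nat set, 'k::field_char_0) ncps set"
  assumes "a \<in> exp_artin_lie n"
  obtains f where "f \<in> free_lie (edges n)" "a = artin_class n (nc_exp f)"
  using assms unfolding exp_artin_lie_eq by blast

lemma exp_artin_lie_closed:
  fixes a :: "(nat set, 'k::field_char_0) ncps set"
  assumes "a \<in> exp_artin_lie n" shows "a \<in> carrier (artin_alg n)"
proof -
  obtain f where f: "f \<in> free_lie (edges n)" "a = artin_class n (nc_exp f)"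
    using assms by (rule exp_artin_lieE)
  show ?thesis unfolding f(2) by (intro artin_class_closed free_lie_closed f)
qed

lemma exp_artin_lie_mult:
  fixes a b :: "(nat set, 'k::field_char_0) ncps set"
  assumes "a \<in> exp_artin_lie n" "b \<in> exp_artin_lie n"
  shows "a \<otimes>\<^bsub>artin_alg n\<^esub> b \<in> exp_artin_lie n"
proof -
  obtain f where f: "f \<in> free_lie (edges n)" "a = artin_class n (nc_exp f)"
    using assms(1) by (rule exp_artin_lieE)
  obtain g where g: "g \<in> free_lie (edges n)" "b = artin_class n (nc_exp g)"
    using assms(2) by (rule exp_artin_lieE)
  obtain h where h: "h \<in> free_lie (edges n)" "nc_exp h = nc_exp f * nc_exp g"
    using free_lie_exp_mult[OF f(1) g(1)] .
  show ?thesis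
    using exp_artin_lieI[OF h(1)]
    unfolding f(2) g(2) artin_class_mult[OF free_lie_closed(2)[OF f(1)] free_lie_closed(2)[OF g(1)]] h(2) .
qed

lemma exp_artin_lie_one: "\<one>\<^bsub>artin_alg n\<^esub> \<in> (exp_artin_lie n :: (nat set, 'k::field_char_0) ncps set set)"
  using exp_artin_lieI[OF free_lie_zero, of n] by (simp add: artin_class_one)

lemma exp_artin_lie_inv:
  fixes a :: "(nat set, 'k::field_char_0) ncps set"
  assumes "a \<in> exp_artin_lie n"
  shows "inv\<^bsub>artin_alg n\<^esub> a \<in> exp_artin_lie n"
    and "a \<otimes>\<^bsub>artin_alg n\<^esub> inv\<^bsub>artin_alg n\<^esub> a = \<one>\<^bsub>artin_alg n\<^esub>"
    and "inv\<^bsub>artin_alg n\<^esub> a \<otimes>\<^bsub>artin_alg n\<^esub> a = \<one>\<^bsub>artin_alg n\<^esub>"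
proof -
  obtain f where f: "f \<in> free_lie (edges n)" "a = artin_class n (nc_exp f)"
    using assms by (rule exp_artin_lieE)
  have nf: "- f \<in> free_lie (edges n)" by (rule free_lie_uminus[OF f(1)])
  note C = free_lie_closed(2)[OF f(1)] free_lie_closed(2)[OF nf]
  note inverse = nc_exp_uminus[OF free_lie_filt[OF f(1)]]
  have inv: "inv\<^bsub>artin_alg n\<^esub> a = artin_class n (nc_exp (- f))"
    unfolding f(2) by (rule artin_class_inv[OF C inverse])
  show "inv\<^bsub>artin_alg n\<^esub> a \<in> exp_artin_lie n" 
    unfolding inv by (rule exp_artin_lieI[OF nf])
  show "a \<otimes>\<^bsub>artin_alg n\<^esub> inv\<^bsub>artin_alg n\<^esub> a = \<one>\<^bsub>artin_alg n\<^esub>"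
    "inv\<^bsub>artin_alg n\<^esub> a \<otimes>\<^bsub>artin_alg n\<^esub> a = \<one>\<^bsub>artin_alg n\<^esub>"
    unfolding inv unfolding f(2) by (simp_all only: artin_class_mult C inverse artin_class_one)
qed

lemma free_lie_edge_action:
  fixes f :: "(nat set, 'k::field_char_0) ncps"
  assumes "\<pi> permutes {1..n}" "f \<in> free_lie (edges n)"
  shows "edge_action n \<pi> f \<in> free_lie (edges n)"
  unfolding edge_action_def
  by (rule free_lie_subst[OF finite_edges free_lie_var[OF edge_action_edge[OF assms(1)]] assms(2)])

lemma edge_action_exp:
  "f \<in> nc_filt 1 \<Longrightarrow> edge_action n \<pi> (nc_exp f) = nc_exp (edge_action n \<pi> f)"
  for f :: "(nat set, 'k::field_char_0) ncps"
  unfolding edge_action_def by (rule nc_subst_exp[OF finite_edges]) auto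

lemma exp_artin_lie_act:
  fixes a :: "(nat set, 'k::field_char_0) ncps set"
  assumes "\<pi> permutes {1..n}" "a \<in> exp_artin_lie n"
  shows "artin_act n \<pi> a \<in> exp_artin_lie n"
proof -
  obtain f where f: "f \<in> free_lie (edges n)" "a = artin_class n (nc_exp f)"
    using assms(2) by (rule exp_artin_lieE)
  show ?thesis
    unfolding f(2) artin_act_class[OF assms(1)] edge_action_exp[OF free_lie_filt[OF f(1)]]
    by (rule exp_artin_lieI[OF free_lie_edge_action[OF assms(1) f(1)]])
qed

lemma exp_artin_lie_nonzero:
  fixes a :: "(nat set, 'k::field_char_0) ncps set"
  assumes "a \<in> exp_artin_lie n" shows "a \<noteq> \<zero>\<^bsub>artin_alg n\<^esub>"
proof
  assume 0: "a = \<zero>\<^bsub>artin_alg n\<^esub>"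
  obtain f where f: "f \<in> free_lie (edges n)" "a = artin_class n (nc_exp f)"
    using assms by (rule exp_artin_lieE)
  have "nc_exp f \<in> artin_ideal n"
    using 0 by (simp add: f(2) artin_class_zero artin_class_eq_iff)
  from artin_ideal_filt_1[OF this] show False by (simp add: nc_filt_def coeff_exp_Nil)
qed

lemma artin_embed_exp_lie:
  fixes a :: "(nat set, 'k::field_char_0) ncps set"
  assumes "a \<in> exp_artin_lie n" shows "artin_embed n a \<in> exp_artin_lie (Suc n)"
proof -
  obtain f where f: "f \<in> free_lie (edges n)" "a = artin_class n (nc_exp f)"
    using assms by (rule exp_artin_lieE)
  then have "f \<in> free_lie (edges (Suc n))"
    by (auto simp: free_lie_def intro: nc_ring_mono[OF edges_mono])
  then show ?thesis unfolding f(2) artin_embed_class by (rule exp_artin_lieI)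
qed

lemma artin_embed_mult:
  fixes a b :: "(nat set, 'k::field_char_0) ncps set"
  assumes "a \<in> carrier (artin_alg n)" "b \<in> carrier (artin_alg n)"
  shows "artin_embed n (a \<otimes>\<^bsub>artin_alg n\<^esub> b)
    = artin_embed n a \<otimes>\<^bsub>artin_alg (Suc n)\<^esub> artin_embed n b"
proof -
  obtain f g where "f \<in> carrier (nc_ring (edges n))" "a = artin_class n f"
    "g \<in> carrier (nc_ring (edges n))" "b = artin_class n g"
    using assms unfolding artin_alg_carrier by blast
  then show ?thesis
    by (simp add: artin_class_mult artin_embed_class nc_ring_mono[OF edges_mono])
qed

lemma artin_embed_act:
  fixes a :: "(nat set, 'k::field_char_0) ncps set"
  assumes \<pi>: "\<pi> permutes {1..n}" and "a \<in> carrier (artin_alg n)"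
  shows "artin_embed n (artin_act n \<pi> a) = artin_act (Suc n) \<pi> (artin_embed n a)"
proof -
  obtain f where f: "f \<in> carrier (nc_ring (edges n))" "a = artin_class n f"
    using assms(2) unfolding artin_alg_carrier by blast
  have "\<pi> permutes {1..Suc n}" by (rule permutes_subset[OF \<pi>]) auto
  moreover have "edge_action n \<pi> f = edge_action (Suc n) \<pi> f"
    unfolding edge_action_def
  proof (rule ncps_eqI)
    fix w
    show "coeff (nc_subst (edges n) (\<lambda>e. nc_var (\<pi> ` e)) f) w
        = coeff (nc_subst (edges (Suc n)) (\<lambda>e. nc_var (\<pi> ` e)) f) w"
      unfolding coeff_subst
      by (rule sum.mono_neutral_left)
        (use f(1) edges_mono in \<open>auto simp: nc_ring_carrier intro: finite_lists_length_le finite_edges\<close>)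
  qed
  ultimately show ?thesis
    by (simp add: f(2) artin_act_class[OF \<pi>] artin_act_class artin_embed_class)
qed


section \<open>The braid algebras\<close>

(* The strands are numbered from 1, which is to stay a numeral in statements about permutations. *)
declare One_nat_def [simp del]

lemma sym_group_simps [simp]:
  "p \<in> carrier (sym_group n) \<longleftrightarrow> p permutes {1..n}"
  "x \<otimes>\<^bsub>sym_group n\<^esub> y = x \<circ> y" "\<one>\<^bsub>sym_group n\<^esub> = id"
  by (simp_all add: sym_group_def)

lemma finite_sym_group: "finite {p. p permutes {1..n::nat}}"
  by (rule finite_permutations) simp

lemma smash_apply: "z permutes {1..n} \<Longrightarrow> smash n a x z = (if z = x then a else \<zero>\<^bsub>artin_alg n\<^esub>)"
  by (simp add: smash_def)

lemma smash_closed: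
  fixes a :: "(nat set, 'k::field_char_0) ncps set"
  assumes "a \<in> carrier (artin_alg n)" shows "smash n a x \<in> carrier (braid_alg n)"
  using assms ring.ring_simprules(2)[OF artin_alg_ring]
  by (auto simp: braid_alg_def smash_def)

lemma braid_alg_closed:
  "F \<in> carrier (braid_alg n) \<Longrightarrow> z permutes {1..n} \<Longrightarrow> F z \<in> carrier (artin_alg n)"
  unfolding braid_alg_def by (auto dest: PiE_mem)

text \<open>
  In a product with a right factor supported at one permutation the sum over factorizations
  collapses to one term.  Multiplying a value of a representation by its values at generators
  leads to such products.
\<close>

lemma braid_alg_mult_smash:
  fixes F :: "(nat \<Rightarrow> nat) \<Rightarrow> (nat set, 'k::field_char_0) ncps set"
  assumes F: "F \<in> carrier (braid_alg n)" and b: "b \<in> carrier (artin_alg n)"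
    and y: "y permutes {1..n}" and z: "z permutes {1..n}"
  shows "(F \<otimes>\<^bsub>braid_alg n\<^esub> smash n b y) z
    = F (z \<circ> inv' y) \<otimes>\<^bsub>artin_alg n\<^esub> artin_act n (z \<circ> inv' y) b"
proof -
  interpret ring "artin_alg n :: (nat set, 'k) ncps set ring" by (rule artin_alg_ring)
  let ?x = "z \<circ> inv' y"
  let ?P = "{(x, y'). x permutes {1..n} \<and> y' permutes {1..n} \<and> x \<circ> y' = z}"
  let ?t = "\<lambda>(x, y'). F x \<otimes>\<^bsub>artin_alg n\<^esub> artin_act n x b"
  have x: "?x permutes {1..n}" by (intro permutes_compose permutes_inv y z)
  have fin: "finite ?P"
    by (rule finite_subset[OF _ finite_cartesian_product[OF finite_sym_group finite_sym_group]]) auto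
  have mem: "(?x, y) \<in> ?P"
    using x y permutes_inv_o(2)[OF y] by (simp add: o_assoc[symmetric])
  have t: "?t \<in> ?P \<rightarrow> carrier (artin_alg n)"
    by (auto intro!: m_closed braid_alg_closed[OF F] artin_act_closed b)
  have "(F \<otimes>\<^bsub>braid_alg n\<^esub> smash n b y) z
      = finsum (artin_alg n) (\<lambda>(x, y'). F x \<otimes>\<^bsub>artin_alg n\<^esub> artin_act n x (smash n b y y')) ?P"
    using z by (simp add: braid_alg_def)
  also have "\<dots> = finsum (artin_alg n) (\<lambda>p. if (?x, y) = p then ?t p else \<zero>\<^bsub>artin_alg n\<^esub>) ?P"
  proof (rule finsum_cong'[OF HOL.refl])
    fix p assume "p \<in> ?P"
    then obtain x' y' where p: "p = (x', y')" "x' permutes {1..n}" "y' permutes {1..n}" "x' \<circ> y' = z"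
      by blast
    show "(case p of (x, y') \<Rightarrow> F x \<otimes>\<^bsub>artin_alg n\<^esub> artin_act n x (smash n b y y'))
        = (if (?x, y) = p then ?t p else \<zero>\<^bsub>artin_alg n\<^esub>)"
    proof (cases "y' = y")
      case True
      then have "?x = x'" using p(4) permutes_inv_o(1)[OF y] by (auto simp: o_assoc[symmetric])
      then show ?thesis using True by (simp add: p(1) smash_apply y)
    next
      case False
      then show ?thesis
        using p braid_alg_closed[OF F p(2)] by (simp add: smash_apply artin_act_zero)
    qed
  qed (auto intro!: m_closed braid_alg_closed[OF F] artin_act_closed b)
  also have "\<dots> = ?t (?x, y)"
    by (rule finsum_singleton[OF mem fin t])
  finally show ?thesis by simp
qed

lemma braid_alg_extensional:
  "F \<in> carrier (braid_alg n) \<Longrightarrow> \<not> z permutes {1..n} \<Longrightarrow> F z = undefined"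
  by (auto simp: braid_alg_def dest: PiE_arb)

lemma braid_alg_mult_extensional:
  "\<not> z permutes {1..n} \<Longrightarrow> (F \<otimes>\<^bsub>braid_alg n\<^esub> G) z = undefined"
  by (simp add: braid_alg_def)

lemma smash_mult:
  fixes a b :: "(nat set, 'k::field_char_0) ncps set"
  assumes a: "a \<in> carrier (artin_alg n)" and b: "b \<in> carrier (artin_alg n)"
    and x: "x permutes {1..n}" and y: "y permutes {1..n}"
  shows "smash n a x \<otimes>\<^bsub>braid_alg n\<^esub> smash n b y
    = smash n (a \<otimes>\<^bsub>artin_alg n\<^esub> artin_act n x b) (x \<circ> y)"
proof
  fix z
  interpret ring "artin_alg n :: (nat set, 'k) ncps set ring" by (rule artin_alg_ring)
  show "(smash n a x \<otimes>\<^bsub>braid_alg n\<^esub> smash n b y) z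
      = smash n (a \<otimes>\<^bsub>artin_alg n\<^esub> artin_act n x b) (x \<circ> y) z"
  proof (cases "z permutes {1..n}")
    case True
    have zy: "z \<circ> inv' y permutes {1..n}" by (intro permutes_compose permutes_inv y True)
    have "z \<circ> inv' y = x \<longleftrightarrow> z = x \<circ> y"
      using permutes_inv_o[OF y] by (metis comp_id o_assoc)
    then show ?thesis
      using artin_act_closed[OF zy b] True zy
      by (auto simp: braid_alg_mult_smash[OF smash_closed[OF a] b y] smash_apply)
  next
    case False
    then show ?thesis by (simp add: braid_alg_mult_extensional smash_def)
  qed
qed

lemma braid_alg_mult_smash_assoc:
  fixes F :: "(nat \<Rightarrow> nat) \<Rightarrow> (nat set, 'k::field_char_0) ncps set"
  assumes F: "F \<in> carrier (braid_alg n)" "F \<otimes>\<^bsub>braid_alg n\<^esub> smash n a x \<in> carrier (braid_alg n)"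
    and a: "a \<in> carrier (artin_alg n)" and b: "b \<in> carrier (artin_alg n)"
    and x: "x permutes {1..n}" and y: "y permutes {1..n}"
  shows "F \<otimes>\<^bsub>braid_alg n\<^esub> smash n a x \<otimes>\<^bsub>braid_alg n\<^esub> smash n b y
    = F \<otimes>\<^bsub>braid_alg n\<^esub> (smash n a x \<otimes>\<^bsub>braid_alg n\<^esub> smash n b y)"
proof
  fix z
  interpret ring "artin_alg n :: (nat set, 'k) ncps set ring" by (rule artin_alg_ring)
  show "(F \<otimes>\<^bsub>braid_alg n\<^esub> smash n a x \<otimes>\<^bsub>braid_alg n\<^esub> smash n b y) z
      = (F \<otimes>\<^bsub>braid_alg n\<^esub> (smash n a x \<otimes>\<^bsub>braid_alg n\<^esub> smash n b y)) z"
  proof (cases "z permutes {1..n}")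
    case True
    let ?y = "z \<circ> inv' y" and ?xy = "z \<circ> inv' y \<circ> inv' x"
    have y': "?y permutes {1..n}" and xy': "?xy permutes {1..n}"
      by (intro permutes_compose permutes_inv x y True)+
    have eq: "z \<circ> inv' (x \<circ> y) = ?xy"
      by (simp add: permutes_inv_inv o_inv_distrib[OF permutes_bij[OF x] permutes_bij[OF y]] o_assoc)
    have eq2: "?xy \<circ> x = ?y" using permutes_inv_o(2)[OF x] by (simp add: o_assoc[symmetric])
    have Fxy: "F ?xy \<in> carrier (artin_alg n)" by (rule braid_alg_closed[OF F(1) xy'])
    have "(F \<otimes>\<^bsub>braid_alg n\<^esub> smash n a x \<otimes>\<^bsub>braid_alg n\<^esub> smash n b y) z
        = F ?xy \<otimes>\<^bsub>artin_alg n\<^esub> artin_act n ?xy a \<otimes>\<^bsub>artin_alg n\<^esub> artin_act n ?y b"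
      by (simp add: braid_alg_mult_smash[OF F(2) b y True] braid_alg_mult_smash[OF F(1) a x y'])
    also have "\<dots> = F ?xy \<otimes>\<^bsub>artin_alg n\<^esub> artin_act n ?xy (a \<otimes>\<^bsub>artin_alg n\<^esub> artin_act n x b)"
      using Fxy by (simp add: artin_act_mult[OF xy' a artin_act_closed[OF x b]] artin_act_comp[OF xy' x b]
          eq2 m_assoc artin_act_closed a b xy' y')
    also have "\<dots> = (F \<otimes>\<^bsub>braid_alg n\<^esub> (smash n a x \<otimes>\<^bsub>braid_alg n\<^esub> smash n b y)) z"
      by (simp add: smash_mult[OF a b x y] eq
          braid_alg_mult_smash[OF F(1) m_closed[OF a artin_act_closed[OF x b]] permutes_compose[OF y x] True])
    finally show ?thesis .
  next
    case False
    then show ?thesis by (simp add: braid_alg_mult_extensional)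
  qed
qed

lemma braid_alg_mult_one:
  fixes F :: "(nat \<Rightarrow> nat) \<Rightarrow> (nat set, 'k::field_char_0) ncps set"
  assumes F: "F \<in> carrier (braid_alg n)"
  shows "F \<otimes>\<^bsub>braid_alg n\<^esub> smash n \<one>\<^bsub>artin_alg n\<^esub> id = F"
proof
  fix z
  interpret ring "artin_alg n :: (nat set, 'k) ncps set ring" by (rule artin_alg_ring)
  show "(F \<otimes>\<^bsub>braid_alg n\<^esub> smash n \<one>\<^bsub>artin_alg n\<^esub> id) z = F z"
  proof (cases "z permutes {1..n}")
    case True
    then show ?thesis
      using braid_alg_closed[OF F True]
      by (simp add: braid_alg_mult_smash[OF F one_closed permutes_id True] artin_act_one)
  next
    case False
    then show ?thesis by (simp add: braid_alg_mult_extensional braid_alg_extensional[OF F])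
  qed
qed

definition exp_semidirect :: "nat \<Rightarrow> ((nat \<Rightarrow> nat) \<Rightarrow> (nat set, 'k::field_char_0) ncps set) monoid" where
  "exp_semidirect n =
    \<lparr>carrier = exp_group n, mult = mult (braid_alg n), one = smash n \<one>\<^bsub>artin_alg n\<^esub> id\<rparr>"

lemma exp_semidirect_simps [simp]:
  "carrier (exp_semidirect n) = exp_group n" "mult (exp_semidirect n) = mult (braid_alg n)"
  "one (exp_semidirect n) = smash n \<one>\<^bsub>artin_alg n\<^esub> id"
  by (simp_all add: exp_semidirect_def)

lemma exp_groupI: "a \<in> exp_artin_lie n \<Longrightarrow> x permutes {1..n} \<Longrightarrow> smash n a x \<in> exp_group n"
  by (auto simp: exp_group_def)

lemma exp_groupE:
  assumes "F \<in> exp_group n"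
  obtains a x where "a \<in> exp_artin_lie n" "x permutes {1..n}" "F = smash n a x"
  using assms by (auto simp: exp_group_def)

lemma exp_group_mult:
  fixes a b :: "(nat set, 'k::field_char_0) ncps set"
  assumes "a \<in> exp_artin_lie n" "b \<in> exp_artin_lie n" "x permutes {1..n}" "y permutes {1..n}"
  shows "smash n a x \<otimes>\<^bsub>braid_alg n\<^esub> smash n b y
    = smash n (a \<otimes>\<^bsub>artin_alg n\<^esub> artin_act n x b) (x \<circ> y)"
  by (rule smash_mult[OF exp_artin_lie_closed exp_artin_lie_closed]) (fact assms)+

lemma exp_group_subset: "F \<in> exp_group n \<Longrightarrow> F \<in> carrier (braid_alg n)"
  for F :: "(nat \<Rightarrow> nat) \<Rightarrow> (nat set, 'k::field_char_0) ncps set"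
  by (auto elim!: exp_groupE intro: smash_closed exp_artin_lie_closed)

lemma exp_semidirect_group:
  "group (exp_semidirect n :: ((nat \<Rightarrow> nat) \<Rightarrow> (nat set, 'k::field_char_0) ncps set) monoid)"
proof (rule groupI)
  let ?G = "exp_semidirect n :: ((nat \<Rightarrow> nat) \<Rightarrow> (nat set, 'k) ncps set) monoid"
  interpret ring "artin_alg n :: (nat set, 'k) ncps set ring" by (rule artin_alg_ring)
  show closed: "F \<otimes>\<^bsub>?G\<^esub> G \<in> carrier ?G" if "F \<in> carrier ?G" "G \<in> carrier ?G" for F G
    using that by (auto elim!: exp_groupE simp: exp_group_mult
        intro!: exp_groupI exp_artin_lie_mult exp_artin_lie_act permutes_compose)
  show "\<one>\<^bsub>?G\<^esub> \<in> carrier ?G"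
    by (simp add: exp_groupI exp_artin_lie_one permutes_id)
  show "F \<otimes>\<^bsub>?G\<^esub> G \<otimes>\<^bsub>?G\<^esub> H = F \<otimes>\<^bsub>?G\<^esub> (G \<otimes>\<^bsub>?G\<^esub> H)"
    if F: "F \<in> carrier ?G" and G: "G \<in> carrier ?G" and H: "H \<in> carrier ?G" for F G H
  proof -
    obtain a x where a: "a \<in> exp_artin_lie n" "x permutes {1..n}" "G = smash n a x"
      using G by (auto elim!: exp_groupE)
    obtain b y where b: "b \<in> exp_artin_lie n" "y permutes {1..n}" "H = smash n b y"
      using H by (auto elim!: exp_groupE)
    have "F \<in> carrier (braid_alg n)" "F \<otimes>\<^bsub>braid_alg n\<^esub> G \<in> carrier (braid_alg n)"
      using closed[OF F G] F exp_group_subset by auto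
    then show ?thesis
      using braid_alg_mult_smash_assoc[of F n a x b y] a b exp_artin_lie_closed by auto
  qed
  show "\<one>\<^bsub>?G\<^esub> \<otimes>\<^bsub>?G\<^esub> F = F" if "F \<in> carrier ?G" for F
  proof -
    obtain a x where a: "a \<in> exp_artin_lie n" "x permutes {1..n}" "F = smash n a x"
      using \<open>F \<in> carrier ?G\<close> by (auto elim!: exp_groupE)
    then show ?thesis
      by (simp add: exp_group_mult exp_artin_lie_one permutes_id artin_act_id exp_artin_lie_closed)
  qed
  show "\<exists>G\<in>carrier ?G. G \<otimes>\<^bsub>?G\<^esub> F = \<one>\<^bsub>?G\<^esub>" if "F \<in> carrier ?G" for F
  proof -
    obtain a x where a: "a \<in> exp_artin_lie n" "x permutes {1..n}" "F = smash n a x"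
      using \<open>F \<in> carrier ?G\<close> by (auto elim!: exp_groupE)
    note x' = permutes_inv[OF a(2)]
    let ?b = "artin_act n (inv' x) (inv\<^bsub>artin_alg n\<^esub> a)"
    have b: "?b \<in> exp_artin_lie n" by (intro exp_artin_lie_act exp_artin_lie_inv x' a)
    have "smash n ?b (inv' x) \<otimes>\<^bsub>?G\<^esub> F
        = smash n (artin_act n (inv' x) (inv\<^bsub>artin_alg n\<^esub> a \<otimes>\<^bsub>artin_alg n\<^esub> a)) id"
      using exp_artin_lie_closed[OF exp_artin_lie_inv(1)[OF a(1)]] exp_artin_lie_closed[OF a(1)]
      by (simp add: a(3) exp_group_mult[OF b a(1) x' a(2)] artin_act_mult[OF x'] permutes_inv_o(2)[OF a(2)])
    then show ?thesis
      using exp_groupI[OF b x'] by (auto simp: exp_artin_lie_inv(3)[OF a(1)] artin_act_one[OF x'])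
  qed
qed

lemma exp_group_perm_smash:
  fixes a :: "(nat set, 'k::field_char_0) ncps set"
  assumes "a \<in> exp_artin_lie n" "x permutes {1..n}"
  shows "exp_group_perm n (smash n a x) = x"
  unfolding exp_group_perm_def
proof (rule the_equality)
  fix y assume "y \<in> carrier (sym_group n) \<and> (\<exists>b\<in>exp_artin_lie n. smash n a x = smash n b y)"
  then obtain b where "y permutes {1..n}" "smash n a x = smash n b y" by auto
  then have "smash n a x x = smash n b y x" by simp
  then show "y = x"
    using assms exp_artin_lie_nonzero[OF assms(1)] by (auto simp: smash_apply split: if_splits)
qed (use assms in auto)

lemma exp_group_perm_hom: "exp_group_perm n \<in> hom (exp_semidirect n) (sym_group n)"
  by (auto simp: hom_def exp_group_perm_smash exp_group_mult exp_artin_lie_mult exp_artin_lie_act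
      permutes_compose elim!: exp_groupE)

lemma braid_alg_embed_smash:
  fixes a :: "(nat set, 'k::field_char_0) ncps set"
  assumes "x permutes {1..n}"
  shows "braid_alg_embed n (smash n a x) = smash (Suc n) (artin_embed n a) x"
proof
  fix z
  have "artin_embed n \<zero>\<^bsub>artin_alg n\<^esub> = (\<zero>\<^bsub>artin_alg (Suc n)\<^esub> :: (nat set, 'k) ncps set)"
    by (simp only: artin_class_zero artin_embed_class)
  then show "braid_alg_embed n (smash n a x) z = smash (Suc n) (artin_embed n a) x z"
    using assms by (simp add: braid_alg_embed_def smash_def)
qed

lemma braid_alg_embed_hom:
  "(braid_alg_embed n :: ((nat \<Rightarrow> nat) \<Rightarrow> (nat set, 'k::field_char_0) ncps set) \<Rightarrow> _)
    \<in> hom (exp_semidirect n) (exp_semidirect (Suc n))"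
proof (rule homI)
  have permutes_Suc: "x permutes {1..Suc n}" if "x permutes {1..n}" for x :: "nat \<Rightarrow> nat"
    by (rule permutes_subset[OF that]) auto
  fix F :: "(nat \<Rightarrow> nat) \<Rightarrow> (nat set, 'k) ncps set"
  assume "F \<in> carrier (exp_semidirect n)"
  then obtain a x where a: "a \<in> exp_artin_lie n" "x permutes {1..n}" "F = smash n a x"
    by (auto elim!: exp_groupE)
  then show "braid_alg_embed n F \<in> carrier (exp_semidirect (Suc n))"
    by (simp add: braid_alg_embed_smash exp_groupI artin_embed_exp_lie permutes_Suc)
  fix G :: "(nat \<Rightarrow> nat) \<Rightarrow> (nat set, 'k) ncps set"
  assume "G \<in> carrier (exp_semidirect n)"
  then obtain b y where b: "b \<in> exp_artin_lie n" "y permutes {1..n}" "G = smash n b y"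
    by (auto elim!: exp_groupE)
  show "braid_alg_embed n (F \<otimes>\<^bsub>exp_semidirect n\<^esub> G)
      = braid_alg_embed n F \<otimes>\<^bsub>exp_semidirect (Suc n)\<^esub> braid_alg_embed n G"
    using a b exp_artin_lie_closed[OF a(1)] exp_artin_lie_closed[OF b(1)]
    by (simp add: exp_group_mult braid_alg_embed_smash permutes_compose permutes_Suc artin_embed_exp_lie
        artin_embed_mult artin_act_closed artin_embed_act)
qed

section \<open>Representations of braid groups\<close>

lemma braid_words_append [simp]: "u @ v \<in> braid_words n \<longleftrightarrow> u \<in> braid_words n \<and> v \<in> braid_words n"
  by (simp add: braid_words_def)

lemma braid_words_Nil [simp]: "[] \<in> braid_words n"
  by (simp add: braid_words_def)

lemma braid_words_Cons [simp]: "(i, b) # u \<in> braid_words n \<longleftrightarrow> i \<in> {1..<n} \<and> u \<in> braid_words n"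
  by (auto simp: braid_words_def)

lemma braid_eq_words: "braid_eq n u v \<Longrightarrow> u \<in> braid_words n \<and> v \<in> braid_words n"
  by (induction rule: braid_eq.induct) auto

lemma braid_eq_append:
  assumes "braid_eq n u u'" "braid_eq n v v'" shows "braid_eq n (u @ v) (u' @ v')"
proof -
  have "braid_eq n ([] @ u @ v) ([] @ u' @ v)"
    by (rule braid_eq.cong) (use assms braid_eq_words in auto)
  moreover have "braid_eq n (u' @ v @ []) (u' @ v' @ [])"
    by (rule braid_eq.cong) (use assms braid_eq_words in auto)
  ultimately show ?thesis using braid_eq.trans by auto
qed

lemma braid_class_eq_iff:
  assumes "u \<in> braid_words n" shows "braid_class n u = braid_class n v \<longleftrightarrow> braid_eq n u v"
  using braid_eq.refl[OF assms] unfolding braid_class_def set_eq_iff mem_Collect_eq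
  by (meson braid_eq.sym braid_eq.trans)

lemma braid_group_carrier: "carrier (braid_group n) = braid_class n ` braid_words n"
  by (simp add: braid_group_def)

lemma braid_group_one: "\<one>\<^bsub>braid_group n\<^esub> = braid_class n []"
  by (simp add: braid_group_def)

lemma UN_braid_class:
  assumes "u \<in> braid_words n" "\<And>v. braid_eq n u v \<Longrightarrow> f v = f u"
  shows "(\<Union>v\<in>braid_class n u. f v) = f u"
  using assms braid_eq.refl[OF assms(1)] unfolding braid_class_def by blast

lemma braid_class_mult:
  assumes "u \<in> braid_words n" "v \<in> braid_words n"
  shows "braid_class n u \<otimes>\<^bsub>braid_group n\<^esub> braid_class n v = braid_class n (u @ v)"
proof -
  have eq: "braid_class n (u' @ v') = braid_class n (u'' @ v'')"
    if "braid_eq n u'' u'" "braid_eq n v'' v'" for u' v' u'' v''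
    using braid_eq_append[OF that] braid_eq_words[OF braid_eq_append[OF that]]
    by (metis braid_class_eq_iff)
  have "(\<Union>v'\<in>braid_class n v. braid_class n (u' @ v')) = braid_class n (u' @ v)"
    if "braid_eq n u u'" for u'
    by (rule UN_braid_class[OF assms(2)])
      (rule eq, rule braid_eq.refl, use braid_eq_words[OF that] in auto)
  then have "(\<Union>u'\<in>braid_class n u. \<Union>v'\<in>braid_class n v. braid_class n (u' @ v'))
      = (\<Union>u'\<in>braid_class n u. braid_class n (u' @ v))"
    unfolding braid_class_def[of n u] by simp
  also have "\<dots> = braid_class n (u @ v)"
    by (rule UN_braid_class[OF assms(1)]) (rule eq, assumption, rule braid_eq.refl[OF assms(2)])
  finally show ?thesis by (simp add: braid_group_def)
qed

lemma braid_class_closed: "u \<in> braid_words n \<Longrightarrow> braid_class n u \<in> carrier (braid_group n)"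
  by (simp add: braid_group_carrier)

lemma braid_class_cancel:
  assumes "i \<in> {1..<n}"
  shows "braid_class n [(i, b)] \<otimes>\<^bsub>braid_group n\<^esub> braid_class n [(i, \<not> b)] = \<one>\<^bsub>braid_group n\<^esub>"
  using assms braid_eq.cancel[OF assms, of b]
  by (simp add: braid_class_mult braid_group_one braid_class_eq_iff)

lemma braid_group_group: "group (braid_group n)"
proof (rule groupI)
  fix \<alpha> \<beta> \<gamma>
  assume "\<alpha> \<in> carrier (braid_group n)"
  then obtain u where u: "u \<in> braid_words n" "\<alpha> = braid_class n u" by (auto simp: braid_group_carrier)
  show "\<one>\<^bsub>braid_group n\<^esub> \<otimes>\<^bsub>braid_group n\<^esub> \<alpha> = \<alpha>"
    using u by (simp add: braid_group_one braid_class_mult)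
  have "\<exists>v\<in>braid_words n. braid_eq n (v @ u) []"
    using u(1)
  proof (induction u)
    case (Cons l u)
    obtain i b where l: "l = (i, b)" by (cases l)
    then obtain v where v: "v \<in> braid_words n" "braid_eq n (v @ u) []" and i: "i \<in> {1..<n}"
      using Cons by auto
    have "braid_eq n (v @ [(i, \<not> b), (i, \<not> \<not> b)] @ u) (v @ [] @ u)"
      by (rule braid_eq.cong[OF braid_eq.cancel[OF i]]) (use v Cons.prems l in auto)
    then have "braid_eq n ((v @ [(i, \<not> b)]) @ l # u) []"
      using braid_eq.trans[OF _ v(2)] by (simp add: l)
    then show ?case using v(1) i by (intro bexI[of _ "v @ [(i, \<not> b)]"]) auto
  next
    case Nil
    then show ?case using braid_eq.refl[OF braid_words_Nil, of n] braid_words_Nil[of n] by fastforce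
  qed
  then obtain v where v: "v \<in> braid_words n" "braid_eq n (v @ u) []" by blast
  show "\<exists>\<beta>\<in>carrier (braid_group n). \<beta> \<otimes>\<^bsub>braid_group n\<^esub> \<alpha> = \<one>\<^bsub>braid_group n\<^esub>"
  proof
    show "braid_class n v \<otimes>\<^bsub>braid_group n\<^esub> \<alpha> = \<one>\<^bsub>braid_group n\<^esub>"
      using u v by (simp add: braid_class_mult braid_group_one braid_class_eq_iff)
  qed (rule braid_class_closed[OF v(1)])
  assume "\<beta> \<in> carrier (braid_group n)"
  then obtain v where v: "v \<in> braid_words n" "\<beta> = braid_class n v" by (auto simp: braid_group_carrier)
  show "\<alpha> \<otimes>\<^bsub>braid_group n\<^esub> \<beta> \<in> carrier (braid_group n)"
    using u v by (simp add: braid_class_mult braid_class_closed)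
  assume "\<gamma> \<in> carrier (braid_group n)"
  then obtain w where w: "w \<in> braid_words n" "\<gamma> = braid_class n w" by (auto simp: braid_group_carrier)
  show "\<alpha> \<otimes>\<^bsub>braid_group n\<^esub> \<beta> \<otimes>\<^bsub>braid_group n\<^esub> \<gamma> = \<alpha> \<otimes>\<^bsub>braid_group n\<^esub> (\<beta> \<otimes>\<^bsub>braid_group n\<^esub> \<gamma>)"
    using u v w by (simp add: braid_class_mult)
qed (simp add: braid_group_one braid_class_closed)

lemma sigma_closed: "i \<in> {1..<n} \<Longrightarrow> sigma n i \<in> carrier (braid_group n)"
  unfolding sigma_def by (rule braid_class_closed) simp

lemma sigma_inv: "i \<in> {1..<n} \<Longrightarrow> inv\<^bsub>braid_group n\<^esub> (sigma n i) = braid_class n [(i, False)]"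
  by (rule group.inv_equality[OF braid_group_group])
    (use braid_class_cancel[of i n False] in \<open>simp_all add: sigma_def braid_class_closed\<close>)

text \<open>
  Elements of a group that satisfy the braid relations are the values at the generators of a
  homomorphism, which evaluates words.
\<close>

locale braid_relations = group G for G (structure) +
  fixes n :: nat and g :: "nat \<Rightarrow> 'a"
  assumes g_closed: "i \<in> {1..<n} \<Longrightarrow> g i \<in> carrier G"
    and far_rel: "i \<in> {1..<n} \<Longrightarrow> j \<in> {1..<n} \<Longrightarrow> i + 2 \<le> j \<Longrightarrow> g i \<otimes> g j = g j \<otimes> g i"
    and braid_rel: "i \<in> {1..<n} \<Longrightarrow> Suc i \<in> {1..<n} \<Longrightarrow>
      g (Suc i) \<otimes> g i \<otimes> g (Suc i) = g i \<otimes> g (Suc i) \<otimes> g i"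
begin

fun braid_eval :: "(nat \<times> bool) list \<Rightarrow> 'a" where
  "braid_eval [] = \<one>"
| "braid_eval ((i, b) # w) = (if b then g i else inv (g i)) \<otimes> braid_eval w"

lemma braid_eval_closed: "w \<in> braid_words n \<Longrightarrow> braid_eval w \<in> carrier G"
  by (induction w rule: braid_eval.induct) (auto simp: g_closed)

lemma braid_eval_append:
  "u \<in> braid_words n \<Longrightarrow> v \<in> braid_words n \<Longrightarrow> braid_eval (u @ v) = braid_eval u \<otimes> braid_eval v"
  by (induction u rule: braid_eval.induct) (auto simp: g_closed braid_eval_closed m_assoc)

lemma braid_eval_cong: "braid_eq n u v \<Longrightarrow> braid_eval u = braid_eval v"
proof (induction rule: braid_eq.induct)
  case (cong u v x y)
  then show ?case using braid_eq_words by (simp add: braid_eval_append)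
next
  case (cancel i b)
  then show ?case using g_closed by (cases b) auto
next
  case (far i j)
  then show ?case using far_rel g_closed by simp
next
  case (braid i)
  then show ?case using braid_rel[OF braid] g_closed by (simp add: m_assoc)
qed auto

lemma the_elem_braid_eval:
  assumes "u \<in> braid_words n" shows "the_elem (braid_eval ` braid_class n u) = braid_eval u"
proof -
  have "braid_eval v = braid_eval u" if "v \<in> braid_class n u" for v
    using braid_eval_cong[of u v] that by (simp add: braid_class_def)
  moreover have "u \<in> braid_class n u"
    using braid_eq.refl[OF assms] by (simp add: braid_class_def)
  ultimately have "braid_eval ` braid_class n u = {braid_eval u}" by blast
  then show ?thesis by simp
qed

lemma braid_eval_hom: "(\<lambda>\<beta>. the_elem (braid_eval ` \<beta>)) \<in> hom (braid_group n) G"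
  by (rule homI)
    (auto simp: braid_group_carrier the_elem_braid_eval braid_eval_closed braid_eval_append braid_class_mult)

lemma braid_eval_sigma: "i \<in> {1..<n} \<Longrightarrow> the_elem (braid_eval ` sigma n i) = g i"
  using the_elem_braid_eval[of "[(i, True)]"] g_closed by (simp add: sigma_def)

end

lemma braid_hom_unique:
  assumes "group G" "\<rho> \<in> hom (braid_group n) G" "\<rho>' \<in> hom (braid_group n) G"
    and "\<And>i. i \<in> {1..<n} \<Longrightarrow> \<rho> (sigma n i) = \<rho>' (sigma n i)" and \<beta>: "\<beta> \<in> carrier (braid_group n)"
  shows "\<rho> \<beta> = \<rho>' \<beta>"
proof -
  interpret r: group_hom "braid_group n" G \<rho>
    using assms braid_group_group by (simp add: group_hom_def group_hom_axioms_def)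
  interpret r': group_hom "braid_group n" G \<rho>'
    using assms braid_group_group by (simp add: group_hom_def group_hom_axioms_def)
  have letter: "\<rho> (braid_class n [(i, b)]) = \<rho>' (braid_class n [(i, b)])" if i: "i \<in> {1..<n}" for i b
  proof (cases b)
    case True
    then show ?thesis using assms(4)[OF i] by (simp add: sigma_def)
  next
    case False
    then show ?thesis
      using assms(4)[OF i] r.hom_inv[OF sigma_closed[OF i]] r'.hom_inv[OF sigma_closed[OF i]]
      unfolding sigma_inv[OF i] by simp
  qed
  have "\<rho> (braid_class n u) = \<rho>' (braid_class n u)" if "u \<in> braid_words n" for u
    using that
  proof (induction u)
    case Nil
    then show ?case by (simp add: braid_group_one[symmetric] del: r.hom_one r'.hom_one)
        (simp add: r.hom_one r'.hom_one)
  next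
    case (Cons l u)
    obtain i b where l: "l = (i, b)" by (cases l)
    have i: "i \<in> {1..<n}" and u: "u \<in> braid_words n" using Cons.prems l by auto
    have "braid_class n (l # u) = braid_class n [(i, b)] \<otimes>\<^bsub>braid_group n\<^esub> braid_class n u"
      using i u by (simp add: braid_class_mult l)
    then show ?case
      using letter[OF i, of b] Cons.IH[OF u] braid_class_closed[of "[(i, b)]" n] i braid_class_closed[OF u]
      by (simp add: r.hom_mult r'.hom_mult)
  qed
  then show ?thesis using \<beta> by (auto simp: braid_group_carrier)
qed

lemma adj_transp_permutes: "i \<in> {1..<n} \<Longrightarrow> adj_transp i permutes {1..n}"
  unfolding adj_transp_def by (rule permutes_swap_id) auto

lemma braid_relations_sym: "braid_relations (sym_group n) n adj_transp"
  by (intro braid_relations.intro[OF sym_group_is_group] braid_relations_axioms.intro)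
    (simp_all only: sym_group_simps adj_transp_permutes,
      auto simp: adj_transp_def transpose_def fun_eq_iff)

lemma braid_perm_hom: "braid_perm \<in> hom (braid_group n) (sym_group n)"
  and braid_perm_sigma: "i \<in> {1..<n} \<Longrightarrow> braid_perm (sigma n i) = adj_transp i"
proof -
  interpret braid_relations "sym_group n" n adj_transp by (rule braid_relations_sym)
  have "inv\<^bsub>sym_group n\<^esub> (adj_transp i) = adj_transp i" if "i \<in> {1..<n}" for i
    using adj_transp_permutes[OF that] by (simp add: adj_transp_def)
  then have "foldr (\<lambda>(i, b) p. adj_transp i \<circ> p) w id = braid_eval w" if "w \<in> braid_words n" for w
    using that by (induction w rule: braid_eval.induct) auto
  then have "braid_perm \<beta> = the_elem (braid_eval ` \<beta>)" if "\<beta> \<in> carrier (braid_group n)" for \<beta>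
  proof -
    have "w \<in> braid_words n" if "w \<in> \<beta>" for w
      using \<open>\<beta> \<in> carrier (braid_group n)\<close> that braid_eq_words
      by (auto simp: braid_group_carrier braid_class_def)
    then show ?thesis
      unfolding braid_perm_def
      using \<open>\<And>w. w \<in> braid_words n \<Longrightarrow> _\<close> by (intro arg_cong[where f = the_elem] image_cong) auto
  qed
  then show "braid_perm \<in> hom (braid_group n) (sym_group n)"
    and "i \<in> {1..<n} \<Longrightarrow> braid_perm (sigma n i) = adj_transp i"
    using braid_eval_hom group.is_monoid[OF braid_group_group] braid_eval_sigma sigma_closed
    by (auto simp: hom_def Pi_def monoid.m_closed)
qed

lemma braid_embed_class:
  assumes "u \<in> braid_words n" shows "braid_embed n (braid_class n u) = braid_class (Suc n) u"
proof -
  have words: "u \<in> braid_words (Suc n)" if "u \<in> braid_words n" for u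
    using that by (induction u) (auto simp: braid_words_def)
  have "braid_eq (Suc n) u v" if "braid_eq n u v" for u v
    using that by (induction rule: braid_eq.induct) (auto intro: braid_eq.intros words)
  then show ?thesis
    unfolding braid_embed_def
    by (intro UN_braid_class[OF assms]) (metis braid_class_eq_iff words assms)
qed

lemma braid_embed_hom: "braid_embed n \<in> hom (braid_group n) (braid_group (Suc n))"
  and braid_embed_sigma: "i \<in> {1..<n} \<Longrightarrow> braid_embed n (sigma n i) = sigma (Suc n) i"
proof -
  have words: "u \<in> braid_words (Suc n)" if "u \<in> braid_words n" for u
    using that by (induction u) (auto simp: braid_words_def)
  show "braid_embed n \<in> hom (braid_group n) (braid_group (Suc n))"
    by (rule homI) (auto simp: braid_group_carrier braid_embed_class words braid_class_mult)
  show "i \<in> {1..<n} \<Longrightarrow> braid_embed n (sigma n i) = sigma (Suc n) i"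
    by (simp add: sigma_def braid_embed_class)
qed

lemma normalized_repI:
  fixes \<rho> :: "(nat \<times> bool) list set \<Rightarrow> (nat \<Rightarrow> nat) \<Rightarrow> (nat set, 'k::field_char_0) ncps set"
  assumes \<rho>: "\<rho> \<in> hom (braid_group n) (exp_semidirect n)"
    and sigma: "\<And>i. i \<in> {1..<n} \<Longrightarrow> \<exists>u\<in>exp_artin_lie n. \<rho> (sigma n i) = smash n u (adj_transp i) \<and>
        equiv2 u (artin_class n (1 + nc_scale (1/2) (gen i (Suc i))))"
  shows "normalized_rep n \<rho>"
  unfolding normalized_rep_def
proof (intro conjI ballI)
  fix \<beta> assume \<beta>: "\<beta> \<in> carrier (braid_group n)"
  show "\<rho> \<beta> \<in> exp_group n" using \<rho> \<beta> by (auto simp: hom_def)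
  have "(exp_group_perm n \<circ> \<rho>) \<beta> = braid_perm \<beta>"
  proof (rule braid_hom_unique[OF sym_group_is_group _ braid_perm_hom _ \<beta>])
    show "exp_group_perm n \<circ> \<rho> \<in> hom (braid_group n) (sym_group n)"
      by (rule hom_compose[OF \<rho> exp_group_perm_hom])
    show "(exp_group_perm n \<circ> \<rho>) (sigma n i) = braid_perm (sigma n i)" if "i \<in> {1..<n}" for i
      using sigma[OF that] by (auto simp: braid_perm_sigma[OF that] exp_group_perm_smash adj_transp_permutes[OF that])
  qed
  then show "exp_group_perm n (\<rho> \<beta>) = braid_perm \<beta>" by simp
qed (rule sigma)

lemma Delta_closed: "Delta \<in> carrier (braid_group 3)"
proof -
  interpret group "braid_group 3" by (rule braid_group_group)
  show ?thesis unfolding Delta_def by (intro m_closed sigma_closed) auto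
qed

lemma sigma_2_eq:
  "sigma 3 2 = inv\<^bsub>braid_group 3\<^esub> (sigma 3 1) \<otimes>\<^bsub>braid_group 3\<^esub> Delta
    \<otimes>\<^bsub>braid_group 3\<^esub> inv\<^bsub>braid_group 3\<^esub> (sigma 3 1)"
proof -
  interpret group "braid_group 3" by (rule braid_group_group)
  have s: "sigma 3 1 \<in> carrier (braid_group 3)" "sigma 3 2 \<in> carrier (braid_group 3)"
    by (auto intro: sigma_closed)
  then show ?thesis
    unfolding Delta_def by (simp add: m_assoc r_inv) (simp add: m_assoc[symmetric])
qed

text \<open>
  A multiplicative map need not preserve the unit, but it does as soon as one value is invertible.
  Invertibility propagates from \<open>\<sigma>\<^sub>1\<close> and \<open>\<Delta>\<close> to all braids, because they generate \<open>B\<^sub>3\<close>.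
\<close>

lemma braid_rep_exp_hom:
  fixes \<rho> :: "(nat \<times> bool) list set \<Rightarrow> (nat \<Rightarrow> nat) \<Rightarrow> (nat set, 'k::field_char_0) ncps set"
  assumes \<rho>: "\<rho> \<in> hom (braid_group 3) (braid_alg 3)"
    and s1: "\<rho> (sigma 3 1) \<in> exp_group 3" and D: "\<rho> Delta \<in> exp_group 3"
  shows "\<rho> \<in> hom (braid_group 3) (exp_semidirect 3)"
proof -
  let ?E = "exp_semidirect 3 :: ((nat \<Rightarrow> nat) \<Rightarrow> (nat set, 'k) ncps set) monoid"
  let ?B = "braid_group 3"
  interpret E: group ?E by (rule exp_semidirect_group)
  interpret B: group ?B by (rule braid_group_group)
  have mult: "\<rho> (\<alpha> \<otimes>\<^bsub>?B\<^esub> \<beta>) = \<rho> \<alpha> \<otimes>\<^bsub>?E\<^esub> \<rho> \<beta>"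
    if "\<alpha> \<in> carrier ?B" "\<beta> \<in> carrier ?B" for \<alpha> \<beta>
    using hom_mult[OF \<rho> that] by simp
  have closed: "\<rho> \<beta> \<in> carrier (braid_alg 3)" if "\<beta> \<in> carrier ?B" for \<beta>
    using hom_in_carrier[OF \<rho> that] .
  have assoc: "F \<otimes>\<^bsub>?E\<^esub> u \<otimes>\<^bsub>?E\<^esub> v = F \<otimes>\<^bsub>?E\<^esub> (u \<otimes>\<^bsub>?E\<^esub> v)"
    if "F \<in> carrier (braid_alg 3)" "F \<otimes>\<^bsub>?E\<^esub> u \<in> carrier (braid_alg 3)" "u \<in> carrier ?E" "v \<in> carrier ?E"
    for F u v
  proof -
    obtain a x where a: "a \<in> exp_artin_lie 3" "x permutes {1..3}" "u = smash 3 a x"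
      using \<open>u \<in> carrier ?E\<close> by (auto elim!: exp_groupE)
    obtain b y where b: "b \<in> exp_artin_lie 3" "y permutes {1..3}" "v = smash 3 b y"
      using \<open>v \<in> carrier ?E\<close> by (auto elim!: exp_groupE)
    show ?thesis
      using braid_alg_mult_smash_assoc[OF that(1) _ exp_artin_lie_closed[OF a(1)]
          exp_artin_lie_closed[OF b(1)] a(2) b(2)] that(2) by (simp add: a(3) b(3))
  qed
  have right_one: "F \<otimes>\<^bsub>?E\<^esub> \<one>\<^bsub>?E\<^esub> = F" if "F \<in> carrier (braid_alg 3)" for F
    using braid_alg_mult_one[OF that] by simp
  have cancel: "F = v \<otimes>\<^bsub>?E\<^esub> inv\<^bsub>?E\<^esub> u"
    if F: "F \<in> carrier (braid_alg 3)" and u: "u \<in> carrier ?E" and v: "F \<otimes>\<^bsub>?E\<^esub> u = v" "v \<in> carrier ?E" for F u v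
  proof -
    have "F = F \<otimes>\<^bsub>?E\<^esub> (u \<otimes>\<^bsub>?E\<^esub> inv\<^bsub>?E\<^esub> u)" using right_one[OF F] E.r_inv[OF u] by simp
    also have "\<dots> = F \<otimes>\<^bsub>?E\<^esub> u \<otimes>\<^bsub>?E\<^esub> inv\<^bsub>?E\<^esub> u"
      using exp_group_subset v u E.inv_closed[OF u] by (intro assoc[symmetric] F) auto
    finally show ?thesis by (simp only: v(1))
  qed
  have sC: "sigma 3 1 \<in> carrier ?B" by (rule sigma_closed) simp
  have s1': "\<rho> (sigma 3 1) \<in> carrier ?E" using s1 by simp
  have one: "\<rho> \<one>\<^bsub>?B\<^esub> = \<one>\<^bsub>?E\<^esub>"
    using cancel[OF closed[OF B.one_closed] s1' _ s1'] mult[OF B.one_closed sC] E.r_inv[OF s1'] sC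
    by (simp only: B.l_one)
  have inv: "\<rho> (inv\<^bsub>?B\<^esub> \<beta>) = inv\<^bsub>?E\<^esub> (\<rho> \<beta>)" if "\<beta> \<in> carrier ?B" "\<rho> \<beta> \<in> carrier ?E" for \<beta>
  proof -
    have "\<rho> (inv\<^bsub>?B\<^esub> \<beta>) \<otimes>\<^bsub>?E\<^esub> \<rho> \<beta> = \<one>\<^bsub>?E\<^esub>"
      using mult[of "inv\<^bsub>?B\<^esub> \<beta>" \<beta>] that one by (simp only: B.inv_closed B.l_inv)
    from cancel[OF closed[OF B.inv_closed[OF that(1)]] that(2) this E.one_closed]
    show ?thesis using E.l_one[OF E.inv_closed[OF that(2)]] by (simp only:)
  qed
  have inv_mem: "\<rho> (inv\<^bsub>?B\<^esub> \<beta>) \<in> carrier ?E" if "\<beta> \<in> carrier ?B" "\<rho> \<beta> \<in> carrier ?E" for \<beta>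
    using inv[OF that] E.inv_closed[OF that(2)] by (simp only:)
  have mult_mem: "\<rho> (\<alpha> \<otimes>\<^bsub>?B\<^esub> \<beta>) \<in> carrier ?E"
    if "\<alpha> \<in> carrier ?B" "\<beta> \<in> carrier ?B" "\<rho> \<alpha> \<in> carrier ?E" "\<rho> \<beta> \<in> carrier ?E" for \<alpha> \<beta>
    unfolding mult[OF that(1,2)] by (rule E.m_closed[OF that(3,4)])
  have s2': "\<rho> (sigma 3 2) \<in> carrier ?E"
    unfolding sigma_2_eq
    using D s1' sC Delta_closed inv_mem[OF sC s1'] by (intro mult_mem B.m_closed B.inv_closed) auto
  have letter: "\<rho> (braid_class 3 [(i, b)]) \<in> carrier ?E" if i: "i \<in> {1..<3}" for i b
  proof -
    have "i = 1 \<or> i = 2" using i by auto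
    then have "\<rho> (sigma 3 i) \<in> carrier ?E" using s1' s2' by blast
    then show ?thesis
      using inv_mem[OF sigma_closed[OF i]] unfolding sigma_inv[OF i] by (cases b) (auto simp: sigma_def)
  qed
  have "\<rho> (braid_class 3 u) \<in> carrier ?E" if "u \<in> braid_words 3" for u
    using that
  proof (induction u)
    case Nil
    then show ?case using one E.one_closed by (simp only: braid_group_one)
  next
    case (Cons l u)
    obtain i b where l: "l = (i, b)" by (cases l)
    have i: "i \<in> {1..<3}" and u: "u \<in> braid_words 3" using Cons.prems l by auto
    have ib: "[(i, b)] \<in> braid_words 3" using i by simp
    have "braid_class 3 (l # u) = braid_class 3 [(i, b)] \<otimes>\<^bsub>?B\<^esub> braid_class 3 u"
      using braid_class_mult[OF ib u] by (simp add: l)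
    then show ?case
      using mult_mem[OF braid_class_closed[OF ib] braid_class_closed[OF u] letter[OF i] Cons.IH[OF u]]
      by (simp only:)
  qed
  then show ?thesis using mult by (auto simp: hom_def braid_group_carrier)
qed


section \<open>The algebra on three strands as a ring\<close>

text \<open>
  Making the algebra on three strands a type turns computations with classes into equational
  reasoning in a ring, and makes the results on filtered algebras available for it.
\<close>

typedef (overloaded) 'k art3 = "carrier (artin_alg 3 :: (nat set, 'k::field_char_0) ncps set ring)"
  by (rule exI, rule ring.ring_simprules(2)[OF artin_alg_ring])

setup_lifting type_definition_art3

instantiation art3 :: (field_char_0) ring_1
begin

lift_definition zero_art3 :: "'a art3" is "\<zero>\<^bsub>artin_alg 3\<^esub>"
  by (rule ring.ring_simprules(2)[OF artin_alg_ring])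
lift_definition one_art3 :: "'a art3" is "\<one>\<^bsub>artin_alg 3\<^esub>"
  by (rule ring.ring_simprules(6)[OF artin_alg_ring])
lift_definition plus_art3 :: "'a art3 \<Rightarrow> 'a art3 \<Rightarrow> 'a art3" is "add (artin_alg 3)"
  by (rule ring.ring_simprules(1)[OF artin_alg_ring])
lift_definition times_art3 :: "'a art3 \<Rightarrow> 'a art3 \<Rightarrow> 'a art3" is "mult (artin_alg 3)"
  by (rule ring.ring_simprules(5)[OF artin_alg_ring])
lift_definition uminus_art3 :: "'a art3 \<Rightarrow> 'a art3" is "a_inv (artin_alg 3)"
  by (rule ring.ring_simprules(3)[OF artin_alg_ring])
definition minus_art3 :: "'a art3 \<Rightarrow> 'a art3 \<Rightarrow> 'a art3" where "minus_art3 x y = x + - y"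

instance
proof
  interpret ring "artin_alg 3 :: (nat set, 'a) ncps set ring" by (rule artin_alg_ring)
  fix x y z :: "'a art3"
  show "x + y + z = x + (y + z)" by transfer (rule a_assoc)
  show "x + y = y + x" by transfer (rule a_comm)
  show "0 + x = x" by transfer (rule l_zero)
  show "- x + x = 0" by transfer (rule l_neg)
  show "x - y = x + - y" by (rule minus_art3_def)
  show "x * y * z = x * (y * z)" by transfer (rule m_assoc)
  show "1 * x = x" by transfer (rule l_one)
  show "x * 1 = x" by transfer (rule r_one)
  show "(x + y) * z = x * z + y * z" by transfer (rule l_distr)
  show "x * (y + z) = x * y + x * z" by transfer (rule r_distr)
  show "(0 :: 'a art3) \<noteq> 1" by transfer (metis exp_artin_lie_nonzero exp_artin_lie_one)
qed

end

abbreviation series3 :: "(nat set, 'k::ring_1) ncps set" where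
  "series3 \<equiv> carrier (nc_ring (edges 3))"

definition art_of :: "(nat set, 'k::field_char_0) ncps \<Rightarrow> 'k art3" where
  "art_of f = Abs_art3 (artin_class 3 (nc_restrict (edges 3) f))"

lemma Rep_art_of_restrict: "Rep_art3 (art_of f) = artin_class 3 (nc_restrict (edges 3) f)"
  unfolding art_of_def by (rule Abs_art3_inverse) (rule artin_class_closed[OF nc_restrict_closed])

lemma Rep_art_of: "f \<in> series3 \<Longrightarrow> Rep_art3 (art_of f) = artin_class 3 f"
  by (simp add: Rep_art_of_restrict nc_restrict_id)

lemma art_of_eq_iff: "art_of f = art_of g \<longleftrightarrow> nc_restrict (edges 3) f - nc_restrict (edges 3) g \<in> artin_ideal 3"
  by (simp add: Rep_art3_inject[symmetric] Rep_art_of_restrict artin_class_eq_iff)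

lemma art_of_surj: obtains f where "f \<in> series3" "x = art_of f"
proof -
  have "Rep_art3 x \<in> carrier (artin_alg 3)" by (rule Rep_art3)
  then obtain f where "f \<in> series3" "Rep_art3 x = artin_class 3 f"
    unfolding artin_alg_carrier by blast
  then show ?thesis
    using that by (metis Rep_art3_inject Rep_art_of)
qed

lemma art_of_add: "art_of (f + g) = art_of f + art_of g"
  unfolding Rep_art3_inject[symmetric] plus_art3.rep_eq Rep_art_of_restrict
  by (subst artin_class_add) (auto simp: nc_restrict_closed intro!: arg_cong[where f = "artin_class 3"] ncps_eqI)

lemma art_of_mult: "art_of (f * g) = art_of f * art_of g"
  unfolding Rep_art3_inject[symmetric] times_art3.rep_eq Rep_art_of_restrict nc_restrict_mult
  by (rule artin_class_mult[OF nc_restrict_closed nc_restrict_closed, symmetric])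

lemma art_of_one: "art_of 1 = 1"
  unfolding Rep_art3_inject[symmetric] one_art3.rep_eq artin_class_one
  by (simp add: Rep_art_of nc_ring_closed)

definition art_filt :: "nat \<Rightarrow> 'k::field_char_0 art3 set" where
  "art_filt n = art_of ` nc_filt n"

lemma art_filtI: "f \<in> nc_filt n \<Longrightarrow> art_of f \<in> art_filt n"
  by (simp add: art_filt_def)

lemma art_of_diff: "art_of (f - g) = art_of f - art_of g"
  using art_of_add[of "f - g" g] by simp

lemma art_of_zero: "art_of 0 = 0"
  using art_of_diff[of 0 0] by simp

interpretation art: filtered_algebra art_filt "\<lambda>c::'k::field_char_0. art_of (nc_const c)"
proof
  fix x y :: "'k art3" and m n :: nat and c d :: 'k
  have "x \<in> art_filt 0" for x :: "'k art3"
    by (rule art_of_surj[of x]) (auto intro!: art_filtI)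
  then show "art_filt 0 = (UNIV :: 'k art3 set)" by blast
  show "0 \<in> (art_filt n :: 'k art3 set)"
    unfolding art_of_zero[symmetric] by (rule art_filtI) simp
  show "x - y \<in> art_filt n" if "x \<in> art_filt n" "y \<in> art_filt n"
    using that unfolding art_filt_def by (auto simp: art_of_diff[symmetric] intro!: nc.F_diff)
  show "x * y \<in> art_filt (m + n)" if "x \<in> art_filt m" "y \<in> art_filt n"
    using that unfolding art_filt_def by (auto simp: art_of_mult[symmetric] intro!: nc.F_mult)
  show "x \<in> art_filt m" if "m \<le> n" "x \<in> art_filt n"
    using that nc.F_mono unfolding art_filt_def by blast
  show "art_of (nc_const 1) = (1 :: 'k art3)" by (simp add: art_of_one)
  show "art_of (nc_const (c + d)) = art_of (nc_const c) + art_of (nc_const d)"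
    by (simp add: nc.sc_add art_of_add)
  show "art_of (nc_const (c * d)) = art_of (nc_const c) * art_of (nc_const d)"
    by (simp add: nc.sc_mult art_of_mult)
  obtain f where x: "x = art_of f" by (rule art_of_surj)
  show "art_of (nc_const c) * x = x * art_of (nc_const c)"
    by (simp add: x art_of_mult[symmetric] nc.sc_commute)
next
  fix x :: "'k art3" assume all: "\<And>n. x \<in> art_filt n"
  obtain f where f: "f \<in> series3" "x = art_of f" by (rule art_of_surj)
  have "f \<in> artin_ideal 3"
  proof (rule artin_ideal_limit[OF f(1)])
    fix N
    obtain g where g: "g \<in> nc_filt N" "x = art_of g" using all[of N] unfolding art_filt_def by blast
    have "f - nc_restrict (edges 3) g \<in> artin_ideal 3"
      using g(2) f by (simp add: art_of_eq_iff nc_restrict_id)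
    moreover have "f - (f - nc_restrict (edges 3) g) \<in> nc_filt N"
      using g(1) by (simp add: nc_filt_def)
    ultimately show "\<exists>h\<in>artin_ideal 3. f - h \<in> nc_filt N" by blast
  qed
  then have "art_of f = art_of 0"
    using f(1) by (simp add: art_of_eq_iff nc_restrict_id nc_ring_closed)
  then show "x = 0" using f(2) art_of_zero by simp
qed

interpretation art_of: filtered_hom nc_filt nc_const art_filt "\<lambda>c::'k::field_char_0. art_of (nc_const c)" art_of
  by unfold_locales (auto simp: art_of_add art_of_mult art_of_one art_filtI)

lemma art_of_ideal: "f \<in> artin_ideal 3 \<Longrightarrow> art_of f = 0"
  using art_of_eq_iff[of f 0] artin_idealD(1)[of 3]
  by (auto simp: nc_restrict_id nc_ring_closed subset_iff)

lemma art_of_exp: "f \<in> nc_filt 1 \<Longrightarrow> art.is_exp (art_of f) (art_of (nc_exp f))"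
  by (rule art_of.hom_is_exp[OF nc_exp_is_exp])

lemma gen_filt [simp]: "gen i j \<in> nc_filt 1"
  unfolding gen_def using nc_var_filt by (simp add: One_nat_def)

lemma gen_commute: "gen i j = gen j i"
  by (simp add: gen_def insert_commute)

lemma gen_closed3:
  "gen 1 2 \<in> series3" "gen 1 3 \<in> series3" "gen 2 3 \<in> series3"
  by (auto intro!: gen_closed)

lemma edges_3: "edges 3 = {{1, 2}, {1, 3}, {2, 3}}"
proof
  show "edges 3 \<subseteq> {{1, 2}, {1, 3}, {2, 3}}"
  proof
    fix e assume "e \<in> edges 3"
    then obtain i j :: nat where e: "e = {i, j}" "i \<in> {1..3}" "j \<in> {1..3}" "i \<noteq> j"
      unfolding edges_def by blast
    then have "i \<in> {1, 2, 3}" "j \<in> {1, 2, 3}" by auto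
    then show "e \<in> {{1, 2}, {1, 3}, {2, 3}}" using e(1,4) by auto
  qed
qed (auto intro!: edgesI)

text \<open>
  This sum is central: the defining relation says that \<open>t\<^sub>i\<^sub>j\<close> commutes with the sum of the other two
  generators.
\<close>

definition gen_sum :: "(nat set, 'k::ring_1) ncps" where
  "gen_sum = gen 1 2 + gen 1 3 + gen 2 3"

lemma gen_sum_closed: "gen_sum \<in> series3"
  unfolding gen_sum_def by (intro nc_ring_add_closed gen_closed3)

lemma gen_sum_filt [simp]: "gen_sum \<in> nc_filt 1"
  unfolding nc_filt_1 gen_sum_def gen_def by (simp add: coeff_var)

lemma art_relation:
  assumes "{i, j, k} \<subseteq> {1..3}" "distinct [i, j, k]"
  shows "art_of (gen i j) * (art_of (gen i k) + art_of (gen j k))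
    = (art_of (gen i k) + art_of (gen j k)) * art_of (gen i j)"
proof -
  have "nc_bracket (gen i j) (gen i k + gen j k) \<in> artin_rels 3"
    unfolding artin_rels_def using assms by blast
  then have "art_of (nc_bracket (gen i j) (gen i k + gen j k)) = 0"
    using artin_rels_ideal by (intro art_of_ideal) blast
  then show ?thesis
    by (simp add: nc_bracket_def art_of.hom_diff art_of_mult art_of_add)
qed

lemma art_gen_sum_central:
  assumes "{i, j} \<in> edges 3"
  shows "art_of (gen i j) * art_of gen_sum = (art_of gen_sum * art_of (gen i j) :: 'k::field_char_0 art3)"
proof -
  have "art_of (gen 1 2) * art_of gen_sum = art_of gen_sum * art_of (gen 1 2)"
    "art_of (gen 1 3) * art_of gen_sum = art_of gen_sum * art_of (gen 1 3)"
    "art_of (gen 2 3) * art_of gen_sum = art_of gen_sum * art_of (gen 2 3)"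
    using art_relation[of 1 2 3] art_relation[of 1 3 2] art_relation[of 2 3 1]
    by (simp_all add: gen_sum_def art_of_add distrib_left distrib_right gen_commute[of 2 1]
        gen_commute[of 3 1] gen_commute[of 3 2] add.commute add.left_commute)
  then show ?thesis
    using assms unfolding gen_def edges_3 by auto
qed

subsection \<open>The free subalgebra\<close>

definition letter_gen :: "letter \<Rightarrow> (nat set, 'k::ring_1) ncps" where
  "letter_gen a = (case a of LA \<Rightarrow> gen 1 2 | LB \<Rightarrow> gen 2 3)"

definition letter_emb :: "(letter, 'k::ring_1) ncps \<Rightarrow> (nat set, 'k) ncps" where
  "letter_emb = nc_subst UNIV letter_gen"

text \<open>
  The retraction of \<open>artin_alg 3\<close> onto the free algebra generated by \<open>t\<^sub>1\<^sub>2\<close> and \<open>t\<^sub>2\<^sub>3\<close>, on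
  representatives: it sends the central sum of the generators to \<open>0\<close>.
\<close>

definition edge_letter :: "nat set \<Rightarrow> (letter, 'k::ring_1) ncps" where
  "edge_letter e =
    (if e = {1, 2} then nc_var LA else if e = {2, 3} then nc_var LB else - nc_var LA - nc_var LB)"

definition letter_retract :: "(nat set, 'k::ring_1) ncps \<Rightarrow> (letter, 'k) ncps" where
  "letter_retract = nc_subst (edges 3) edge_letter"

instance letter :: finite
proof
  have "(UNIV :: letter set) \<subseteq> {LA, LB}" using letter.exhaust by auto
  then show "finite (UNIV :: letter set)" by (rule finite_subset) simp
qed

lemma letter_gen_filt: "letter_gen a \<in> nc_filt 1" for a
  by (cases a) (simp_all add: letter_gen_def)

lemma letter_gen_lie: "(letter_gen a :: (nat set, 'k::field_char_0) ncps) \<in> free_lie (edges 3)"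
  unfolding letter_gen_def gen_def by (cases a) (auto intro!: free_lie_var simp: edges_3)

lemma edge_letter_lie: "(edge_letter e :: (letter, 'k::field_char_0) ncps) \<in> free_lie UNIV"
proof -
  have v: "(nc_var a :: (letter, 'k) ncps) \<in> free_lie UNIV" for a by (rule free_lie_var) simp
  have "- nc_var LA + - nc_var LB \<in> (free_lie UNIV :: (letter, 'k) ncps set)"
    by (intro free_lie_add free_lie_uminus v)
  then show ?thesis unfolding edge_letter_def using v by simp
qed

lemma edge_letter_filt: "(edge_letter e :: (letter, 'k::field_char_0) ncps) \<in> nc_filt 1"
  by (rule free_lie_filt[OF edge_letter_lie])

interpretation letter_emb: filtered_hom nc_filt nc_const nc_filt
  "nc_const :: 'k::field_char_0 \<Rightarrow> (nat set, 'k) ncps" letter_emb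
  unfolding letter_emb_def by (rule nc_subst_hom) (auto intro: letter_gen_filt)

interpretation letter_retract: filtered_hom nc_filt nc_const nc_filt
  "nc_const :: 'k::field_char_0 \<Rightarrow> (letter, 'k) ncps" letter_retract
  unfolding letter_retract_def by (rule nc_subst_hom[OF finite_edges]) (rule edge_letter_filt)

lemma letter_emb_closed: "letter_emb \<psi> \<in> series3" for \<psi> :: "(letter, 'k::field_char_0) ncps"
  unfolding letter_emb_def by (rule nc_subst_closed) (rule free_lie_closed(1)[OF letter_gen_lie])

lemma letter_emb_lie: "\<psi> \<in> free_lie UNIV \<Longrightarrow> letter_emb \<psi> \<in> free_lie (edges 3)"
  for \<psi> :: "(letter, 'k::field_char_0) ncps"
  unfolding letter_emb_def by (rule free_lie_subst[OF finite_UNIV letter_gen_lie])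

lemma letter_emb_var: "letter_emb (nc_var a) = (letter_gen a :: (nat set, 'k::field_char_0) ncps)"
  unfolding letter_emb_def by (rule nc_subst_var) (auto intro: letter_gen_filt)

lemma letter_emb_exp: "\<psi> \<in> nc_filt 1 \<Longrightarrow> letter_emb (nc_exp \<psi>) = nc_exp (letter_emb \<psi>)"
  for \<psi> :: "(letter, 'k::field_char_0) ncps"
  unfolding letter_emb_def by (rule nc_subst_exp) (auto intro: letter_gen_filt)

lemma letter_emb_is_subst: "nc.is_subst UNIV letter_gen \<psi> (letter_emb \<psi>)"
  for \<psi> :: "(letter, 'k::field_char_0) ncps"
  unfolding letter_emb_def by (rule nc_subst_is_subst) (auto intro: letter_gen_filt)

lemma letter_retract_gen:
  "letter_retract (gen 1 2) = (nc_var LA :: (letter, 'k::field_char_0) ncps)"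
  "letter_retract (gen 2 3) = (nc_var LB :: (letter, 'k) ncps)"
  "letter_retract (gen 1 3) = (- nc_var LA - nc_var LB :: (letter, 'k) ncps)"
proof -
  have "letter_retract (nc_var e) = (edge_letter e :: (letter, 'k) ncps)" if "e \<in> edges 3" for e
    unfolding letter_retract_def by (rule nc_subst_var[OF finite_edges edge_letter_filt that])
  then show "letter_retract (gen 1 2) = (nc_var LA :: (letter, 'k) ncps)"
    "letter_retract (gen 2 3) = (nc_var LB :: (letter, 'k) ncps)"
    "letter_retract (gen 1 3) = (- nc_var LA - nc_var LB :: (letter, 'k) ncps)"
    by (simp_all add: gen_def edges_3 edge_letter_def doubleton_eq_iff)
qed

lemma letter_retract_emb: "letter_retract (letter_emb \<psi>) = \<psi>" for \<psi> :: "(letter, 'k::field_char_0) ncps"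
proof -
  have "nc.is_subst UNIV (\<lambda>a. letter_retract (letter_gen a)) \<psi> (letter_retract (letter_emb \<psi>))"
    by (rule letter_retract.hom_is_subst[OF letter_emb_is_subst])
  moreover have "letter_retract (letter_gen a) = (nc_var a :: (letter, 'k) ncps)" for a
    by (cases a) (simp_all add: letter_gen_def letter_retract_gen)
  ultimately have "nc.is_subst UNIV nc_var \<psi> (letter_retract (letter_emb \<psi>))" by simp
  moreover have "nc.is_subst UNIV nc_var \<psi> (nc_subst UNIV nc_var \<psi>)"
    by (rule nc_subst_is_subst) (simp_all add: One_nat_def)
  ultimately show ?thesis
    by (metis nc.is_subst_unique nc_subst_identity finite_UNIV nc_restrict_id nc_ring_UNIV)
qed

lemma letter_retract_ideal: "f \<in> artin_ideal 3 \<Longrightarrow> letter_retract f = 0"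
  for f :: "(nat set, 'k::field_char_0) ncps"
proof (rule artin_ideal_kernel[OF letter_retract.filtered_hom_axioms])
  fix r :: "(nat set, 'k) ncps" assume "r \<in> artin_rels 3"
  then show "letter_retract r = 0"
  proof (cases rule: artin_rels_cases)
    case (adjacent i j k)
    let ?h = "letter_retract :: (nat set, 'k) ncps \<Rightarrow> _"
    have "i \<in> {1, 2, 3}" "j \<in> {1, 2, 3}" "k \<in> {1, 2, 3}" using adjacent(1-3) by auto
    then have "?h (gen i k) + ?h (gen j k) = - ?h (gen i j)"
      using adjacent(4-6) by (auto simp: letter_retract_gen gen_commute[of 2 1]
          gen_commute[of 3 1] gen_commute[of 3 2])
    then show ?thesis
      by (simp add: adjacent(7) nc_bracket_def letter_retract.hom_diff letter_retract.hom_mult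
          letter_retract.hom_add)
  next
    case (disjoint i j k l)
    then have "i \<in> {1, 2, 3}" "j \<in> {1, 2, 3}" "k \<in> {1, 2, 3}" "l \<in> {1, 2, 3}" by auto
    then show ?thesis using disjoint(5-7) by auto
  qed
qed

definition art_letter :: "(letter, 'k::field_char_0) ncps \<Rightarrow> 'k art3" where
  "art_letter \<psi> = art_of (letter_emb \<psi>)"

interpretation art_letter: filtered_hom nc_filt nc_const art_filt
  "\<lambda>c::'k::field_char_0. art_of (nc_const c)" art_letter
  unfolding art_letter_def
  by unfold_locales (simp_all add: letter_emb.hom_add letter_emb.hom_mult letter_emb.hom_sc
      letter_emb.hom_F art_of_add art_of_mult art_of_one art_filtI)

lemma art_letter_inject: "art_letter \<psi> = art_letter \<psi>' \<longleftrightarrow> \<psi> = \<psi>'"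
proof
  assume "art_letter \<psi> = art_letter \<psi>'"
  then have "letter_emb \<psi> - letter_emb \<psi>' \<in> artin_ideal 3"
    by (simp add: art_letter_def art_of_eq_iff nc_restrict_id letter_emb_closed)
  from letter_retract_ideal[OF this] show "\<psi> = \<psi>'"
    by (simp add: letter_retract.hom_diff letter_retract_emb)
qed simp

lemma Psi_t_eq: "Psi_t \<Psi> = Rep_art3 (art_letter \<Psi>)"
  by (simp add: Psi_t_def art_letter_def Rep_art_of letter_emb_closed)
    (simp add: letter_emb_def letter_gen_def[abs_def])

text \<open>
  As Lie algebras, \<open>P\<^sub>3\<close> is the direct product of its centre and the free Lie algebra on \<open>t\<^sub>1\<^sub>2\<close> and
  \<open>t\<^sub>2\<^sub>3\<close>.  To decompose a primitive series, write \<open>t\<^sub>1\<^sub>3\<close> as the central sum minus \<open>t\<^sub>1\<^sub>2 + t\<^sub>2\<^sub>3\<close> and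
  substitute by \<open>is_subst_primitive_add\<close>.
\<close>

lemma art_of_lie:
  fixes f :: "(nat set, 'k::field_char_0) ncps"
  assumes f: "f \<in> free_lie (edges 3)"
  shows "art_of f = art_letter (letter_retract f) + art_of (nc_scale (coeff f [{1, 3}]) gen_sum)"
proof -
  let ?a = "\<lambda>e. art_letter (edge_letter e :: (letter, 'k) ncps)"
  let ?b = "\<lambda>e. if e = {1, 3} then art_of gen_sum else (0 :: 'k art3)"
  have letters: "art_letter (nc_var LA) = (art_of (gen 1 2) :: 'k art3)"
    "art_letter (nc_var LB) = (art_of (gen 2 3) :: 'k art3)"
    by (simp_all add: art_letter_def letter_emb_var letter_gen_def)
  have comm: "?a e * ?b e' = ?b e' * ?a e" for e e'
  proof -
    have "?a e * art_of gen_sum = art_of gen_sum * ?a e"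
      using art_gen_sum_central[of 1 2, where ?'k = 'k] art_gen_sum_central[of 2 3, where ?'k = 'k]
      by (simp add: edge_letter_def art_letter.hom_diff art_letter.hom_uminus letters
          edges_3 left_diff_distrib right_diff_distrib)
    then show ?thesis by simp
  qed
  have sum: "?a e + ?b e = art_of (nc_var e)" if "e \<in> edges 3" for e
    using that by (auto simp: edges_3 edge_letter_def letters art_letter.hom_diff art_letter.hom_uminus
        gen_sum_def art_of_add gen_def doubleton_eq_iff)
  have "art.is_subst (edges 3) (\<lambda>e. art_of (nc_var e)) f (art_of f)"
    by (rule art_of.hom_is_subst[OF nc_is_subst_self[OF finite_edges free_lie_closed(1)[OF f]]])
  then have subst_f: "art.is_subst (edges 3) (\<lambda>e. ?a e + ?b e) f (art_of f)"
    by (subst art.is_subst_cong[OF sum])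
  have subst_a: "art.is_subst (edges 3) ?a f (art_letter (letter_retract f))"
    unfolding letter_retract_def
    by (rule art_letter.hom_is_subst[OF nc_subst_is_subst[OF finite_edges edge_letter_filt]])
  have subst_b: "art.is_subst (edges 3) ?b f (art_of (nc_const (coeff f [{1, 3}])) * art_of gen_sum)"
    unfolding art.is_subst_def art.approx_def
  proof
    fix N
    let ?W = "{w. set w \<subseteq> edges 3 \<and> length w \<le> N}"
    have zero: "art_of (nc_const (coeff f w)) * art.monomial ?b w = 0" if "w \<noteq> [{1, 3}]" for w
    proof (cases "set w \<subseteq> {{1, 3}}")
      case True
      then have "w = replicate (length w) {1, 3}" by (intro replicate_eqI) auto
      moreover from this that have "length w \<noteq> 1" by (auto simp: One_nat_def)
      ultimately have "coeff f w = 0"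
        using nc_primitive_replicate[of f "length w" "{1, 3}"] f by (simp add: free_lie_def)
      then show ?thesis by (simp only: art.sc_0) simp
    next
      case False
      then obtain e where "e \<in> set w" "e \<noteq> {1, 3}" by blast
      then have "art.monomial ?b w = 0" by (induction w) auto
      then show ?thesis by simp
    qed
    show "art_of (nc_const (coeff f [{1, 3}])) * art_of gen_sum - art.subst_partial (edges 3) ?b f N
        \<in> art_filt (Suc N)"
    proof (cases N)
      case 0
      have "art.subst_partial (edges 3) ?b f N = 0"
        unfolding art.subst_partial_def by (intro sum.neutral ballI zero) (auto simp: 0)
      then show ?thesis
        using art.F_mult_left[OF art_filtI[OF gen_sum_filt]] by (simp add: 0 One_nat_def)
    next
      case (Suc M)
      have "art.subst_partial (edges 3) ?b f N
          = (\<Sum>w\<in>{[{1, 3}]}. art_of (nc_const (coeff f w)) * art.monomial ?b w)"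
        unfolding art.subst_partial_def
        by (rule sum.mono_neutral_right[OF art.finite_words[OF finite_edges]])
          (use zero Suc in \<open>auto simp: edges_3\<close>)
      then show ?thesis by simp
    qed
  qed
  have "art.is_subst (edges 3) (\<lambda>e. ?a e + ?b e) f
      (art_letter (letter_retract f) + art_of (nc_const (coeff f [{1, 3}])) * art_of gen_sum)"
    using f by (intro art.is_subst_primitive_add finite_edges comm subst_a subst_b)
      (simp add: free_lie_def)
  from art.is_subst_unique[OF subst_f this] show ?thesis
    by (simp add: art_of_mult[symmetric] const_mult)
qed


section \<open>The braid relation and the hexagon\<close>

lemma perm3_apply [simp]: "perm3 i j k 1 = i" "perm3 i j k 2 = j" "perm3 i j k 3 = k"
  by (simp_all add: perm3_def)

lemma perm3_comp [simp]:
  "perm3 i j k \<circ> perm3 a b c = perm3 (perm3 i j k a) (perm3 i j k b) (perm3 i j k c)"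
  by (rule ext) (simp add: perm3_def)

lemma perm3_id: "perm3 1 2 3 = id"
  by (rule ext) (simp add: perm3_def)

lemma adj_transp_perm3: "adj_transp 1 = perm3 2 1 3" "adj_transp 2 = perm3 1 3 2"
  by (auto simp: adj_transp_def transpose_def perm3_def fun_eq_iff numeral_eq_Suc One_nat_def)

lemma perm3_permutes [simp]:
  "perm3 2 1 3 permutes {1..3}" "perm3 1 3 2 permutes {1..3}" "perm3 2 3 1 permutes {1..3}"
  "perm3 3 1 2 permutes {1..3}" "perm3 3 2 1 permutes {1..3}"
proof -
  show s: "perm3 2 1 3 permutes {1..3}" "perm3 1 3 2 permutes {1..3}"
    using adj_transp_permutes[of 1 3] adj_transp_permutes[of 2 3] by (auto simp: adj_transp_perm3)
  show "perm3 2 3 1 permutes {1..3}" "perm3 3 1 2 permutes {1..3}"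
    using permutes_compose[OF s(2,1)] permutes_compose[OF s(1,2)] by simp_all
  then show "perm3 3 2 1 permutes {1..3}" using permutes_compose[OF s(1)] by fastforce
qed

abbreviation group_series :: "(nat set, 'k::field_char_0) ncps set" where
  "group_series \<equiv> nc_exp ` free_lie (edges 3)"

abbreviation gen_exp :: "'k::field_char_0 \<Rightarrow> nat \<Rightarrow> nat \<Rightarrow> (nat set, 'k) ncps" where
  "gen_exp c i j \<equiv> nc_exp (nc_scale c (gen i j))"

abbreviation gen_sum_exp :: "'k::field_char_0 \<Rightarrow> (nat set, 'k) ncps" where
  "gen_sum_exp c \<equiv> nc_exp (nc_scale c gen_sum)"

lemma nc_scale_filt [simp]: "f \<in> nc_filt n \<Longrightarrow> nc_scale c f \<in> nc_filt n"
  by (simp add: nc_filt_def)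

lemma group_series_closed: "f \<in> group_series \<Longrightarrow> f \<in> series3"
  by (auto intro: free_lie_closed)

lemma group_series_mult:
  fixes f g :: "(nat set, 'k::field_char_0) ncps"
  assumes "f \<in> group_series" "g \<in> group_series" shows "f * g \<in> group_series"
proof -
  obtain a b where a: "a \<in> free_lie (edges 3)" "f = nc_exp a" and b: "b \<in> free_lie (edges 3)" "g = nc_exp b"
    using assms by blast
  obtain c where "c \<in> free_lie (edges 3)" "nc_exp c = nc_exp a * nc_exp b"
    using free_lie_exp_mult[OF a(1) b(1)] .
  then show ?thesis unfolding a(2) b(2) by (metis imageI)
qed

lemma gen_lie3:
  "gen 1 2 \<in> (free_lie (edges 3) :: (nat set, 'k::field_char_0) ncps set)"
  "gen 1 3 \<in> (free_lie (edges 3) :: (nat set, 'k) ncps set)"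
  "gen 2 3 \<in> (free_lie (edges 3) :: (nat set, 'k) ncps set)"
  unfolding gen_def by (rule free_lie_var, simp add: edges_3)+

lemma gen_sum_lie: "gen_sum \<in> (free_lie (edges 3) :: (nat set, 'k::field_char_0) ncps set)"
  unfolding gen_sum_def by (intro free_lie_add gen_lie3)

lemma group_series_gen:
  "gen_exp c 1 2 \<in> group_series" "gen_exp c 1 3 \<in> group_series" "gen_exp c 2 3 \<in> group_series"
  "gen_sum_exp c \<in> group_series"
  by (intro imageI free_lie_scale gen_lie3 gen_sum_lie)+

lemma group_series_act: "f \<in> group_series \<Longrightarrow> \<pi> permutes {1..3} \<Longrightarrow> edge_action 3 \<pi> f \<in> group_series"
  for f :: "(nat set, 'k::field_char_0) ncps"
  by (auto simp: edge_action_exp free_lie_filt intro: imageI free_lie_edge_action)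

lemma group_series_letter: "\<psi> \<in> free_lie UNIV \<Longrightarrow> letter_emb (nc_exp \<psi>) \<in> group_series"
  for \<psi> :: "(letter, 'k::field_char_0) ncps"
  by (simp add: letter_emb_exp free_lie_filt letter_emb_lie)

lemma exp_scale_inverse:
  fixes f :: "('x, 'k::field_char_0) ncps"
  assumes "f \<in> nc_filt 1"
  shows "nc_exp (nc_scale c f) * nc_exp (nc_scale (- c) f) = 1"
    "nc_exp (nc_scale (- c) f) * nc_exp (nc_scale c f) = 1"
proof -
  have "nc_scale (- c) f = - nc_scale c f" by (rule ncps_eqI) simp
  then show "nc_exp (nc_scale c f) * nc_exp (nc_scale (- c) f) = 1"
    "nc_exp (nc_scale (- c) f) * nc_exp (nc_scale c f) = 1"
    using nc_exp_uminus[OF nc_scale_filt[OF assms]] by simp_all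
qed

lemma edge_action_scale: "edge_action n \<pi> (nc_scale c f) = nc_scale c (edge_action n \<pi> f)"
  for f :: "(nat set, 'k::field_char_0) ncps"
  using filtered_hom.hom_mult[OF edge_action_hom[of n \<pi>, where ?'k = 'k], of "nc_const c" f]
    filtered_hom.hom_sc[OF edge_action_hom[of n \<pi>, where ?'k = 'k], of c]
  by (simp add: const_mult)

lemma edge_action_gen_exp:
  "edge_action 3 \<pi> (gen_exp c 1 2) = gen_exp c (\<pi> 1) (\<pi> 2)"
  "edge_action 3 \<pi> (gen_exp c 1 3) = gen_exp c (\<pi> 1) (\<pi> 3)"
  "edge_action 3 \<pi> (gen_exp c 2 3) = gen_exp c (\<pi> 2) (\<pi> 3)"
  for c :: "'k::field_char_0"
  by (simp_all add: edge_action_exp edge_action_scale edge_action_gen)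

lemma edge_action_mult: "edge_action n \<pi> (f * g) = edge_action n \<pi> f * edge_action n \<pi> g"
  for f :: "(nat set, 'k::field_char_0) ncps"
  by (rule filtered_hom.hom_mult[OF edge_action_hom])

lemma edge_action_add: "edge_action n \<pi> (f + g) = edge_action n \<pi> f + edge_action n \<pi> g"
  for f :: "(nat set, 'k::field_char_0) ncps"
  by (rule filtered_hom.hom_add[OF edge_action_hom])

lemmas gen_normalize = gen_commute[of 2 1] gen_commute[of 3 1] gen_commute[of 3 2]

lemma edge_action_gen_sum_exp:
  "edge_action 3 (perm3 2 1 3) (gen_sum_exp c) = gen_sum_exp c"
  "edge_action 3 (perm3 2 3 1) (gen_sum_exp c) = gen_sum_exp c"
  "edge_action 3 (perm3 3 2 1) (gen_sum_exp c) = gen_sum_exp c" for c :: "'k::field_char_0"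
  by (simp_all add: edge_action_exp edge_action_scale)
    (simp_all add: gen_sum_def edge_action_add edge_action_gen gen_normalize ac_simps)

lemma art_gen_exp_inverse:
  "art_of (gen_exp c i j) * art_of (gen_exp (- c) i j) = 1"
  "art_of (gen_exp (- c) i j) * art_of (gen_exp c i j) = 1"
  "art_of (gen_sum_exp c) * art_of (gen_sum_exp (- c)) = 1"
  "art_of (gen_sum_exp (- c)) * art_of (gen_sum_exp c) = 1"
  for c :: "'k::field_char_0"
  by (simp_all add: art_of_mult[symmetric] exp_scale_inverse gen_sum_filt art_of_one)

lemma art_gen_sum_commute: "art_of gen_sum * x = x * art_of gen_sum" for x :: "'k::field_char_0 art3"
proof -
  obtain f where f: "f \<in> series3" "x = art_of f" by (rule art_of_surj)
  have "art.is_subst (edges 3) (\<lambda>e. art_of (nc_var e)) f x"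
    unfolding f(2) by (rule art_of.hom_is_subst[OF nc_is_subst_self[OF finite_edges f(1)]])
  then have approx: "x - art.subst_partial (edges 3) (\<lambda>e. art_of (nc_var e)) f N \<in> art_filt (Suc N)" for N
    by (simp add: art.is_subst_def art.approx_def)
  have gen: "art_of gen_sum * art_of (nc_var e) = (art_of (nc_var e) * art_of gen_sum :: 'k art3)"
    if "e \<in> edges 3" for e
    using that art_gen_sum_central[of 1 2, where ?'k = 'k, symmetric]
      art_gen_sum_central[of 1 3, where ?'k = 'k, symmetric]
      art_gen_sum_central[of 2 3, where ?'k = 'k, symmetric] by (auto simp: edges_3 gen_def)
  have mono: "art_of gen_sum * art.monomial (\<lambda>e. art_of (nc_var e)) w
      = (art.monomial (\<lambda>e. art_of (nc_var e)) w * art_of gen_sum :: 'k art3)" if "set w \<subseteq> edges 3" for w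
    using that
  proof (induction w)
    case (Cons e w)
    let ?m = "art.monomial (\<lambda>e. art_of (nc_var e)) w :: 'k art3"
    have "art_of gen_sum * (art_of (nc_var e) * ?m) = art_of (nc_var e) * (art_of gen_sum * ?m)"
      using gen[of e] Cons.prems by (simp add: mult.assoc[symmetric])
    with Cons show ?case by (simp add: mult.assoc)
  qed simp
  have partial: "art_of gen_sum * art.subst_partial (edges 3) (\<lambda>e. art_of (nc_var e)) f N
      = art.subst_partial (edges 3) (\<lambda>e. art_of (nc_var e)) f N * art_of gen_sum" for N
    unfolding art.subst_partial_def sum_distrib_left sum_distrib_right
  proof (rule sum.cong[OF HOL.refl])
    fix w assume w: "w \<in> {w. set w \<subseteq> edges 3 \<and> length w \<le> N}"
    have "art_of gen_sum * (art_of (nc_const (coeff f w)) * art.monomial (\<lambda>e. art_of (nc_var e)) w)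
        = art_of (nc_const (coeff f w)) * (art_of gen_sum * art.monomial (\<lambda>e. art_of (nc_var e)) w)"
      by (simp only: mult.assoc[symmetric] art.sc_commute[of _ "art_of gen_sum"])
    then show "art_of gen_sum * (art_of (nc_const (coeff f w)) * art.monomial (\<lambda>e. art_of (nc_var e)) w)
        = art_of (nc_const (coeff f w)) * art.monomial (\<lambda>e. art_of (nc_var e)) w * art_of gen_sum"
      using mono[of w] w by (simp add: mult.assoc)
  qed
  have "art_of gen_sum * x - x * art_of gen_sum \<in> art_filt (Suc N)" for N
  proof -
    let ?s = "art.subst_partial (edges 3) (\<lambda>e. art_of (nc_var e)) f N"
    have "art_of gen_sum * x - x * art_of gen_sum
        = art_of gen_sum * (x - ?s) - (x - ?s) * art_of gen_sum"
      using partial[of N] by (simp add: algebra_simps)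
    then show ?thesis
      using art.F_diff[OF art.F_mult_left[OF approx[of N]] art.F_mult_right[OF approx[of N]]] by simp
  qed
  then have "art_of gen_sum * x - x * art_of gen_sum \<in> art_filt N" for N
    by (rule art.F_mono[OF le_SucI[OF order_refl]])
  then have "art_of gen_sum * x - x * art_of gen_sum = 0" by (rule art.F_separated)
  then show ?thesis by simp
qed

lemma art_gen_sum_scale_commute:
  "art_of (nc_scale c gen_sum) * x = x * art_of (nc_scale c gen_sum)" for x :: "'k::field_char_0 art3"
proof -
  have "art_of (nc_scale c gen_sum) = art_of (nc_const c) * art_of gen_sum"
    by (simp add: art_of_mult[symmetric] const_mult)
  then show ?thesis
    by (simp only: mult.assoc art_gen_sum_commute[of x]) (simp only: mult.assoc[symmetric] art.sc_commute[of c x])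
qed

lemma art_gen_sum_exp_commute:
  "art_of (gen_sum_exp c) * x = x * art_of (gen_sum_exp c)" for x :: "'k::field_char_0 art3"
  using art_of_exp[of "nc_scale c gen_sum"] gen_sum_filt
  by (intro art.is_exp_commute[OF art_gen_sum_scale_commute]) simp

text \<open>The summand \<open>t\<^sub>1\<^sub>3 + t\<^sub>2\<^sub>3\<close> differs from the central \<open>gen_sum\<close> by \<open>t\<^sub>1\<^sub>2\<close>, with which it commutes.\<close>

lemma art_gen_sum_exp_split:
  "art_of (gen_sum_exp c) = art_of (gen_exp c 1 2) * art_of (nc_exp (nc_scale c (gen 1 3 + gen 2 3)))"
  for c :: "'k::field_char_0"
proof -
  let ?a = "nc_scale c (gen 1 2)" and ?b = "nc_scale c (gen 1 3 + gen 2 3)"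
  have f: "?a \<in> nc_filt 1" "?b \<in> nc_filt 1" by (simp_all add: nc.F_add)
  have sum: "art_of (nc_scale c gen_sum) = art_of ?a + art_of ?b"
    unfolding art_of_add[symmetric]
    by (rule arg_cong[where f = art_of], rule ncps_eqI) (simp add: gen_sum_def algebra_simps)
  have "art_of ?a * art_of ?b = art_of ?b * art_of ?a"
    using art_gen_sum_scale_commute[of c "art_of ?a"] unfolding sum by (simp add: distrib_left distrib_right)
  then have "art.is_exp (art_of ?a + art_of ?b) (art_of (nc_exp ?a) * art_of (nc_exp ?b))"
    by (intro art.is_exp_add art_of_exp art_filtI f)
  moreover have "art.is_exp (art_of ?a + art_of ?b) (art_of (gen_sum_exp c))"
    unfolding sum[symmetric] by (rule art_of_exp) (simp add: gen_sum_filt)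
  ultimately show ?thesis by (rule art.is_exp_unique[rotated])
qed

subsection \<open>Permuted copies of the free subalgebra\<close>

definition perm_letter :: "(nat \<Rightarrow> nat) \<Rightarrow> (letter, 'k::field_char_0) ncps \<Rightarrow> 'k art3" where
  "perm_letter \<pi> \<psi> = art_of (edge_action 3 \<pi> (letter_emb \<psi>))"

lemma perm_letter_mult: "perm_letter \<pi> (\<psi> * \<phi>) = perm_letter \<pi> \<psi> * perm_letter \<pi> \<phi>"
  by (simp add: perm_letter_def letter_emb.hom_mult edge_action_mult art_of_mult)

lemma perm_letter_one: "perm_letter \<pi> 1 = (1 :: 'k::field_char_0 art3)"
  by (simp add: perm_letter_def filtered_hom.hom_one[OF edge_action_hom] art_of_one)

lemma perm_letter_inverse: "\<psi> * \<phi> = 1 \<Longrightarrow> perm_letter \<pi> \<psi> * perm_letter \<pi> \<phi> = 1"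
  by (metis perm_letter_mult perm_letter_one)

lemma letter_swap_hom:
  "filtered_hom nc_filt nc_const nc_filt (nc_const :: 'k::field_char_0 \<Rightarrow> (letter, 'k) ncps) nc_swap"
  unfolding nc_swap_def by (rule nc_subst_hom) (auto split: letter.split simp: One_nat_def)

lemma letter_emb_swap:
  "letter_emb (nc_swap \<psi>) = edge_action 3 (perm3 3 2 1) (letter_emb \<psi>)"
  for \<psi> :: "(letter, 'k::field_char_0) ncps"
proof -
  have "nc.is_subst UNIV (case_letter (nc_var LB) (nc_var LA)) \<psi> (nc_swap \<psi>)"
    unfolding nc_swap_def by (rule nc_subst_is_subst) (auto split: letter.split simp: One_nat_def)
  then have "nc.is_subst UNIV (\<lambda>a. letter_emb (case_letter (nc_var LB) (nc_var LA) a)) \<psi> (letter_emb (nc_swap \<psi>))"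
    by (rule letter_emb.hom_is_subst)
  moreover have "letter_emb (case_letter (nc_var LB) (nc_var LA) a)
      = (edge_action 3 (perm3 3 2 1) (letter_gen a) :: (nat set, 'k) ncps)" for a
    by (cases a) (simp_all add: letter_emb_var letter_gen_def edge_action_gen gen_normalize)
  ultimately have "nc.is_subst UNIV (\<lambda>a. edge_action 3 (perm3 3 2 1) (letter_gen a)) \<psi> (letter_emb (nc_swap \<psi>))"
    by simp
  then show ?thesis
    by (rule nc.is_subst_unique[OF _ filtered_hom.hom_is_subst[OF edge_action_hom letter_emb_is_subst]])
qed

lemma perm_letter_swap: "perm_letter \<pi> (nc_swap \<psi>) = perm_letter (\<pi> \<circ> perm3 3 2 1) \<psi>"
  by (simp add: perm_letter_def letter_emb_swap edge_action_comp)

lemma nc_swap_swap: "nc_swap (nc_swap \<psi>) = \<psi>" for \<psi> :: "(letter, 'k::field_char_0) ncps"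
proof -
  have "letter_emb (nc_swap (nc_swap \<psi>)) = letter_emb \<psi>"
    by (simp add: letter_emb_swap edge_action_comp perm3_id edge_action_id letter_emb_closed)
  then show ?thesis by (metis letter_retract_emb)
qed

lemma artin_act_Psi_t:
  "\<pi> permutes {1..3} \<Longrightarrow> artin_act 3 \<pi> (Psi_t \<Psi>) = Rep_art3 (perm_letter \<pi> \<Psi>)"
  by (simp add: Psi_t_eq art_letter_def perm_letter_def Rep_art_of letter_emb_closed artin_act_class
      edge_action_closed)

lemma Rep_art3_inverse_element:
  assumes "x * y = 1" "y * x = 1" shows "inv\<^bsub>artin_alg 3\<^esub> (Rep_art3 x) = Rep_art3 y"
proof -
  interpret ring "artin_alg 3 :: (nat set, 'a) ncps set ring" by (rule artin_alg_ring)
  show ?thesis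
    by (rule inv_unique'[symmetric])
      (simp_all add: Rep_art3 times_art3.rep_eq[symmetric] one_art3.rep_eq[symmetric] assms)
qed

lemma exp_half_Rep:
  "exp_half 3 f = Rep_art3 (art_of (nc_exp (nc_scale (1/2) f)))"
  if "f \<in> series3" "f \<in> nc_filt 1" for f :: "(nat set, 'k::field_char_0) ncps"
  using that by (simp add: exp_half_class Rep_art_of nc_exp_closed nc_ring_closed)

text \<open>
  For \<open>\<Psi>'\<close> the inverse of \<open>\<Psi>\<close>, \<open>hexagon\<close> is the form that the braid relation takes.  It becomes
  (H3) when \<open>\<^sup>2\<^sup>1\<^sup>3\<Psi>\<^sup>-\<^sup>1\<close> and \<open>\<^sup>2\<^sup>3\<^sup>1\<Psi>\<close> are rewritten by means of (AS), and (H1) when moreover the permutation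
  \<open>321\<close> is applied to it.
\<close>

definition hexagon :: "(letter, 'k::field_char_0) ncps \<Rightarrow> (letter, 'k) ncps \<Rightarrow> bool" where
  "hexagon \<Psi> \<Psi>' \<longleftrightarrow> art_of (nc_exp (nc_scale (1/2) (gen 1 3 + gen 2 3))) =
    perm_letter (perm3 2 1 3) \<Psi>' * art_of (gen_exp (1/2) 1 3) * perm_letter (perm3 2 3 1) \<Psi> *
    art_of (gen_exp (1/2) 2 3) * art_letter \<Psi>"

lemma ring_inverse_unique:
  fixes x y z :: "'a::ring_1"
  assumes "x * y = 1" "y * z = 1" shows "x = z"
  using assms by (metis mult.assoc mult_1_left mult_1_right)

lemma nc_ring_inv:
  assumes "\<Psi> * \<Psi>' = 1" "\<Psi>' * \<Psi> = 1" shows "inv\<^bsub>nc_ring UNIV\<^esub> \<Psi> = \<Psi>'"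
proof -
  interpret ring "nc_ring UNIV" by (rule nc_ring_is_ring)
  show ?thesis by (rule inv_unique'[symmetric]) (simp_all add: assms)
qed

lemma semi_associator_iff:
  fixes \<psi> :: "(letter, 'k::field_char_0) ncps"
  assumes \<psi>: "\<psi> \<in> free_lie_gt1 UNIV"
  shows "semi_associator (nc_exp \<psi>) \<longleftrightarrow>
    nc_swap (nc_exp \<psi>) = nc_exp (- \<psi>) \<and> hexagon (nc_exp \<psi>) (nc_exp (- \<psi>))"
proof -
  define \<Psi> \<Psi>' where "\<Psi> = nc_exp \<psi>" and "\<Psi>' = nc_exp (- \<psi>)"
  have "\<psi> \<in> nc_filt 1" using \<psi> free_lie_filt by (auto simp: free_lie_gt1_def)
  then have inverse: "\<Psi> * \<Psi>' = 1" "\<Psi>' * \<Psi> = 1"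
    by (simp_all add: \<Psi>_def \<Psi>'_def nc_exp_uminus)
  define h where "h = (\<lambda>i j. art_of (gen_exp (1/2) i j) :: 'k art3)"
  let ?E = "\<lambda>f. art_of (nc_exp (nc_scale (1/2) f)) :: 'k art3"
  note p = perm_letter_inverse[OF inverse(1)] perm_letter_inverse[OF inverse(2)]
  have J: "art_letter \<Psi> * art_letter \<Psi>' = 1" "art_letter \<Psi>' * art_letter \<Psi> = 1"
    using inverse by (metis art_letter.hom_mult art_letter.hom_one)+
  have inv: "inv\<^bsub>artin_alg 3\<^esub> (Rep_art3 (perm_letter \<pi> \<Psi>)) = Rep_art3 (perm_letter \<pi> \<Psi>')"
    "inv\<^bsub>artin_alg 3\<^esub> (Rep_art3 (art_letter \<Psi>)) = Rep_art3 (art_letter \<Psi>')" for \<pi>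
    by (rule Rep_art3_inverse_element[OF p] Rep_art3_inverse_element[OF J])+
  have sums: "gen 1 2 + gen 1 3 \<in> series3" "gen 1 3 + gen 2 3 \<in> series3"
    "(gen 1 2 + gen 1 3 :: (nat set, 'k) ncps) \<in> nc_filt 1"
    "(gen 1 3 + gen 2 3 :: (nat set, 'k) ncps) \<in> nc_filt 1"
    by (simp_all add: nc_ring_add_closed gen_closed3 nc.F_add)
  have Reps: "exp_half 3 (gen 1 2) = Rep_art3 (h 1 2)" "exp_half 3 (gen 1 3) = Rep_art3 (h 1 3)"
    "exp_half 3 (gen 2 3) = Rep_art3 (h 2 3)"
    by (simp_all add: h_def exp_half_Rep gen_closed3)
  have H1: "(exp_half 3 (gen 1 2 + gen 1 3) =
       inv\<^bsub>artin_alg 3\<^esub> (artin_act 3 (perm3 2 3 1) (Psi_t \<Psi>)) \<otimes>\<^bsub>artin_alg 3\<^esub>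
       exp_half 3 (gen 1 3) \<otimes>\<^bsub>artin_alg 3\<^esub>
       artin_act 3 (perm3 2 1 3) (Psi_t \<Psi>) \<otimes>\<^bsub>artin_alg 3\<^esub>
       exp_half 3 (gen 1 2) \<otimes>\<^bsub>artin_alg 3\<^esub>
       inv\<^bsub>artin_alg 3\<^esub> (Psi_t \<Psi>)) \<longleftrightarrow>
     ?E (gen 1 2 + gen 1 3) = perm_letter (perm3 2 3 1) \<Psi>' * h 1 3 * perm_letter (perm3 2 1 3) \<Psi> *
       h 1 2 * art_letter \<Psi>'"
    by (simp add: artin_act_Psi_t[unfolded Psi_t_eq] Psi_t_eq Reps exp_half_Rep sums inv
        times_art3.rep_eq[symmetric] Rep_art3_inject)
  have H3: "(exp_half 3 (gen 1 3 + gen 2 3) =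
       artin_act 3 (perm3 3 1 2) (Psi_t \<Psi>) \<otimes>\<^bsub>artin_alg 3\<^esub>
       exp_half 3 (gen 1 3) \<otimes>\<^bsub>artin_alg 3\<^esub>
       inv\<^bsub>artin_alg 3\<^esub> (artin_act 3 (perm3 1 3 2) (Psi_t \<Psi>)) \<otimes>\<^bsub>artin_alg 3\<^esub>
       exp_half 3 (gen 2 3) \<otimes>\<^bsub>artin_alg 3\<^esub>
       Psi_t \<Psi>) \<longleftrightarrow>
     ?E (gen 1 3 + gen 2 3) = perm_letter (perm3 3 1 2) \<Psi> * h 1 3 * perm_letter (perm3 1 3 2) \<Psi>' *
       h 2 3 * art_letter \<Psi>"
    by (simp add: artin_act_Psi_t[unfolded Psi_t_eq] Psi_t_eq Reps exp_half_Rep sums inv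
        times_art3.rep_eq[symmetric] Rep_art3_inject)
  have swap: "perm_letter (perm3 3 1 2) \<Psi> = perm_letter (perm3 2 1 3) \<Psi>'"
      "perm_letter (perm3 1 3 2) \<Psi>' = perm_letter (perm3 2 3 1) \<Psi>"
      "perm_letter (perm3 3 2 1) \<Psi> = art_letter \<Psi>'" if AS: "nc_swap \<Psi> = \<Psi>'"
  proof -
    have AS': "nc_swap \<Psi>' = \<Psi>" using AS nc_swap_swap[of \<Psi>] by simp
    show "perm_letter (perm3 3 1 2) \<Psi> = perm_letter (perm3 2 1 3) \<Psi>'"
      using perm_letter_swap[of "perm3 2 1 3" \<Psi>] AS by simp
    show "perm_letter (perm3 1 3 2) \<Psi>' = perm_letter (perm3 2 3 1) \<Psi>"
      using perm_letter_swap[of "perm3 2 3 1" \<Psi>'] AS' by simp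
    show "perm_letter (perm3 3 2 1) \<Psi> = art_letter \<Psi>'"
      using AS by (simp add: perm_letter_def letter_emb_swap[symmetric] art_letter_def)
  qed
  have hexagon_H3: "hexagon \<Psi> \<Psi>' \<longleftrightarrow> ?E (gen 1 3 + gen 2 3) =
      perm_letter (perm3 3 1 2) \<Psi> * h 1 3 * perm_letter (perm3 1 3 2) \<Psi>' * h 2 3 * art_letter \<Psi>"
    if "nc_swap \<Psi> = \<Psi>'"
    using swap[OF that] by (simp add: hexagon_def h_def)
  \<comment> \<open>Apply the permutation \<open>321\<close> to representatives of the two sides.\<close>
  have hexagon_H1: "?E (gen 1 2 + gen 1 3) = perm_letter (perm3 2 3 1) \<Psi>' * h 1 3 *
      perm_letter (perm3 2 1 3) \<Psi> * h 1 2 * art_letter \<Psi>'"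
    if AS: "nc_swap \<Psi> = \<Psi>'" and hex: "hexagon \<Psi> \<Psi>'"
  proof -
    let ?d = "edge_action 3 (perm3 3 2 1) :: (nat set, 'k) ncps \<Rightarrow> _"
    let ?l = "nc_exp (nc_scale (1/2) (gen 1 3 + gen 2 3)) :: (nat set, 'k) ncps"
    let ?r = "edge_action 3 (perm3 2 1 3) (letter_emb \<Psi>') * gen_exp (1/2) 1 3 *
        edge_action 3 (perm3 2 3 1) (letter_emb \<Psi>) * gen_exp (1/2) 2 3 * letter_emb \<Psi>"
    have C: "?l \<in> series3" "?r \<in> series3"
      by (auto intro!: nc_ring_mult_closed nc_exp_closed nc_ring_closed sums gen_closed3
          edge_action_closed letter_emb_closed)
    have "art_of ?l = art_of ?r"
      using hex by (simp add: hexagon_def perm_letter_def art_letter_def art_of_mult)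
    then have "?l - ?r \<in> artin_ideal 3"
      using C by (simp add: art_of_eq_iff nc_restrict_id)
    then have "?d (?l - ?r) \<in> artin_ideal 3" by (rule edge_action_ideal[rotated]) simp
    then have eq: "art_of (?d ?l) = art_of (?d ?r)"
      by (simp add: art_of_eq_iff nc_restrict_id edge_action_closed
          filtered_hom.hom_diff[OF edge_action_hom])
    have "?d ?l = nc_exp (nc_scale (1/2) (gen 1 2 + gen 1 3))"
      by (simp add: edge_action_exp sums edge_action_scale edge_action_add edge_action_gen
          gen_normalize add.commute)
    moreover have "art_of (?d ?r) = perm_letter (perm3 2 3 1) \<Psi>' * h 1 3 *
        perm_letter (perm3 2 1 3) \<Psi> * h 1 2 * perm_letter (perm3 3 2 1) \<Psi>"
      by (simp add: edge_action_mult edge_action_comp art_of_mult perm_letter_def h_def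
          edge_action_gen_exp gen_normalize)
    ultimately show ?thesis using eq swap(3)[OF AS] by simp
  qed
  have "semi_associator \<Psi> \<longleftrightarrow> nc_swap \<Psi> = \<Psi>' \<and> hexagon \<Psi> \<Psi>'"
    unfolding semi_associator_def H1 H3 nc_ring_inv[OF inverse]
    using hexagon_H3 hexagon_H1 \<psi> \<Psi>_def by blast
  then show ?thesis by (simp only: \<Psi>_def \<Psi>'_def)
qed


subsection \<open>Linear parts\<close>

text \<open>
  The relation \<open>\<equiv>\<^sub>2\<close> for series with constant term \<open>1\<close>, in a form in which linear parts add up in
  products.
\<close>

definition has_linear_part :: "('x, 'k::field_char_0) ncps \<Rightarrow> ('x, 'k) ncps \<Rightarrow> bool" where
  "has_linear_part F f \<longleftrightarrow> f \<in> nc_filt 1 \<and> F - 1 - f \<in> nc_filt 2"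

lemma has_linear_part_exp: "f \<in> nc_filt 1 \<Longrightarrow> has_linear_part (nc_exp f) f"
  for f :: "('x, 'k::field_char_0) ncps"
  using nc.is_exp_diff[of f 0 1 "nc_exp f" 1] nc_exp_is_exp[of f] nc.is_exp_0
  by (simp add: has_linear_part_def numeral_2_eq_2 One_nat_def)

lemma has_linear_part_mult:
  fixes F G :: "('x, 'k::field_char_0) ncps"
  assumes "has_linear_part F f" "has_linear_part G g" shows "has_linear_part (F * G) (f + g)"
proof -
  have 2: "F - 1 - f \<in> nc_filt 2" "G - 1 - g \<in> nc_filt 2" and 1: "f \<in> nc_filt 1" "g \<in> nc_filt 1"
    using assms by (auto simp: has_linear_part_def)
  have "F * G - 1 - (f + g) = (F - 1 - f) * G + (1 + f) * (G - 1 - g) + f * g"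
    by (simp add: algebra_simps)
  moreover have "f * g \<in> nc_filt 2" using nc.F_mult[OF 1] by (simp only: one_add_one)
  ultimately have "F * G - 1 - (f + g) \<in> nc_filt 2"
    by (simp only: nc.F_add nc.F_mult_left[OF 2(2)] nc.F_mult_right[OF 2(1)])
  then show ?thesis using 1 by (simp add: has_linear_part_def nc.F_add)
qed

lemma has_linear_part_hom:
  assumes "filtered_hom nc_filt nc_const nc_filt nc_const h" "has_linear_part F f"
  shows "has_linear_part (h F) (h f)"
proof -
  interpret filtered_hom nc_filt nc_const nc_filt nc_const h by (rule assms(1))
  show ?thesis
    using assms(2) hom_F[of "F - 1 - f" 2] hom_F[of f 1] by (auto simp: has_linear_part_def hom_diff)
qed

lemma has_linear_part_shift: "has_linear_part F f \<Longrightarrow> f - g \<in> nc_filt 2 \<Longrightarrow> has_linear_part F g"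
  for F :: "('x, 'k::field_char_0) ncps"
proof -
  assume F: "has_linear_part F f" and fg: "f - g \<in> nc_filt 2"
  have "f - g \<in> nc_filt 1" using fg nc.F_mono[of 1 2] by simp
  then have "g \<in> nc_filt 1" using F nc.F_diff[of f 1 "f - g"] by (simp add: has_linear_part_def)
  then show ?thesis
    using F nc.F_add[OF _ fg, of "F - 1 - f"] by (simp add: has_linear_part_def algebra_simps)
qed

lemma has_linear_part_unique: "has_linear_part F f \<Longrightarrow> has_linear_part F g \<Longrightarrow> f - g \<in> nc_filt 2"
  for F :: "('x, 'k::field_char_0) ncps"
  using nc.F_diff[of "F - 1 - g" 2 "F - 1 - f"] by (simp add: has_linear_part_def algebra_simps)

lemma equiv2_linear_part:
  fixes F :: "(nat set, 'k::field_char_0) ncps"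
  assumes "f \<in> nc_filt 1"
  shows "equiv2 (artin_class n F) (artin_class n (1 + f)) \<longleftrightarrow> has_linear_part F f"
  using assms
  by (auto simp: equiv2_iff has_linear_part_def nc_filt_def numeral_2_eq_2 less_Suc_eq_le One_nat_def
      diff_diff_eq)

section \<open>Semi-associators and representations\<close>

abbreviation art_smash ::
  "(nat set, 'k::field_char_0) ncps \<Rightarrow> (nat \<Rightarrow> nat) \<Rightarrow> (nat \<Rightarrow> nat) \<Rightarrow> (nat set, 'k) ncps set" where
  "art_smash f x \<equiv> smash 3 (artin_class 3 f) x"

lemma group_series_class: "f \<in> group_series \<Longrightarrow> artin_class 3 f \<in> exp_artin_lie 3"
  for f :: "(nat set, 'k::field_char_0) ncps"
  by (elim imageE) (simp add: exp_artin_lieI)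

lemma art_smash_mem: "f \<in> group_series \<Longrightarrow> x permutes {1..3} \<Longrightarrow> art_smash f x \<in> exp_group 3"
  by (intro exp_groupI group_series_class)

lemma art_smash_mult:
  assumes "f \<in> group_series" "g \<in> group_series" "x permutes {1..3}" "y permutes {1..3}"
  shows "art_smash f x \<otimes>\<^bsub>braid_alg 3\<^esub> art_smash g y = art_smash (f * edge_action 3 x g) (x \<circ> y)"
  using assms artin_class_mult[OF group_series_closed[OF assms(1)] edge_action_closed[OF assms(3)]]
  by (simp add: exp_group_mult group_series_class artin_act_class)

lemma art_smash_eq_iff:
  assumes "f \<in> series3" "g \<in> series3" "x permutes {1..3}"
  shows "art_smash f x = art_smash g x \<longleftrightarrow> art_of f = art_of g"
proof -
  have "art_smash f x = art_smash g x \<longleftrightarrow> artin_class 3 f = artin_class 3 g"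
    using smash_apply[OF assms(3)] by metis
  then show ?thesis
    using assms(1,2) by (simp add: artin_class_eq_iff art_of_eq_iff nc_restrict_id)
qed

abbreviation sigma_value :: "'k::field_char_0 \<Rightarrow> (nat \<Rightarrow> nat) \<Rightarrow> (nat set, 'k) ncps set" where
  "sigma_value c \<equiv> art_smash (gen_exp c 1 2) (perm3 2 1 3)"

abbreviation Delta_value ::
  "(letter, 'k::field_char_0) ncps \<Rightarrow> (nat \<Rightarrow> nat) \<Rightarrow> (nat set, 'k) ncps set" where
  "Delta_value \<Psi>' \<equiv> art_smash (gen_sum_exp (1/2) * letter_emb \<Psi>') (perm3 3 2 1)"

lemmas group_series_intros = group_series_mult group_series_gen group_series_act group_series_letter

lemma sigma_value_mem: "sigma_value c \<in> exp_group 3"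
  by (rule art_smash_mem[OF group_series_gen(1)]) simp

lemma Delta_value_mem: "\<psi> \<in> free_lie UNIV \<Longrightarrow> Delta_value (nc_exp \<psi>) \<in> exp_group 3"
  by (rule art_smash_mem) (auto intro!: group_series_intros simp del: One_nat_def)

lemma sigma_value_inv:
  "inv\<^bsub>exp_semidirect 3\<^esub> (sigma_value c) = sigma_value (- c)" for c :: "'k::field_char_0"
proof (rule group.inv_equality[OF exp_semidirect_group])
  have "sigma_value (- c) \<otimes>\<^bsub>exp_semidirect 3\<^esub> sigma_value c
      = art_smash (gen_exp (- c) 1 2 * gen_exp c 1 2) id"
    by (simp add: art_smash_mult group_series_gen edge_action_gen_exp gen_normalize perm3_id)
  then show "sigma_value (- c) \<otimes>\<^bsub>exp_semidirect 3\<^esub> sigma_value c = \<one>\<^bsub>exp_semidirect 3\<^esub>"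
    by (simp add: exp_scale_inverse artin_class_one)
qed (simp_all add: sigma_value_mem)

lemma parametrizes_iff:
  fixes \<psi> :: "(letter, 'k::field_char_0) ncps"
  assumes \<psi>: "\<psi> \<in> free_lie UNIV"
  shows "parametrizes (nc_exp \<psi>) \<rho> \<longleftrightarrow>
    \<rho> (sigma 3 1) = sigma_value (1/2) \<and> \<rho> Delta = Delta_value (nc_exp (- \<psi>))"
proof -
  let ?T = "gen_sum_exp (1/2) :: (nat set, 'k) ncps"
  have inverse: "nc_exp \<psi> * nc_exp (- \<psi>) = 1" "nc_exp (- \<psi>) * nc_exp \<psi> = 1"
    using nc_exp_uminus[OF free_lie_filt[OF \<psi>]] by auto
  have "inv\<^bsub>artin_alg 3\<^esub> (Psi_t (nc_exp \<psi>)) = artin_class 3 (letter_emb (nc_exp (- \<psi>)))"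
    unfolding Psi_t_eq art_letter_def Rep_art_of[OF letter_emb_closed]
    by (rule artin_class_inv[OF letter_emb_closed letter_emb_closed])
      (simp_all add: letter_emb.hom_mult[symmetric] inverse)
  moreover have "exp_half 3 (gen 1 2 + gen 1 3 + gen 2 3) = artin_class 3 ?T"
    by (simp add: gen_sum_def[symmetric] exp_half_class gen_sum_closed)
  moreover have "?T \<in> series3" by (rule group_series_closed[OF group_series_gen(4)])
  ultimately have "exp_half 3 (gen 1 2 + gen 1 3 + gen 2 3) \<otimes>\<^bsub>artin_alg 3\<^esub>
      inv\<^bsub>artin_alg 3\<^esub> (Psi_t (nc_exp \<psi>)) = artin_class 3 (?T * letter_emb (nc_exp (- \<psi>)))"
    by (simp add: artin_class_mult letter_emb_closed)
  then show ?thesis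
    by (simp add: parametrizes_def exp_half_class gen_closed3 adj_transp_perm3)
qed

lemma central_cancel:
  fixes T T' E a a' Z Zi Y :: "'a::ring_1"
  assumes T: "\<And>x. T * x = x * T" "T' * T = 1" and a: "a' * a = 1" "T = a * E"
    and Z: "Z * Zi = 1" "Zi * Z = 1"
  shows "T * T * Z = a * T * Y \<longleftrightarrow> E = Y * Zi"
proof
  assume "T * T * Z = a * T * Y"
  then have "T' * (T * (T * Z)) = T' * (T * (a * Y))"
    using T(1)[of a] by (simp add: mult.assoc[symmetric])
  then have "a * E * Z = a * Y" using T(2) by (simp add: mult.assoc[symmetric] a(2))
  then have "a' * (a * (E * Z)) = a' * (a * Y)" by (simp add: mult.assoc)
  then have "E * Z = Y" using a(1) by (simp add: mult.assoc[symmetric])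
  then show "E = Y * Zi" using Z(1) by (metis mult.assoc mult_1_right)
next
  assume "E = Y * Zi"
  then have "T * Z = a * Y" using Z(2) by (simp add: a(2) mult.assoc)
  then have "T * T * Z = T * a * Y" by (simp add: mult.assoc)
  then show "T * T * Z = a * T * Y" using T(1)[of a] by simp
qed

text \<open>
  In terms of the generators \<open>\<sigma>\<^sub>1\<close> and \<open>\<Delta>\<close>, the group \<open>B\<^sub>3\<close> is defined by the one relation
  \<open>\<Delta> \<sigma>\<^sub>1\<^sup>-\<^sup>1 \<Delta> = \<sigma>\<^sub>1 \<Delta> \<sigma>\<^sub>1\<close>.  For the values given by a series \<open>\<Psi>\<close> it amounts to \<open>hexagon\<close>: multiply out in the
  semidirect product and cancel the central factor \<open>exp T\<close>, using \<open>exp T = exp (t\<^sub>1\<^sub>2/2) exp ((t\<^sub>1\<^sub>3 + t\<^sub>2\<^sub>3)/2)\<close>.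
\<close>

lemma braid_relation_iff_hexagon:
  fixes \<psi> :: "(letter, 'k::field_char_0) ncps"
  assumes \<psi>: "\<psi> \<in> free_lie UNIV"
  defines "D \<equiv> Delta_value (nc_exp (- \<psi>))"
  shows "D \<otimes>\<^bsub>exp_semidirect 3\<^esub> sigma_value (- 1/2) \<otimes>\<^bsub>exp_semidirect 3\<^esub> D
      = sigma_value (1/2) \<otimes>\<^bsub>exp_semidirect 3\<^esub> D \<otimes>\<^bsub>exp_semidirect 3\<^esub> sigma_value (1/2)
    \<longleftrightarrow> hexagon (nc_exp \<psi>) (nc_exp (- \<psi>))"
proof -
  define \<Psi> \<Psi>' where "\<Psi> = nc_exp \<psi>" and "\<Psi>' = nc_exp (- \<psi>)"
  have inverse: "\<Psi> * \<Psi>' = 1" "\<Psi>' * \<Psi> = 1"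
    by (simp_all add: \<Psi>_def \<Psi>'_def nc_exp_uminus free_lie_filt[OF \<psi>])
  let ?T = "gen_sum_exp (1/2) :: (nat set, 'k) ncps" and ?e = "letter_emb \<Psi>'"
  let ?h = "gen_exp (1/2) :: nat \<Rightarrow> nat \<Rightarrow> (nat set, 'k) ncps"
  let ?h' = "gen_exp (- 1/2) :: nat \<Rightarrow> nat \<Rightarrow> (nat set, 'k) ncps"
  have e: "?e \<in> group_series"
    unfolding \<Psi>'_def by (rule group_series_letter[OF free_lie_uminus[OF \<psi>]])
  have D: "D = art_smash (?T * ?e) (perm3 3 2 1)" by (simp add: D_def \<Psi>'_def)
  let ?l = "?T * ?e * ?h' 2 3 * (?T * edge_action 3 (perm3 2 3 1) ?e)"
  let ?r = "?h 1 2 * (?T * edge_action 3 (perm3 2 1 3) ?e) * ?h 1 3"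
  have lr: "?l \<in> group_series" "?r \<in> group_series"
    by (intro group_series_intros e perm3_permutes)+
  have "D \<otimes>\<^bsub>braid_alg 3\<^esub> sigma_value (- 1/2) \<otimes>\<^bsub>braid_alg 3\<^esub> D = art_smash ?l (perm3 1 3 2)"
    unfolding D
    by (simp add: art_smash_mult group_series_mult group_series_gen e edge_action_gen_exp
        edge_action_mult edge_action_gen_sum_exp gen_normalize)
  moreover have "sigma_value (1/2) \<otimes>\<^bsub>braid_alg 3\<^esub> D \<otimes>\<^bsub>braid_alg 3\<^esub> sigma_value (1/2)
      = art_smash ?r (perm3 1 3 2)"
    unfolding D
    by (simp add: art_smash_mult group_series_mult group_series_gen group_series_act e
        edge_action_gen_exp edge_action_mult edge_action_gen_sum_exp gen_normalize)
  ultimately have "D \<otimes>\<^bsub>exp_semidirect 3\<^esub> sigma_value (- 1/2) \<otimes>\<^bsub>exp_semidirect 3\<^esub> D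
      = sigma_value (1/2) \<otimes>\<^bsub>exp_semidirect 3\<^esub> D \<otimes>\<^bsub>exp_semidirect 3\<^esub> sigma_value (1/2)
    \<longleftrightarrow> art_of ?l = art_of ?r"
    using group_series_closed[OF lr(1)] group_series_closed[OF lr(2)] by (simp add: art_smash_eq_iff)
  also have "\<dots> \<longleftrightarrow> hexagon \<Psi> \<Psi>'"
  proof -
    let ?aT = "art_of ?T" and ?P = "art_letter \<Psi>" and ?P' = "art_letter \<Psi>'"
    let ?X = "perm_letter (perm3 2 3 1) \<Psi>" and ?X' = "perm_letter (perm3 2 3 1) \<Psi>'"
    let ?Y' = "perm_letter (perm3 2 1 3) \<Psi>'"
    let ?b = "art_of (?h 2 3)" and ?b' = "art_of (?h' 2 3)"
    let ?Z = "?P' * ?b' * ?X'" and ?Zi = "?X * ?b * ?P"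
    have P: "?P' * ?P = 1" "?P * ?P' = 1"
      using inverse by (metis art_letter.hom_mult art_letter.hom_one)+
    have X: "?X' * ?X = 1" "?X * ?X' = 1" by (simp_all add: perm_letter_inverse inverse)
    have b: "?b' * ?b = 1" "?b * ?b' = 1"
      using art_gen_exp_inverse(1,2)[of "1/2 :: 'k" 2 3] by simp_all
    have "?Z * ?Zi = ?P' * (?b' * (?X' * ?X) * ?b) * ?P" by (simp only: mult.assoc)
    then have Z: "?Z * ?Zi = 1" by (simp only: X b P mult_1_left mult_1_right)
    have "?Zi * ?Z = ?X * (?b * (?P * ?P') * ?b') * ?X'" by (simp only: mult.assoc)
    then have Z': "?Zi * ?Z = 1" by (simp only: X b P mult_1_left mult_1_right)
    have "art_of ?l = ?aT * ?P' * ?b' * (?aT * ?X')"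
      by (simp add: art_of_mult art_letter_def perm_letter_def)
    also have "\<dots> = ?aT * (?P' * ?b' * ?aT) * ?X'" by (simp only: mult.assoc)
    also have "\<dots> = ?aT * ?aT * ?Z"
      unfolding art_gen_sum_exp_commute[of "1/2" "?P' * ?b'", symmetric] by (simp only: mult.assoc)
    finally have l: "art_of ?l = ?aT * ?aT * ?Z" .
    have r: "art_of ?r = art_of (?h 1 2) * ?aT * (?Y' * art_of (?h 1 3))"
      by (simp add: art_of_mult perm_letter_def mult.assoc)
    have "art_of ?l = art_of ?r \<longleftrightarrow> art_of (nc_exp (nc_scale (1/2) (gen 1 3 + gen 2 3)))
        = (?Y' * art_of (?h 1 3)) * ?Zi"
      unfolding l r
      by (rule central_cancel[OF art_gen_sum_exp_commute art_gen_exp_inverse(4)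
            art_gen_exp_inverse(2) art_gen_sum_exp_split Z Z'])
    then show ?thesis by (simp add: hexagon_def mult.assoc)
  qed
  finally show ?thesis by (simp only: \<Psi>_def \<Psi>'_def)
qed

lemma semi_associatorE:
  assumes "semi_associator \<Psi>"
  obtains \<psi> where "\<psi> \<in> free_lie_gt1 UNIV" "\<psi> \<in> free_lie UNIV" "\<Psi> = nc_exp \<psi>"
  using assms by (auto simp: semi_associator_def free_lie_gt1_def)

lemma free_lie_gt1_filt: "\<psi> \<in> free_lie_gt1 X \<Longrightarrow> \<psi> \<in> nc_filt 2" for \<psi> :: "('x, 'k::field_char_0) ncps"
proof -
  assume \<psi>: "\<psi> \<in> free_lie_gt1 X"
  have "coeff \<psi> w = 0" if w: "length w < 2" for w
  proof (cases w)
    case Nil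
    then show ?thesis using free_lie_filt[of \<psi> X] \<psi> by (simp add: free_lie_gt1_def nc_filt_1)
  next
    case (Cons a v)
    then show ?thesis using w \<psi> by (simp add: free_lie_gt1_def)
  qed
  then show ?thesis by (simp add: nc_filt_def)
qed

lemma restrict_hom: "group G \<Longrightarrow> h \<in> hom G H \<Longrightarrow> restrict h (carrier G) \<in> hom G H"
  by (auto simp: hom_def group.is_monoid monoid.m_closed)

lemma braid_repsI:
  "h \<in> hom (braid_group n) (exp_semidirect n) \<Longrightarrow> restrict h (carrier (braid_group n)) \<in> braid_reps n"
  using restrict_hom[OF braid_group_group, of h n "exp_semidirect n"]
  by (auto simp: braid_reps_def hom_def Pi_def intro: exp_group_subset)

lemma parametrized_rep_values:
  fixes \<psi> :: "(letter, 'k::field_char_0) ncps"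
  assumes \<psi>: "\<psi> \<in> free_lie UNIV" and \<rho>: "\<rho> \<in> braid_reps 3" "parametrizes (nc_exp \<psi>) \<rho>"
  shows "\<rho> \<in> hom (braid_group 3) (exp_semidirect 3)" "\<rho> (sigma 3 1) = sigma_value (1/2)"
    and "\<rho> (sigma 3 2) = inv\<^bsub>exp_semidirect 3\<^esub> (sigma_value (1/2)) \<otimes>\<^bsub>exp_semidirect 3\<^esub>
      Delta_value (nc_exp (- \<psi>)) \<otimes>\<^bsub>exp_semidirect 3\<^esub> inv\<^bsub>exp_semidirect 3\<^esub> (sigma_value (1/2))"
proof -
  have v: "\<rho> (sigma 3 1) = sigma_value (1/2)" "\<rho> Delta = Delta_value (nc_exp (- \<psi>))"
    using \<rho>(2) unfolding parametrizes_iff[OF \<psi>] by blast+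
  show "\<rho> (sigma 3 1) = sigma_value (1/2)" by (rule v)
  have "\<rho> \<in> hom (braid_group 3) (braid_alg 3)" using \<rho>(1) unfolding braid_reps_def by blast
  then show hom: "\<rho> \<in> hom (braid_group 3) (exp_semidirect 3)"
    by (rule braid_rep_exp_hom)
      (simp_all only: v sigma_value_mem Delta_value_mem[OF free_lie_uminus[OF \<psi>]])
  interpret r: group_hom "braid_group 3" "exp_semidirect 3" \<rho>
    by (intro group_hom.intro group_hom_axioms.intro braid_group_group exp_semidirect_group hom)
  have s: "sigma 3 1 \<in> carrier (braid_group 3)" by (rule sigma_closed) simp
  show "\<rho> (sigma 3 2) = inv\<^bsub>exp_semidirect 3\<^esub> (sigma_value (1/2)) \<otimes>\<^bsub>exp_semidirect 3\<^esub>
      Delta_value (nc_exp (- \<psi>)) \<otimes>\<^bsub>exp_semidirect 3\<^esub> inv\<^bsub>exp_semidirect 3\<^esub> (sigma_value (1/2))"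
    unfolding sigma_2_eq
    by (simp only: r.hom_mult r.hom_inv r.G.m_closed r.G.inv_closed s Delta_closed v)
qed

text \<open>
  The values at \<open>\<sigma>\<^sub>1\<close> and \<open>\<Delta>\<close> are invertible, so the representation is a homomorphism to
  \<open>exp_semidirect 3\<close>, and such a homomorphism is determined at generators.
\<close>

lemma parametrized_rep_unique:
  assumes "semi_associator \<Psi>" "\<rho> \<in> braid_reps 3" "\<rho>' \<in> braid_reps 3"
    and "parametrizes \<Psi> \<rho>" "parametrizes \<Psi> \<rho>'"
  shows "\<rho> = \<rho>'"
proof -
  obtain \<psi> where \<psi>: "\<psi> \<in> free_lie UNIV" "\<Psi> = nc_exp \<psi>"
    using assms(1) by (rule semi_associatorE)
  note v = parametrized_rep_values[OF \<psi>(1) assms(2) assms(4)[unfolded \<psi>(2)]]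
  note v' = parametrized_rep_values[OF \<psi>(1) assms(3) assms(5)[unfolded \<psi>(2)]]
  have "\<rho> \<beta> = \<rho>' \<beta>" if "\<beta> \<in> carrier (braid_group 3)" for \<beta>
  proof (rule braid_hom_unique[OF exp_semidirect_group v(1) v'(1) _ that])
    fix i :: nat assume "i \<in> {1..<3}"
    then consider "i = 1" | "i = 2" by fastforce
    then show "\<rho> (sigma 3 i) = \<rho>' (sigma 3 i)"
      by cases (simp_all only: v(2,3) v'(2,3))
  qed
  then show ?thesis
    using assms(2,3) unfolding braid_reps_def
    by (intro extensionalityI[of _ "carrier (braid_group 3)"]) blast+
qed

text \<open>
  The factor \<open>exp T\<close> is invertible, and the free algebra embeds into \<open>artin_alg 3\<close>.
\<close>

lemma parametrizing_series_unique:
  fixes \<Psi> \<Phi> :: "(letter, 'k::field_char_0) ncps"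
  assumes "semi_associator \<Psi>" "semi_associator \<Phi>" "parametrizes \<Psi> \<rho>" "parametrizes \<Phi> \<rho>"
  shows "\<Psi> = \<Phi>"
proof -
  obtain \<psi> where \<psi>: "\<psi> \<in> free_lie UNIV" "\<Psi> = nc_exp \<psi>"
    using assms(1) by (rule semi_associatorE)
  obtain \<phi> where \<phi>: "\<phi> \<in> free_lie UNIV" "\<Phi> = nc_exp \<phi>"
    using assms(2) by (rule semi_associatorE)
  let ?T = "gen_sum_exp (1/2) :: (nat set, 'k) ncps"
  have C: "?T * letter_emb \<chi> \<in> series3" for \<chi>
    by (rule nc_ring_mult_closed[OF group_series_closed[OF group_series_gen(4)] letter_emb_closed])
  have "Delta_value (nc_exp (- \<psi>)) = Delta_value (nc_exp (- \<phi>))"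
    using assms(3,4) unfolding \<psi>(2) \<phi>(2) parametrizes_iff[OF \<psi>(1)] parametrizes_iff[OF \<phi>(1)]
    by simp
  then have "art_of (?T * letter_emb (nc_exp (- \<psi>))) = art_of (?T * letter_emb (nc_exp (- \<phi>)))"
    using art_smash_eq_iff[OF C C perm3_permutes(5)] by blast
  then have "art_of ?T * art_letter (nc_exp (- \<psi>)) = art_of ?T * art_letter (nc_exp (- \<phi>))"
    by (simp only: art_of_mult art_letter_def)
  then have "art_of (gen_sum_exp (- (1/2))) * (art_of ?T * art_letter (nc_exp (- \<psi>)))
      = art_of (gen_sum_exp (- (1/2))) * (art_of ?T * art_letter (nc_exp (- \<phi>)))"
    by (simp only:)
  then have "art_letter (nc_exp (- \<psi>)) = art_letter (nc_exp (- \<phi>))"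
    by (simp only: mult.assoc[symmetric] art_gen_exp_inverse(4) mult_1_left)
  then have "nc_exp (- \<psi>) = nc_exp (- \<phi>)" by (simp only: art_letter_inject)
  then show ?thesis
    unfolding \<psi>(2) \<phi>(2)
    using nc_exp_uminus[OF free_lie_filt[OF \<psi>(1)]] nc_exp_uminus[OF free_lie_filt[OF \<phi>(1)]]
    by (metis ring_inverse_unique)
qed

text \<open>
  The identity \<open>\<sigma>\<^sub>2 = \<sigma>\<^sub>1\<^sup>-\<^sup>1 \<Delta> \<sigma>\<^sub>1\<^sup>-\<^sup>1\<close> prescribes the value at \<open>\<sigma>\<^sub>2\<close>; the braid relation then holds by
  \<open>braid_relation_iff_hexagon\<close>.  The linear part at \<open>\<sigma>\<^sub>2\<close> comes out as
  \<open>T - t\<^sub>1\<^sub>2/2 - t\<^sub>1\<^sub>3/2 = t\<^sub>2\<^sub>3/2\<close>.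
\<close>

lemma semi_associator_rep:
  fixes \<Psi> :: "(letter, 'k::field_char_0) ncps"
  assumes "semi_associator \<Psi>"
  shows "\<exists>\<rho>. \<rho> \<in> braid_reps 3 \<and> parametrizes \<Psi> \<rho> \<and> universal_rep \<rho>"
proof -
  obtain \<psi> where \<psi>: "\<psi> \<in> free_lie_gt1 UNIV" "\<psi> \<in> free_lie UNIV" "\<Psi> = nc_exp \<psi>"
    using assms by (rule semi_associatorE)
  have n\<psi>: "- \<psi> \<in> free_lie UNIV" by (rule free_lie_uminus[OF \<psi>(2)])
  let ?G = "exp_semidirect 3 :: ((nat \<Rightarrow> nat) \<Rightarrow> (nat set, 'k) ncps set) monoid"
  interpret G: group ?G by (rule exp_semidirect_group)
  define s D where "s = sigma_value (1/2 :: 'k)" and "D = Delta_value (nc_exp (- \<psi>))"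
  define g where "g = (\<lambda>i::nat. if i = 1 then s else inv\<^bsub>?G\<^esub> s \<otimes>\<^bsub>?G\<^esub> D \<otimes>\<^bsub>?G\<^esub> inv\<^bsub>?G\<^esub> s)"
  have sD: "s \<in> carrier ?G" "D \<in> carrier ?G"
    by (simp_all add: s_def D_def sigma_value_mem Delta_value_mem n\<psi>)
  have s': "inv\<^bsub>?G\<^esub> s = sigma_value (- 1/2)"
    using sigma_value_inv[of "1/2 :: 'k"] by (simp add: s_def)
  have "hexagon (nc_exp \<psi>) (nc_exp (- \<psi>))"
    using assms semi_associator_iff[OF \<psi>(1)] \<psi>(3) by simp
  then have rel: "D \<otimes>\<^bsub>?G\<^esub> inv\<^bsub>?G\<^esub> s \<otimes>\<^bsub>?G\<^esub> D = s \<otimes>\<^bsub>?G\<^esub> D \<otimes>\<^bsub>?G\<^esub> s"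
    unfolding s' unfolding D_def s_def using braid_relation_iff_hexagon[OF \<psi>(2)] by blast
  have g12: "g 1 = s" "g 2 = inv\<^bsub>?G\<^esub> s \<otimes>\<^bsub>?G\<^esub> D \<otimes>\<^bsub>?G\<^esub> inv\<^bsub>?G\<^esub> s"
    by (simp_all add: g_def)
  have cancel: "s \<otimes>\<^bsub>?G\<^esub> (inv\<^bsub>?G\<^esub> s \<otimes>\<^bsub>?G\<^esub> x) = x" "inv\<^bsub>?G\<^esub> s \<otimes>\<^bsub>?G\<^esub> (s \<otimes>\<^bsub>?G\<^esub> x) = x"
    if "x \<in> carrier ?G" for x
    using sD(1) that by (simp_all only: G.m_assoc[symmetric] G.inv_closed G.r_inv G.l_inv G.l_one)
  have g121: "g 1 \<otimes>\<^bsub>?G\<^esub> g 2 \<otimes>\<^bsub>?G\<^esub> g 1 = D"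
    unfolding g12 using sD
    by (simp only: G.m_assoc G.m_closed G.inv_closed cancel G.l_inv G.r_one)
  have "g 2 \<otimes>\<^bsub>?G\<^esub> g 1 \<otimes>\<^bsub>?G\<^esub> g 2
      = inv\<^bsub>?G\<^esub> s \<otimes>\<^bsub>?G\<^esub> (D \<otimes>\<^bsub>?G\<^esub> inv\<^bsub>?G\<^esub> s \<otimes>\<^bsub>?G\<^esub> D) \<otimes>\<^bsub>?G\<^esub> inv\<^bsub>?G\<^esub> s"
    unfolding g12 using sD by (simp only: G.m_assoc G.m_closed G.inv_closed cancel)
  also have "\<dots> = D"
    unfolding rel using sD
    by (simp only: G.m_assoc G.m_closed G.inv_closed cancel G.r_inv G.r_one)
  finally have g212: "g 2 \<otimes>\<^bsub>?G\<^esub> g 1 \<otimes>\<^bsub>?G\<^esub> g 2 = D" .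
  interpret R: braid_relations ?G 3 g
  proof (intro braid_relations.intro[OF exp_semidirect_group] braid_relations_axioms.intro)
    fix i :: nat assume i: "i \<in> {1..<3}"
    then have "i = 1 \<or> i = 2" by auto
    then show "g i \<in> carrier ?G" using sD by (auto simp only: g12 G.m_closed G.inv_closed)
    show "g (Suc i) \<otimes>\<^bsub>?G\<^esub> g i \<otimes>\<^bsub>?G\<^esub> g (Suc i) = g i \<otimes>\<^bsub>?G\<^esub> g (Suc i) \<otimes>\<^bsub>?G\<^esub> g i"
      if "Suc i \<in> {1..<3}"
    proof -
      have "i = 1" "Suc i = 2" using i that by auto
      then show ?thesis using g121 g212 by simp
    qed
  qed auto
  define h where "h = (\<lambda>\<beta>. the_elem (R.braid_eval ` \<beta>))"
  have h: "h \<in> hom (braid_group 3) ?G" unfolding h_def by (rule R.braid_eval_hom)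
  define \<rho> where "\<rho> = restrict h (carrier (braid_group 3))"
  have \<rho>: "\<rho> \<in> hom (braid_group 3) ?G" unfolding \<rho>_def by (rule restrict_hom[OF braid_group_group h])
  have rep: "\<rho> \<in> braid_reps 3" unfolding \<rho>_def by (rule braid_repsI[OF h])
  have sigma_mem: "sigma 3 1 \<in> carrier (braid_group 3)" "sigma 3 2 \<in> carrier (braid_group 3)"
    by (auto intro: sigma_closed)
  have \<rho>12: "\<rho> (sigma 3 1) = g 1" "\<rho> (sigma 3 2) = g 2"
    using R.braid_eval_sigma[of 1] R.braid_eval_sigma[of 2] sigma_mem by (simp_all add: \<rho>_def h_def)
  interpret \<rho>: group_hom "braid_group 3" ?G \<rho>
    using \<rho> braid_group_group exp_semidirect_group by (simp add: group_hom_def group_hom_axioms_def)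
  have "\<rho> Delta = D"
    unfolding Delta_def using sigma_mem g121 \<rho>12 \<rho>.hom_mult \<rho>.G.m_closed by metis
  then have param: "parametrizes \<Psi> \<rho>"
    using \<rho>12(1) g12(1) by (simp add: \<psi>(3) parametrizes_iff[OF \<psi>(2)] s_def D_def)
  define u2 where "u2 = gen_exp (- 1/2 :: 'k) 1 2 *
    (gen_sum_exp (1/2) * edge_action 3 (perm3 2 1 3) (letter_emb (nc_exp (- \<psi>)))) * gen_exp (- 1/2) 1 3"
  note series = group_series_intros n\<psi> perm3_permutes
  have u2: "u2 \<in> group_series" unfolding u2_def by (intro series)
  have g2: "g 2 = art_smash u2 (perm3 1 3 2)"
    unfolding g12 s' unfolding D_def u2_def
    by (simp add: art_smash_mult series edge_action_gen_exp edge_action_mult edge_action_gen_sum_exp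
        gen_normalize)
  have linear: "has_linear_part u2 (nc_scale (1/2) (gen 2 3))"
  proof -
    have "has_linear_part (nc_exp (- \<psi>)) (- \<psi>)"
      by (rule has_linear_part_exp[OF free_lie_filt[OF n\<psi>]])
    then have "has_linear_part (nc_exp (- \<psi>)) 0"
      by (rule has_linear_part_shift) (simp add: nc.F_uminus free_lie_gt1_filt[OF \<psi>(1)])
    from has_linear_part_hom[OF letter_emb.filtered_hom_axioms this]
    have "has_linear_part (letter_emb (nc_exp (- \<psi>))) 0" by simp
    from has_linear_part_hom[OF edge_action_hom[of 3 "perm3 2 1 3"] this]
    have "has_linear_part (edge_action 3 (perm3 2 1 3) (letter_emb (nc_exp (- \<psi>)))) 0"
      by (simp add: filtered_hom.hom_zero[OF edge_action_hom])
    then have "has_linear_part u2 (nc_scale (- 1/2) (gen 1 2) + (nc_scale (1/2) gen_sum + 0)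
        + nc_scale (- 1/2) (gen 1 3))"
      unfolding u2_def by (intro has_linear_part_mult has_linear_part_exp nc_scale_filt gen_filt gen_sum_filt)
    also have "nc_scale (- 1/2) (gen 1 2) + (nc_scale (1/2) gen_sum + 0) + nc_scale (- 1/2) (gen 1 3)
        = (nc_scale (1/2) (gen 2 3) :: (nat set, 'k) ncps)"
      by (rule ncps_eqI) (simp add: gen_sum_def field_simps)
    finally show ?thesis .
  qed
  have normalized: "normalized_rep 3 \<rho>"
  proof (rule normalized_repI[OF \<rho>])
    fix i :: nat assume "i \<in> {1..<3}"
    then consider "i = 1" | "i = 2" by fastforce
    then show "\<exists>u\<in>exp_artin_lie 3. \<rho> (sigma 3 i) = smash 3 u (adj_transp i) \<and>
        equiv2 u (artin_class 3 (1 + nc_scale (1/2) (gen i (Suc i))))"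
    proof cases
      case 1
      have "has_linear_part (gen_exp (1/2 :: 'k) 1 2) (nc_scale (1/2) (gen 1 2))"
        by (intro has_linear_part_exp nc_scale_filt gen_filt)
      then show ?thesis
        using group_series_class[OF group_series_gen(1)]
        by (intro bexI[of _ "artin_class 3 (gen_exp (1/2) 1 2)"])
          (auto simp: 1 \<rho>12 g12 s_def adj_transp_perm3 equiv2_linear_part)
    next
      case 2
      then show ?thesis
        using group_series_class[OF u2] linear
        by (intro bexI[of _ "artin_class 3 u2"]) (auto simp: \<rho>12 g2 adj_transp_perm3 equiv2_linear_part)
    qed
  qed
  \<comment> \<open>On two strands the same formula for \<open>\<sigma>\<^sub>1\<close> gives a representation: there are no relations.\<close>
  let ?G2 = "exp_semidirect 2 :: ((nat \<Rightarrow> nat) \<Rightarrow> (nat set, 'k) ncps set) monoid"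
  have gen_2: "nc_scale (1/2) (gen 1 2) \<in> (free_lie (edges 2) :: (nat set, 'k) ncps set)"
    unfolding gen_def by (intro free_lie_scale free_lie_var edgesI) auto
  define u1 where "u1 = artin_class 2 (gen_exp (1/2 :: 'k) 1 2)"
  have u1: "u1 \<in> exp_artin_lie 2" unfolding u1_def by (rule exp_artin_lieI[OF gen_2])
  interpret R2: braid_relations ?G2 2 "\<lambda>i. smash 2 u1 (adj_transp 1)"
    by (intro braid_relations.intro[OF exp_semidirect_group] braid_relations_axioms.intro)
      (auto intro!: exp_groupI u1 adj_transp_permutes)
  define h2 where "h2 = (\<lambda>\<beta>. the_elem (R2.braid_eval ` \<beta>))"
  have h2: "h2 \<in> hom (braid_group 2) ?G2" unfolding h2_def by (rule R2.braid_eval_hom)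
  define \<rho>2 where "\<rho>2 = restrict h2 (carrier (braid_group 2))"
  have \<rho>2: "\<rho>2 \<in> hom (braid_group 2) ?G2" unfolding \<rho>2_def by (rule restrict_hom[OF braid_group_group h2])
  have sigma_2_1: "\<rho>2 (sigma 2 1) = smash 2 u1 (adj_transp 1)"
    using R2.braid_eval_sigma[of 1] sigma_closed[of 1 2] by (simp add: \<rho>2_def h2_def)
  have normalized_2: "normalized_rep 2 \<rho>2"
  proof (rule normalized_repI[OF \<rho>2])
    fix i :: nat assume "i \<in> {1..<2}"
    then have i: "i = 1" by simp
    have "has_linear_part (gen_exp (1/2 :: 'k) 1 2) (nc_scale (1/2) (gen 1 2))"
      by (intro has_linear_part_exp nc_scale_filt gen_filt)
    then show "\<exists>u\<in>exp_artin_lie 2. \<rho>2 (sigma 2 i) = smash 2 u (adj_transp i) \<and>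
        equiv2 u (artin_class 2 (1 + nc_scale (1/2) (gen i (Suc i))))"
      using u1 by (intro bexI[of _ u1]) (auto simp: i sigma_2_1 u1_def equiv2_linear_part)
  qed
  have "(\<rho> \<circ> braid_embed 2) \<beta> = (braid_alg_embed 2 \<circ> \<rho>2) \<beta>" if \<beta>: "\<beta> \<in> carrier (braid_group 2)" for \<beta>
  proof (rule braid_hom_unique[OF exp_semidirect_group _ _ _ \<beta>])
    show "\<rho> \<circ> braid_embed 2 \<in> hom (braid_group 2) ?G"
      using braid_embed_hom[of 2] by (intro hom_compose[OF _ \<rho>]) simp
    show "braid_alg_embed 2 \<circ> \<rho>2 \<in> hom (braid_group 2) ?G"
      using hom_compose[OF \<rho>2 braid_alg_embed_hom] by simp
    fix i :: nat assume "i \<in> {1..<2}"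
    then have i: "i = 1" by simp
    show "(\<rho> \<circ> braid_embed 2) (sigma 2 i) = (braid_alg_embed 2 \<circ> \<rho>2) (sigma 2 i)"
      using braid_embed_sigma[of 1 2] adj_transp_permutes[of 1 2]
      by (simp add: i sigma_2_1 braid_alg_embed_smash u1_def artin_embed_class \<rho>12 g12 s_def adj_transp_perm3)
  qed
  then have "universal_rep \<rho>"
    using rep normalized normalized_2 braid_repsI[OF h2] by (auto simp: universal_rep_def \<rho>2_def[symmetric])
  then show ?thesis using rep param by blast
qed


lemma free_lie_single_letter:
  fixes f :: "('x, 'k::field_char_0) ncps"
  assumes "f \<in> free_lie {x}" shows "f = nc_scale (coeff f [x]) (nc_var x)"
proof (rule ncps_eqI)
  fix w
  have "coeff f w = 0" if "w \<noteq> [x]"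
  proof (cases "set w \<subseteq> {x}")
    case True
    then have w: "w = replicate (length w) x" by (intro replicate_eqI) auto
    then have "length w \<noteq> 1" using that by (auto simp: One_nat_def)
    then show ?thesis
      using nc_primitive_replicate[of f "length w" x] assms w by (simp add: free_lie_def)
  qed (use free_lie_closed(1)[OF assms] in \<open>auto simp: nc_ring_carrier\<close>)
  then show "coeff f w = coeff (nc_scale (coeff f [x]) (nc_var x)) w"
    by (auto simp: coeff_var)
qed

text \<open>
  As \<open>P\<^sub>2\<close> is spanned by \<open>t\<^sub>1\<^sub>2\<close>, the linear part of the value at \<open>\<sigma>\<^sub>1\<close> determines it.
\<close>

lemma universal_rep_sigma_1:
  fixes \<rho> :: "(nat \<times> bool) list set \<Rightarrow> (nat \<Rightarrow> nat) \<Rightarrow> (nat set, 'k::field_char_0) ncps set"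
  assumes "universal_rep \<rho>" shows "\<rho> (sigma 3 1) = sigma_value (1/2)"
proof -
  obtain \<rho>2 :: "(nat \<times> bool) list set \<Rightarrow> (nat \<Rightarrow> nat) \<Rightarrow> (nat set, 'k) ncps set"
    where \<rho>2: "normalized_rep 2 \<rho>2"
      "\<And>\<beta>. \<beta> \<in> carrier (braid_group 2) \<Longrightarrow> \<rho> (braid_embed 2 \<beta>) = braid_alg_embed 2 (\<rho>2 \<beta>)"
    using assms unfolding universal_rep_def by blast
  have i: "(1::nat) \<in> {1..<2}" by simp
  obtain u where u: "u \<in> exp_artin_lie 2" "\<rho>2 (sigma 2 1) = smash 2 u (adj_transp 1)"
    "equiv2 u (artin_class 2 (1 + nc_scale (1/2) (gen 1 (Suc 1))))"
    using \<rho>2(1) i unfolding normalized_rep_def by blast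
  obtain f where f: "f \<in> free_lie (edges 2)" "u = artin_class 2 (nc_exp f)"
    using u(1) by (rule exp_artin_lieE)
  have edges_2: "edges 2 = {{1, 2}}"
  proof
    show "edges 2 \<subseteq> {{1, 2}}"
    proof
      fix e assume "e \<in> edges 2"
      then obtain i j :: nat where e: "e = {i, j}" "i \<in> {1..2}" "j \<in> {1..2}" "i \<noteq> j"
        unfolding edges_def by blast
      then have "i \<in> {1, 2}" "j \<in> {1, 2}" by auto
      then show "e \<in> {{1, 2}}" using e(1,4) by auto
    qed
  qed (auto intro!: edgesI)
  have "has_linear_part (nc_exp f) (nc_scale (1/2) (gen 1 2))"
    using u(3) unfolding f(2) by (simp add: equiv2_linear_part)
  from has_linear_part_unique[OF has_linear_part_exp[OF free_lie_filt[OF f(1)]] this]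
  have "coeff f [{1, 2}] = 1/2"
    by (simp add: nc_filt_def gen_def coeff_var)
  then have "f = nc_scale (1/2) (gen 1 2)"
    using free_lie_single_letter[OF f(1)[unfolded edges_2]] by (simp only: gen_def)
  then have "\<rho> (braid_embed 2 (sigma 2 1)) = art_smash (gen_exp (1/2) 1 2) (adj_transp 1)"
    using \<rho>2(2)[OF sigma_closed[OF i]] adj_transp_permutes[OF i]
    by (simp add: u(2) f(2) braid_alg_embed_smash artin_embed_class)
  then show ?thesis
    using braid_embed_sigma[OF i] by (simp add: adj_transp_perm3)
qed

text \<open>
  The value at \<open>\<Delta>\<close> is the exponential of a Lie series with linear part \<open>T\<close>.  By \<open>art_of_lie\<close> it
  splits into \<open>exp T\<close> and an exponential from the free subalgebra.
\<close>

lemma universal_rep_Delta: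
  fixes \<rho> :: "(nat \<times> bool) list set \<Rightarrow> (nat \<Rightarrow> nat) \<Rightarrow> (nat set, 'k::field_char_0) ncps set"
  assumes "universal_rep \<rho>"
  obtains \<psi> where "\<psi> \<in> free_lie_gt1 UNIV" "\<rho> Delta = Delta_value (nc_exp (- \<psi>))"
proof -
  have \<rho>: "\<rho> \<in> hom (braid_group 3) (braid_alg 3)" "normalized_rep 3 \<rho>"
    using assms unfolding universal_rep_def braid_reps_def by blast+
  have i: "(2::nat) \<in> {1..<3}" by simp
  obtain u where u: "u \<in> exp_artin_lie 3" "\<rho> (sigma 3 2) = smash 3 u (adj_transp 2)"
    "equiv2 u (artin_class 3 (1 + nc_scale (1/2) (gen 2 (Suc 2))))"
    using \<rho>(2) i unfolding normalized_rep_def by blast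
  obtain f where f: "f \<in> free_lie (edges 3)" "u = artin_class 3 (nc_exp f)"
    using u(1) by (rule exp_artin_lieE)
  have lin_f: "has_linear_part (nc_exp f) (nc_scale (1/2) (gen 2 3))"
    using u(3) unfolding f(2) by (simp add: equiv2_linear_part)
  have fG: "nc_exp f \<in> group_series" by (rule imageI[OF f(1)])
  let ?H = "gen_exp (1/2) 1 2 * edge_action 3 (perm3 2 1 3) (nc_exp f) * gen_exp (1/2) 2 3"
  have HG: "?H \<in> group_series"
    by (intro group_series_mult group_series_gen group_series_act fG perm3_permutes)
  then obtain h where h: "h \<in> free_lie (edges 3)" "?H = nc_exp h" by blast
  have sC: "sigma 3 1 \<in> carrier (braid_group 3)" "sigma 3 2 \<in> carrier (braid_group 3)"
    by (auto intro: sigma_closed)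
  have "\<rho> Delta = \<rho> (sigma 3 1) \<otimes>\<^bsub>braid_alg 3\<^esub> \<rho> (sigma 3 2) \<otimes>\<^bsub>braid_alg 3\<^esub> \<rho> (sigma 3 1)"
    unfolding Delta_def
    by (simp only: hom_mult[OF \<rho>(1)] sC monoid.m_closed[OF group.is_monoid[OF braid_group_group]])
  also have "\<dots> = sigma_value (1/2) \<otimes>\<^bsub>braid_alg 3\<^esub> art_smash (nc_exp f) (perm3 1 3 2)
      \<otimes>\<^bsub>braid_alg 3\<^esub> sigma_value (1/2)"
    by (simp only: universal_rep_sigma_1[OF assms] u(2) f(2) adj_transp_perm3)
  also have "\<dots> = art_smash ?H (perm3 3 2 1)"
    by (simp add: art_smash_mult group_series_mult group_series_gen group_series_act fG
        edge_action_gen_exp gen_normalize)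
  finally have Delta: "\<rho> Delta = art_smash (nc_exp h) (perm3 3 2 1)" by (simp only: h(2))
  have "has_linear_part (edge_action 3 (perm3 2 1 3) (nc_exp f)) (nc_scale (1/2) (gen 1 3))"
    using has_linear_part_hom[OF edge_action_hom[of 3 "perm3 2 1 3"] lin_f]
    by (simp add: edge_action_scale edge_action_gen)
  then have "has_linear_part ?H (nc_scale (1/2) (gen 1 2) + nc_scale (1/2) (gen 1 3) + nc_scale (1/2) (gen 2 3))"
    by (intro has_linear_part_mult has_linear_part_exp nc_scale_filt gen_filt)
  also have "nc_scale (1/2) (gen 1 2) + nc_scale (1/2) (gen 1 3) + nc_scale (1/2) (gen 2 3)
      = (nc_scale (1/2) gen_sum :: (nat set, 'k) ncps)"
    by (rule ncps_eqI) (simp add: gen_sum_def algebra_simps)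
  finally have lin_h: "h - nc_scale (1/2) gen_sum \<in> nc_filt 2"
    unfolding h(2) by (rule has_linear_part_unique[OF has_linear_part_exp[OF free_lie_filt[OF h(1)]]])
  define \<psi> where "\<psi> = - letter_retract h"
  have n\<psi>: "letter_retract h \<in> free_lie UNIV"
    unfolding letter_retract_def by (rule free_lie_subst[OF finite_edges edge_letter_lie h(1)])
  have "letter_retract gen_sum = (0 :: (letter, 'k) ncps)"
    by (simp add: gen_sum_def letter_retract.hom_add letter_retract_gen)
  then have "letter_retract (nc_scale (1/2) gen_sum) = (0 :: (letter, 'k) ncps)"
    unfolding const_mult[of "1/2" gen_sum, symmetric] letter_retract.hom_mult by simp
  then have "letter_retract h \<in> nc_filt 2"
    using letter_retract.hom_F[OF lin_h] by (simp add: letter_retract.hom_diff)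
  then have "\<psi> \<in> nc_filt 2" unfolding \<psi>_def by (rule nc.F_uminus)
  then have \<psi>: "\<psi> \<in> free_lie_gt1 UNIV"
    using free_lie_uminus[OF n\<psi>] by (simp add: free_lie_gt1_def \<psi>_def nc_filt_def)
  have "coeff h [{1, 3}] = 1/2"
    using lin_h by (simp add: nc_filt_def gen_sum_def gen_def coeff_var doubleton_eq_iff)
  then have split: "art_of h = art_letter (- \<psi>) + art_of (nc_scale (1/2) gen_sum)"
    using art_of_lie[OF h(1)] by (simp only: \<psi>_def minus_minus)
  have n\<psi>1: "- \<psi> \<in> nc_filt 1" unfolding \<psi>_def using free_lie_filt[OF n\<psi>] by simp
  have "art.is_exp (art_of (nc_scale (1/2) gen_sum) + art_letter (- \<psi>))
      (art_of (gen_sum_exp (1/2)) * art_letter (nc_exp (- \<psi>)))"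
    by (intro art.is_exp_add art_gen_sum_scale_commute art_filtI art_letter.hom_F art_of_exp
        art_letter.hom_is_exp nc_exp_is_exp n\<psi>1 nc_scale_filt gen_sum_filt)
  moreover have "art.is_exp (art_of (nc_scale (1/2) gen_sum) + art_letter (- \<psi>)) (art_of (nc_exp h))"
    using art_of_exp[OF free_lie_filt[OF h(1)]] by (simp only: split add.commute)
  ultimately have "art_of (nc_exp h) = art_of (gen_sum_exp (1/2)) * art_letter (nc_exp (- \<psi>))"
    by (rule art.is_exp_unique[rotated])
  then have "art_of (nc_exp h) = art_of (gen_sum_exp (1/2) * letter_emb (nc_exp (- \<psi>)))"
    by (simp only: art_of_mult art_letter_def)
  then have "\<rho> Delta = Delta_value (nc_exp (- \<psi>))"
    unfolding Delta
    using art_smash_eq_iff[OF free_lie_closed(2)[OF h(1)] nc_ring_mult_closed[OF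
        group_series_closed[OF group_series_gen(4)] letter_emb_closed] perm3_permutes(5)] by blast
  then show ?thesis using \<psi> that by blast
qed

text \<open>
  A series that commutes with a letter \<open>a\<close> is a series in \<open>a\<close> alone: comparing the coefficients of
  \<open>a G\<close> and \<open>G a\<close>, final letters \<open>a\<close> are moved to the front of a word until it ends in another
  letter, and then its coefficient vanishes.  If moreover \<open>G\<close> is group-like without linear part, it
  is \<open>1\<close>, by the divided-power coproduct in one letter.
\<close>

lemma commute_letter_coeff:
  fixes G :: "('x, 'k::field_char_0) ncps"
  assumes "nc_var a * G = G * nc_var a" "b \<noteq> a"
  shows "coeff G (v @ b # replicate n a) = 0"
proof (induction n arbitrary: v)
  case 0
  have "coeff G (v @ [b]) = coeff (nc_var a * G) ((a # v) @ [b])" by (simp add: coeff_var_mult)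
  also have "\<dots> = 0" unfolding assms(1) coeff_mult_var using assms(2) by simp
  finally show ?case by simp
next
  case (Suc n)
  have "coeff G (v @ b # replicate (Suc n) a) = coeff (nc_var a * G) (a # v @ b # replicate (Suc n) a)"
    by (simp add: coeff_var_mult)
  also have "a # v @ b # replicate (Suc n) a = ((a # v) @ b # replicate n a) @ [a]"
    by (simp add: replicate_append_same)
  also have "coeff (nc_var a * G) \<dots> = coeff G ((a # v) @ b # replicate n a)"
    unfolding assms(1) coeff_mult_var by simp
  also have "\<dots> = 0" by (rule Suc)
  finally show ?case .
qed

lemma grouplike_commute_letter:
  fixes g :: "('x, 'k::field_char_0) ncps"
  assumes g: "nc_primitive g" "coeff g [a] = 0" and comm: "nc_var a * nc_exp g = nc_exp g * nc_var a"
  shows "nc_exp g = 1"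
proof (rule ncps_eqI)
  fix w
  show "coeff (nc_exp g) w = coeff 1 w"
  proof (cases "set w \<subseteq> {a}")
    case True
    then have w: "w = replicate (length w) a" by (intro replicate_eqI) auto
    show ?thesis
    proof (cases "w = []")
      case False
      then show ?thesis
        using nc_exp_primitive_replicate[OF g, of "length w"] w by (simp add: coeff_one)
    qed (simp add: coeff_exp_Nil coeff_one)
  next
    case False
    then have "\<exists>x\<in>set w. x \<noteq> a" by blast
    then obtain v b u where w: "w = v @ b # u" "b \<noteq> a" "\<forall>x\<in>set u. \<not> x \<noteq> a"
      by (rule split_list_last_propE)
    have "u = replicate (length u) a" using w(3) by (intro replicate_eqI) auto
    then have "coeff (nc_exp g) w = 0"
      unfolding w(1) using commute_letter_coeff[OF comm w(2)] by metis
    then show ?thesis using w(1) by (simp add: coeff_one)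
  qed
qed

lemma central_commute_cancel:
  fixes t t' x y h :: "'a::ring_1"
  assumes t: "\<And>z. t * z = z * t" "t' * t = 1"
    and eq: "t * x * (t * y) * h = h * (t * x * (t * y))"
  shows "x * y * h = h * (x * y)"
proof -
  have "t * x * (t * y) = t * (x * t) * y" by (simp only: mult.assoc)
  then have xy: "t * x * (t * y) = t * (t * (x * y))" unfolding t(1)[of x, symmetric] by (simp only: mult.assoc)
  have "h * (t * (t * (x * y))) = t * (h * (t * (x * y)))" by (metis mult.assoc t(1))
  also have "\<dots> = t * (t * (h * (x * y)))" by (metis mult.assoc t(1))
  finally have "t * (t * (x * y * h)) = t * (t * (h * (x * y)))"
    using eq unfolding xy by (simp only: mult.assoc)
  then have "t' * (t' * (t * (t * (x * y * h)))) = t' * (t' * (t * (t * (h * (x * y)))))" by (rule arg_cong)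
  moreover have "t' * (t' * (t * (t * z))) = z" for z
  proof -
    have "t' * (t' * (t * (t * z))) = t' * ((t' * t) * (t * z))" by (simp only: mult.assoc)
    also have "\<dots> = z" by (simp only: t(2) mult_1_left mult.assoc[symmetric])
    finally show ?thesis .
  qed
  ultimately show ?thesis by (simp only:)
qed

lemma (in group) square_commute:
  assumes s: "s \<in> carrier G" and D: "D \<in> carrier G" and rel: "D \<otimes> inv s \<otimes> D = s \<otimes> D \<otimes> s"
  shows "D \<otimes> D \<otimes> s = s \<otimes> D \<otimes> D"
proof -
  have cancel: "s \<otimes> (inv s \<otimes> x) = x" "inv s \<otimes> (s \<otimes> x) = x" if "x \<in> carrier G" for x
    using s that by (simp_all add: m_assoc[symmetric])
  have "s \<otimes> D \<otimes> D = (s \<otimes> D \<otimes> s) \<otimes> (inv s \<otimes> D)"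
    using s D by (simp add: m_assoc cancel)
  also have "\<dots> = D \<otimes> inv s \<otimes> (D \<otimes> inv s \<otimes> D)"
    unfolding rel[symmetric] using s D by (simp add: m_assoc)
  also have "\<dots> = D \<otimes> D \<otimes> s"
    unfolding rel using s D by (simp add: m_assoc cancel)
  finally show ?thesis by simp
qed

text \<open>
  The square of \<open>\<Delta>\<close> commutes with \<open>\<sigma>\<^sub>1\<close>, hence its value \<open>exp(2T) \<Psi>\<^sup>-\<^sup>1 \<cdot> \<^sup>3\<^sup>2\<^sup>1\<Psi>\<^sup>-\<^sup>1\<close> commutes with \<open>exp t\<^sub>1\<^sub>2\<close>.  This
  forces (AS).
\<close>

lemma braid_relation_AS:
  fixes \<psi> :: "(letter, 'k::field_char_0) ncps"
  assumes \<psi>: "\<psi> \<in> free_lie_gt1 UNIV"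
  defines "D \<equiv> Delta_value (nc_exp (- \<psi>))"
  assumes rel: "D \<otimes>\<^bsub>exp_semidirect 3\<^esub> sigma_value (- 1/2) \<otimes>\<^bsub>exp_semidirect 3\<^esub> D
      = sigma_value (1/2) \<otimes>\<^bsub>exp_semidirect 3\<^esub> D \<otimes>\<^bsub>exp_semidirect 3\<^esub> sigma_value (1/2)"
  shows "nc_swap (nc_exp \<psi>) = nc_exp (- \<psi>)"
proof -
  have \<psi>L: "\<psi> \<in> free_lie UNIV" using \<psi> by (simp add: free_lie_gt1_def)
  have n\<psi>: "- \<psi> \<in> free_lie UNIV" by (rule free_lie_uminus[OF \<psi>L])
  let ?G = "exp_semidirect 3 :: ((nat \<Rightarrow> nat) \<Rightarrow> (nat set, 'k) ncps set) monoid"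
  interpret G: group ?G by (rule exp_semidirect_group)
  interpret swap: filtered_hom nc_filt nc_const nc_filt
    "nc_const :: 'k \<Rightarrow> (letter, 'k) ncps" nc_swap by (rule letter_swap_hom)
  let ?s = "sigma_value (1/2 :: 'k)"
  let ?T = "gen_sum_exp (1/2) :: (nat set, 'k) ncps"
  define \<Psi>' where "\<Psi>' = nc_exp (- \<psi>)"
  let ?e = "letter_emb \<Psi>'" and ?e2 = "letter_emb (nc_swap \<Psi>')"
  let ?h = "gen_exp (1/2 :: 'k) 1 2"
  have s: "?s \<in> carrier ?G" and D: "D \<in> carrier ?G"
    by (simp_all only: D_def exp_semidirect_simps sigma_value_mem Delta_value_mem[OF n\<psi>])
  have "inv\<^bsub>?G\<^esub> ?s = sigma_value (- 1/2)" using sigma_value_inv[of "1/2 :: 'k"] by simp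
  then have "D \<otimes>\<^bsub>?G\<^esub> D \<otimes>\<^bsub>?G\<^esub> ?s = ?s \<otimes>\<^bsub>?G\<^esub> D \<otimes>\<^bsub>?G\<^esub> D"
    using rel by (intro G.square_commute[OF s D]) simp
  then have comm: "D \<otimes>\<^bsub>?G\<^esub> D \<otimes>\<^bsub>?G\<^esub> (?s \<otimes>\<^bsub>?G\<^esub> ?s) = ?s \<otimes>\<^bsub>?G\<^esub> ?s \<otimes>\<^bsub>?G\<^esub> (D \<otimes>\<^bsub>?G\<^esub> D)"
    using s D by (metis G.m_assoc G.m_closed)
  have e: "?e \<in> group_series" unfolding \<Psi>'_def by (rule group_series_letter[OF n\<psi>])
  have e2: "edge_action 3 (perm3 3 2 1) ?e = ?e2" by (simp only: letter_emb_swap)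
  have e2G: "?e2 \<in> group_series"
    unfolding letter_emb_swap by (rule group_series_act[OF e]) simp
  note series = group_series_mult group_series_gen e e2G
  have DD: "D \<otimes>\<^bsub>braid_alg 3\<^esub> D = art_smash (?T * ?e * (?T * ?e2)) id"
    unfolding D_def \<Psi>'_def[symmetric]
    by (simp add: art_smash_mult series edge_action_mult edge_action_gen_sum_exp e2 perm3_id)
  have ss: "?s \<otimes>\<^bsub>braid_alg 3\<^esub> ?s = art_smash (?h * ?h) id"
    by (simp add: art_smash_mult series edge_action_gen_exp gen_normalize perm3_id)
  let ?l = "?T * ?e * (?T * ?e2) * (?h * ?h)" and ?r = "?h * ?h * (?T * ?e * (?T * ?e2))"
  have "art_smash ?l id = art_smash ?r id"
    using comm group_series_closed[OF group_series_gen(1)]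
    by (simp add: DD ss art_smash_mult series permutes_id edge_action_id
        nc_ring_mult_closed group_series_closed letter_emb_closed group_series_closed[OF group_series_gen(4)])
  moreover have "?l \<in> group_series" "?r \<in> group_series" by (intro series)+
  ultimately have eq: "art_of ?l = art_of ?r"
    using art_smash_eq_iff[OF group_series_closed group_series_closed permutes_id] by blast
  \<comment> \<open>After cancelling the central factors the equation lives in the free algebra.\<close>
  define A where "A = (nc_var LA :: (letter, 'k) ncps)"
  define a where "a = nc_exp (nc_scale (1/2) A)"
  define G where "G = \<Psi>' * nc_swap \<Psi>'"
  have A1: "nc_scale (1/2) A \<in> nc_filt 1" by (simp add: A_def One_nat_def)
  have ha: "art_of ?h = art_letter a"
  proof -
    have "letter_emb (nc_const (1/2) * A) = nc_const (1/2) * gen 1 2"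
      unfolding letter_emb.hom_mult letter_emb.hom_sc
      by (simp only: A_def letter_emb_var letter_gen_def letter.case)
    then show ?thesis by (simp add: art_letter_def a_def letter_emb_exp[OF A1] const_mult)
  qed
  have G_comm: "G * (a * a) = a * a * G"
  proof -
    have "art_letter \<Psi>' * art_letter (nc_swap \<Psi>') * (art_letter a * art_letter a)
        = art_letter a * art_letter a * (art_letter \<Psi>' * art_letter (nc_swap \<Psi>'))"
      using eq unfolding art_of_mult ha art_letter_def[symmetric]
      by (rule central_commute_cancel[OF art_gen_sum_exp_commute art_gen_exp_inverse(4)])
    then have "art_letter (G * (a * a)) = art_letter (a * a * G)"
      by (simp only: art_letter.hom_mult G_def)
    then show ?thesis by (simp only: art_letter_inject)
  qed
  have n\<psi>1: "- \<psi> \<in> nc_filt 1" by (rule free_lie_filt[OF n\<psi>])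
  have swap_lie: "nc_swap (- \<psi>) \<in> free_lie UNIV"
    unfolding nc_swap_def
    by (rule free_lie_subst[OF finite_UNIV _ n\<psi>]) (simp split: letter.split add: free_lie_var)
  have swap_exp: "nc_swap \<Psi>' = nc_exp (nc_swap (- \<psi>))"
    unfolding \<Psi>'_def
    using nc_exp_eqI[OF swap.hom_F[OF n\<psi>1] swap.hom_is_exp[OF nc_exp_is_exp[OF n\<psi>1]]] by simp
  obtain g where g: "g \<in> free_lie UNIV" "nc_exp g = G"
    unfolding G_def swap_exp unfolding \<Psi>'_def using free_lie_exp_mult[OF n\<psi> swap_lie] .
  have "has_linear_part \<Psi>' 0"
    unfolding \<Psi>'_def
    by (rule has_linear_part_shift[OF has_linear_part_exp[OF n\<psi>1]])
      (simp add: nc.F_uminus free_lie_gt1_filt[OF \<psi>])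
  from has_linear_part_mult[OF this has_linear_part_hom[OF letter_swap_hom this]]
  have "has_linear_part (nc_exp g) 0" by (simp add: g(2) G_def)
  from has_linear_part_unique[OF has_linear_part_exp[OF free_lie_filt[OF g(1)]] this]
  have gA: "coeff g [LA] = 0" by (simp add: nc_filt_def)
  have G_inverse: "G * nc_exp (- g) = 1" "nc_exp (- g) * G = 1"
    using nc_exp_uminus[OF free_lie_filt[OF g(1)]] by (simp_all add: g(2))
  have AF: "A \<in> nc_filt 1" by (simp add: A_def One_nat_def)
  \<comment> \<open>Conjugation by \<open>G\<close> fixes \<open>exp A\<close>, hence fixes \<open>A\<close>, the exponential being injective.\<close>
  have "nc.is_exp (nc_scale (1/2) A + nc_scale (1/2) A) (a * a)"
    unfolding a_def by (intro nc.is_exp_add nc_exp_is_exp A1 HOL.refl)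
  also have "nc_scale (1/2) A + nc_scale (1/2) A = A" by (rule ncps_eqI) simp
  finally have expA: "nc.is_exp A (a * a)" .
  have "G * (a * a) * nc_exp (- g) = a * a * (G * nc_exp (- g))"
    unfolding G_comm by (simp only: mult.assoc)
  then have "nc.is_exp (G * A * nc_exp (- g)) (a * a)"
    using nc.is_exp_conjugate[OF G_inverse expA] by (simp add: G_inverse)
  then have "G * A * nc_exp (- g) = A"
    using nc.is_exp_inject[OF nc.F_mult_right[OF nc.F_mult_left[OF AF]] AF _ expA] by blast
  then have "G * A * (nc_exp (- g) * G) = A * G" by (simp only: mult.assoc[symmetric])
  then have "nc_var LA * nc_exp g = nc_exp g * nc_var LA"
    using G_inverse(2) by (simp add: g(2) A_def)
  then have "nc_exp g = 1"
    using g(1) gA by (intro grouplike_commute_letter) (auto simp: free_lie_def)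
  then have "\<Psi>' * nc_swap \<Psi>' = 1" by (simp add: g(2) G_def)
  moreover have "nc_swap \<Psi>' * nc_swap (nc_exp \<psi>) = 1"
    using nc_exp_uminus(2)[OF free_lie_filt[OF \<psi>L]] unfolding \<Psi>'_def
    by (metis swap.hom_mult swap.hom_one)
  ultimately show ?thesis using ring_inverse_unique unfolding \<Psi>'_def by metis
qed

text \<open>
  The relation \<open>\<Delta> \<sigma>\<^sub>1\<^sup>-\<^sup>1 \<Delta> = \<sigma>\<^sub>1 \<Delta> \<sigma>\<^sub>1\<close> in \<open>B\<^sub>3\<close> yields (AS) and the hexagon for the series read off from
  the value at \<open>\<Delta>\<close>.
\<close>

lemma universal_rep_semi_associator:
  fixes \<rho> :: "(nat \<times> bool) list set \<Rightarrow> (nat \<Rightarrow> nat) \<Rightarrow> (nat set, 'k::field_char_0) ncps set"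
  assumes "universal_rep \<rho>"
  shows "\<exists>\<Psi>. semi_associator \<Psi> \<and> parametrizes \<Psi> \<rho>"
proof -
  obtain \<psi> where \<psi>: "\<psi> \<in> free_lie_gt1 UNIV" "\<rho> Delta = Delta_value (nc_exp (- \<psi>))"
    using assms by (rule universal_rep_Delta)
  have \<psi>L: "\<psi> \<in> free_lie UNIV" using \<psi>(1) by (simp add: free_lie_gt1_def)
  have s: "\<rho> (sigma 3 1) = sigma_value (1/2)" by (rule universal_rep_sigma_1[OF assms])
  have "\<rho> \<in> hom (braid_group 3) (braid_alg 3)"
    using assms unfolding universal_rep_def braid_reps_def by blast
  then have hom: "\<rho> \<in> hom (braid_group 3) (exp_semidirect 3)"
    by (rule braid_rep_exp_hom)
      (simp_all only: s \<psi>(2) sigma_value_mem Delta_value_mem[OF free_lie_uminus[OF \<psi>L]])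
  interpret r: group_hom "braid_group 3" "exp_semidirect 3" \<rho>
    by (intro group_hom.intro group_hom_axioms.intro braid_group_group exp_semidirect_group hom)
  let ?B = "braid_group 3"
  have sC: "sigma 3 1 \<in> carrier ?B" "sigma 3 2 \<in> carrier ?B" by (auto intro: sigma_closed)
  have "braid_eq 3 [(Suc 1, True), (1, True), (Suc 1, True)] [(1, True), (Suc 1, True), (1, True)]"
    by (rule braid_eq.braid) auto
  then have braid: "sigma 3 2 \<otimes>\<^bsub>?B\<^esub> sigma 3 1 \<otimes>\<^bsub>?B\<^esub> sigma 3 2 = Delta"
    unfolding Delta_def sigma_def by (simp add: braid_class_mult braid_class_eq_iff)
  have cancel: "sigma 3 1 \<otimes>\<^bsub>?B\<^esub> (inv\<^bsub>?B\<^esub> (sigma 3 1) \<otimes>\<^bsub>?B\<^esub> x) = x" if "x \<in> carrier ?B" for x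
    using sC that by (simp add: r.G.m_assoc[symmetric])
  have "Delta \<otimes>\<^bsub>?B\<^esub> inv\<^bsub>?B\<^esub> (sigma 3 1) \<otimes>\<^bsub>?B\<^esub> Delta
      = sigma 3 1 \<otimes>\<^bsub>?B\<^esub> (sigma 3 2 \<otimes>\<^bsub>?B\<^esub> sigma 3 1 \<otimes>\<^bsub>?B\<^esub> sigma 3 2) \<otimes>\<^bsub>?B\<^esub> sigma 3 1"
    unfolding Delta_def using sC by (simp add: r.G.m_assoc cancel)
  then have "Delta \<otimes>\<^bsub>?B\<^esub> inv\<^bsub>?B\<^esub> (sigma 3 1) \<otimes>\<^bsub>?B\<^esub> Delta = sigma 3 1 \<otimes>\<^bsub>?B\<^esub> Delta \<otimes>\<^bsub>?B\<^esub> sigma 3 1"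
    unfolding braid .
  then have "\<rho> (Delta \<otimes>\<^bsub>?B\<^esub> inv\<^bsub>?B\<^esub> (sigma 3 1) \<otimes>\<^bsub>?B\<^esub> Delta) = \<rho> (sigma 3 1 \<otimes>\<^bsub>?B\<^esub> Delta \<otimes>\<^bsub>?B\<^esub> sigma 3 1)"
    by (rule arg_cong)
  then have "Delta_value (nc_exp (- \<psi>)) \<otimes>\<^bsub>exp_semidirect 3\<^esub> inv\<^bsub>exp_semidirect 3\<^esub> (sigma_value (1/2))
        \<otimes>\<^bsub>exp_semidirect 3\<^esub> Delta_value (nc_exp (- \<psi>))
      = sigma_value (1/2) \<otimes>\<^bsub>exp_semidirect 3\<^esub> Delta_value (nc_exp (- \<psi>)) \<otimes>\<^bsub>exp_semidirect 3\<^esub> sigma_value (1/2)"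
    by (simp only: r.hom_mult r.hom_inv r.G.m_closed r.G.inv_closed sC Delta_closed s \<psi>(2))
  moreover have "inv\<^bsub>exp_semidirect 3\<^esub> (sigma_value (1/2 :: 'k)) = sigma_value (- 1/2)"
    using sigma_value_inv[of "1/2 :: 'k"] by simp
  ultimately have rel: "Delta_value (nc_exp (- \<psi>)) \<otimes>\<^bsub>exp_semidirect 3\<^esub> sigma_value (- 1/2)
        \<otimes>\<^bsub>exp_semidirect 3\<^esub> Delta_value (nc_exp (- \<psi>))
      = sigma_value (1/2) \<otimes>\<^bsub>exp_semidirect 3\<^esub> Delta_value (nc_exp (- \<psi>)) \<otimes>\<^bsub>exp_semidirect 3\<^esub> sigma_value (1/2)"
    by (simp only:)
  have "semi_associator (nc_exp \<psi>)"
    using semi_associator_iff[OF \<psi>(1)] braid_relation_AS[OF \<psi>(1) rel]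
      braid_relation_iff_hexagon[OF \<psi>L] rel by blast
  moreover have "parametrizes (nc_exp \<psi>) \<rho>"
    using s \<psi>(2) by (simp only: parametrizes_iff[OF \<psi>L])
  ultimately show ?thesis by blast
qed

theorem theorem1p1:
  shows "(\<forall>\<Psi> :: (letter, 'k::field_char_0) ncps. semi_associator \<Psi> \<longrightarrow>
            (\<exists>!\<rho>. \<rho> \<in> braid_reps 3 \<and> parametrizes \<Psi> \<rho>) \<and>
            (\<forall>\<rho>. \<rho> \<in> braid_reps 3 \<and> parametrizes \<Psi> \<rho> \<longrightarrow> universal_rep \<rho>)) \<and>
         (\<forall>\<rho> :: (nat \<times> bool) list set \<Rightarrow> (nat \<Rightarrow> nat) \<Rightarrow> (nat set, 'k) ncps set.
            universal_rep \<rho> \<longrightarrow>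
            (\<exists>!\<Psi>. semi_associator \<Psi> \<and> parametrizes \<Psi> \<rho>)) \<and>
         bij_betw
           (\<lambda>\<Psi> :: (letter, 'k) ncps. THE \<rho>. \<rho> \<in> braid_reps 3 \<and> parametrizes \<Psi> \<rho>)
           {\<Psi>. semi_associator \<Psi>} {\<rho>. universal_rep \<rho>}"
proof -
  define param :: "(letter, 'k) ncps \<Rightarrow> ((nat \<times> bool) list set \<Rightarrow> (nat \<Rightarrow> nat) \<Rightarrow> (nat set, 'k) ncps set) \<Rightarrow> bool"
    where "param \<Psi> \<rho> \<longleftrightarrow> \<rho> \<in> braid_reps 3 \<and> parametrizes \<Psi> \<rho>" for \<Psi> \<rho>
  have unique: "\<exists>!\<rho>. param \<Psi> \<rho>" and universal: "param \<Psi> \<rho> \<Longrightarrow> universal_rep \<rho>"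
    if \<Psi>: "semi_associator \<Psi>" for \<Psi> \<rho>
  proof -
    obtain \<rho>0 where \<rho>0: "param \<Psi> \<rho>0" "universal_rep \<rho>0"
      using semi_associator_rep[OF \<Psi>] unfolding param_def by blast
    have eq: "\<rho> = \<rho>0" if "param \<Psi> \<rho>" for \<rho>
      using parametrized_rep_unique[OF \<Psi>] that \<rho>0(1) unfolding param_def by blast
    show "\<exists>!\<rho>. param \<Psi> \<rho>" using \<rho>0(1) eq by blast
    show "param \<Psi> \<rho> \<Longrightarrow> universal_rep \<rho>" using eq \<rho>0(2) by blast
  qed
  have series: "\<exists>!\<Psi>. semi_associator \<Psi> \<and> parametrizes \<Psi> \<rho>" if "universal_rep \<rho>" for \<rho> :: "_ \<Rightarrow> _ \<Rightarrow> (nat set, 'k) ncps set"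
    using universal_rep_semi_associator[OF that] parametrizing_series_unique by blast
  have the_rep: "param \<Psi> (THE \<rho>. param \<Psi> \<rho>)" if "semi_associator \<Psi>" for \<Psi>
    by (rule theI'[OF unique[OF that]])
  have "bij_betw (\<lambda>\<Psi>. THE \<rho>. param \<Psi> \<rho>) {\<Psi>. semi_associator \<Psi>} {\<rho>. universal_rep \<rho>}"
    unfolding bij_betw_def
  proof
    show "inj_on (\<lambda>\<Psi>. THE \<rho>. param \<Psi> \<rho>) {\<Psi>. semi_associator \<Psi>}"
    proof (rule inj_onI)
      fix \<Psi> \<Phi> assume sa: "\<Psi> \<in> {\<Psi>. semi_associator \<Psi>}" "\<Phi> \<in> {\<Psi>. semi_associator \<Psi>}"
        and eq: "(THE \<rho>. param \<Psi> \<rho>) = (THE \<rho>. param \<Phi> \<rho>)"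
      from sa eq have "param \<Psi> (THE \<rho>. param \<Psi> \<rho>)" "param \<Phi> (THE \<rho>. param \<Psi> \<rho>)"
        using the_rep[of \<Psi>] the_rep[of \<Phi>] by simp_all
      then show "\<Psi> = \<Phi>"
        using sa parametrizing_series_unique unfolding param_def by blast
    qed
    show "(\<lambda>\<Psi>. THE \<rho>. param \<Psi> \<rho>) ` {\<Psi>. semi_associator \<Psi>} = {\<rho>. universal_rep \<rho>}"
    proof
      show "(\<lambda>\<Psi>. THE \<rho>. param \<Psi> \<rho>) ` {\<Psi>. semi_associator \<Psi>} \<subseteq> {\<rho>. universal_rep \<rho>}"
        using the_rep universal by blast
      show "{\<rho>. universal_rep \<rho>} \<subseteq> (\<lambda>\<Psi>. THE \<rho>. param \<Psi> \<rho>) ` {\<Psi>. semi_associator \<Psi>}"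
      proof
        fix \<rho> :: "_ \<Rightarrow> _ \<Rightarrow> (nat set, 'k) ncps set" assume \<rho>: "\<rho> \<in> {\<rho>. universal_rep \<rho>}"
        then obtain \<Psi> where \<Psi>: "semi_associator \<Psi>" "parametrizes \<Psi> \<rho>" using series by blast
        then have "param \<Psi> \<rho>" using \<rho> by (simp add: param_def universal_rep_def)
        then have "\<rho> = (THE \<rho>. param \<Psi> \<rho>)" using unique[OF \<Psi>(1)] the_rep[OF \<Psi>(1)] by blast
        then show "\<rho> \<in> (\<lambda>\<Psi>. THE \<rho>. param \<Psi> \<rho>) ` {\<Psi>. semi_associator \<Psi>}" using \<Psi>(1) by blast
      qed
    qed
  qed
  then show ?thesis
    using unique universal series unfolding param_def by blast
qed

end
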